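(* There exists a positive constant $A$ such that, for every real number $x>5$, $$E_{\mu}(x)=O\left(x^{1/2}\exp\left(-A(\log x\,\log\log x)^{1/3}\right)\right),$$ where the implied constant is absolute.
   Context: $\mu$ is the Möbius function, $\zeta$ is the Riemann zeta-function, $\zeta'$ is its first derivative, and $\gamma$ is the Euler--Mascheroni constant. Define $$S_{\mu}(x)=\sum_{mn\le x}\mu(\gcd(m,n)),$$ the sum running over all ordered pairs $(m,n)$ of positive integers with $mn\le x$. The error term $E_{\mu}(x)$ is defined by $$E_{\mu}(x)=S_{\mu}(x)-\frac{x}{\zeta^{2}(2)}\left(\log x+2\gamma-1-4\frac{\zeta'(2)}{\zeta(2)}\right).$$ *)

theory Defs
  imports "HOL-Analysis.Analysis" "HOL-Computational_Algebra.Computational_Algebra"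
begin

definition moebius_mu :: "nat \<Rightarrow> int" where
  "moebius_mu n = (if squarefree n then (- 1) ^ card (prime_factors n) else 0)"

(* The Riemann zeta function on its half-plane of absolute convergence, Re s > 1.
   The Dirichlet series is not meaningful elsewhere. Below it is only needed near s = 2,
   and "deriv" is the complex derivative there. *)
definition zeta :: "complex \<Rightarrow> complex" where
  "zeta s = (\<Sum>n. 1 / of_nat (Suc n) powr s)"

definition S_mu :: "real \<Rightarrow> real" where
  "S_mu x = (\<Sum>(m, n) | m > 0 \<and> n > 0 \<and> real (m * n) \<le> x. of_int (moebius_mu (gcd m n)))"

lemma finite_S_mu_range:
  "finite {(m :: nat, n :: nat). m > 0 \<and> n > 0 \<and> real (m * n) \<le> x}"
proof (rule finite_subset)
  have "m \<le> nat \<lfloor>x\<rfloor> \<and> n \<le> nat \<lfloor>x\<rfloor>"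
    if "m > 0" "n > 0" "real (m * n) \<le> x" for m n :: nat
  proof -
    have "m * n \<le> nat \<lfloor>x\<rfloor>"
      using that by (simp add: le_nat_floor)
    moreover have "m \<le> m * n" "n \<le> m * n"
      using that by simp_all
    ultimately show ?thesis
      by (blast intro: order_trans)
  qed
  then show "{(m :: nat, n :: nat). m > 0 \<and> n > 0 \<and> real (m * n) \<le> x}
               \<subseteq> {..nat \<lfloor>x\<rfloor>} \<times> {..nat \<lfloor>x\<rfloor>}"
    by blast
qed simp

(* zeta 2 and deriv zeta 2 are real numbers of type complex; Re only changes the type. *)
definition E_mu :: "real \<Rightarrow> real" where
  "E_mu x = S_mu x - x / (Re (zeta 2))\<^sup>2 *
     (ln x + 2 * euler_mascheroni - 1 - 4 * (Re (deriv zeta 2) / Re (zeta 2)))"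

end

theory Submission
  imports Defs "HOL-Number_Theory.Prime_Powers" "HOL-Complex_Analysis.Complex_Analysis" "HOL-Real_Asymp.Real_Asymp"
begin

text \<open>Since \<open>mu(gcd(m,n))\<close> is the sum of \<open>h(d)\<close> over the common divisors \<open>d\<close> of \<open>m\<close> and \<open>n\<close>, where
  \<open>h = mu * mu\<close> has Dirichlet series \<open>1 / zeta\<^sup>2\<close>, the sum \<open>S_mu x\<close> equals the sum of
  \<open>h(d) D(x / d\<^sup>2)\<close>, with \<open>D\<close> the summatory function of the number of divisors. Split at \<open>Y\<close>
  slightly below \<open>sqrt x\<close>. For \<open>d \<le> Y\<close> use \<open>D(v) = v (ln v + 2 \<gamma> - 1) + O(v powr \<theta>)\<close> with some
  \<open>\<theta> < 1/2\<close>, proved by averaging the sawtooth sum over short progressions. For \<open>d > Y\<close> sum over \<open>d\<close>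
  first and use that the partial sums of \<open>h\<close> up to \<open>u\<close> are \<open>O(u exp (- (ln u) powr \<alpha>))\<close> with
  \<open>\<alpha> > 1/3\<close>. This follows from a zero-free region of the classical kind, obtained from the \<open>3-4-1\<close>
  inequality and Landau's lemma, and from Newman's contour argument for \<open>1 / zeta\<close>.\<close>

section \<open>Dirichlet series\<close>

text \<open>Any exponent \<open>\<theta> < 1/2\<close> in the divisor problem will do, but
  \<open>\<theta> = 1/2\<close> from the bare hyperbola method will not: the errors for
  \<open>d \<le> Y\<close> add up to about
  \<open>x powr \<theta> * Y powr (1 - 2 * \<theta>)\<close>, that is,
  \<open>sqrt x * (Y / sqrt x) powr (1 - 2 * \<theta>)\<close>, times logarithms, and a gain from
  \<open>Y < sqrt x\<close> exists only if \<open>\<theta> < 1/2\<close>. Here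
  \<open>\<theta> = 19/40\<close>. The large divisors pay for a small \<open>Y\<close> with a power
  of \<open>x / Y\<^sup>2\<close>, which the decay of the partial sums of \<open>h\<close> has to
  outweigh. With \<open>Y = sqrt x * exp (- (ln x) powr \<beta>)\<close> both requirements are met
  for \<open>1/3 < \<beta> < \<alpha>\<close>; the factor \<open>ln (ln x)\<close> of the claim and
  all constants disappear in \<open>\<beta> > 1/3\<close>, whence \<open>A = 1\<close> works. The
  same device is used throughout: savings of the form \<open>exp (- (ln x) powr \<alpha>)\<close>
  are passed on with decreasing exponents
  \<open>9/20 > 2/5 > 39/100 > 38/100 > 35/100 > 1/3\<close>, and each decrease absorbs the
  constants and logarithms of one step.\<close>

lemma moebius_mu_prime_mult:
  assumes p: "prime p" and d: "\<not> p dvd d"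
  shows "moebius_mu (p * d) = - moebius_mu d"
proof -
  have "d > 0" using d by (cases d) auto
  have cop: "coprime p d" using p d by (rule prime_imp_coprime)
  have sq: "squarefree (p * d) \<longleftrightarrow> squarefree d"
    using squarefree_mult_coprime[OF cop squarefree_prime[OF p]] squarefree_multD(2)[of p d] by blast
  have "prime_factors (p * d) = insert p (prime_factors d)"
    using p \<open>d > 0\<close> by (simp add: prime_factors_product prime_prime_factors)
  moreover have "p \<notin> prime_factors d" using d by auto
  ultimately have "card (prime_factors (p * d)) = Suc (card (prime_factors d))" by simp
  with sq show ?thesis by (simp add: moebius_mu_def)
qed

lemma moebius_mu_square_dvd:
  assumes "prime p" "p * p dvd d"
  shows "moebius_mu d = 0"
proof -
  have "\<not> squarefree d" 
    using assms by (auto simp: squarefree_def power2_eq_square intro!: exI[of _ p])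
  thus ?thesis by (simp add: moebius_mu_def)
qed

text \<open>Fix a prime \<open>p\<close> dividing \<open>n\<close>. Divisors divisible by
  \<open>p * p\<close> contribute 0, and the remaining ones cancel in pairs \<open>d\<close>,
  \<open>p * d\<close>.\<close>

lemma moebius_mu_divisor_sum:
  assumes "n > 0"
  shows "(\<Sum>d | d dvd n. moebius_mu d) = (if n = 1 then 1 else 0)"
proof (cases "n = 1")
  case True
  have "{d. d dvd (1::nat)} = {1}" by auto
  moreover have "moebius_mu (Suc 0) = 1" by (simp add: moebius_mu_def)
  ultimately show ?thesis using True by simp
next
  case False
  then obtain p where p: "prime p" "p dvd n" using prime_factor_nat by blast
  let ?A = "{d. d dvd n \<and> \<not> p dvd d}" and ?B = "{d. d dvd n \<and> p dvd d \<and> \<not> p * p dvd d}"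
  have fin: "finite {d. d dvd n}" using assms by simp
  have "(\<Sum>d | d dvd n. moebius_mu d) = (\<Sum>d\<in>?A \<union> ?B. moebius_mu d)"
    using fin moebius_mu_square_dvd[OF p(1)] by (intro sum.mono_neutral_right) auto
  also have "\<dots> = sum moebius_mu ?A + sum moebius_mu ?B"
    using fin by (intro sum.union_disjoint) (auto elim: finite_subset[rotated])
  also have "sum moebius_mu ?B = (\<Sum>d\<in>?A. moebius_mu (p * d))"
  proof (rule sum.reindex_bij_witness[of _ "\<lambda>d. p * d" "\<lambda>d. d div p"])
    fix d assume "d \<in> ?B"
    thus "p * (d div p) = d" "d div p \<in> ?A" "moebius_mu (p * (d div p)) = moebius_mu d"
      using p(1) by (auto elim!: dvdE)
  next
    fix d assume d: "d \<in> ?A"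
    show "p * d div p = d" using p(1) by auto
    have "coprime p d" using p(1) d by (intro prime_imp_coprime) auto
    hence "p * d dvd n" using p d by (simp add: divides_mult)
    thus "p * d \<in> ?B" using d p(1) by auto
  qed
  also have "\<dots> = - sum moebius_mu ?A"
    using moebius_mu_prime_mult[OF p(1)] by (simp add: sum_negf)
  finally show ?thesis using False by simp
qed

lemma abs_moebius_mu_le: "\<bar>moebius_mu n\<bar> \<le> 1"
  by (simp add: moebius_mu_def)

text \<open>Reindexing \<open>(a, b)\<close> by \<open>(a * b, a)\<close> turns the double sum into
  a sum over \<open>n\<close> and its divisors; absolute convergence justifies the regrouping. The
  powers of \<open>n\<close> are part of \<open>f\<close> and \<open>g\<close>, so coefficients with
  logarithms are covered as well.\<close>

lemma dirichlet_product_has_sum: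
  fixes f g :: "nat \<Rightarrow> complex"
  assumes f: "(\<lambda>n. norm (f n)) summable_on {0<..}" and g: "(\<lambda>n. norm (g n)) summable_on {0<..}"
  shows "((\<lambda>n. \<Sum>a | a dvd n. f a * g (n div a)) has_sum (infsum f {0<..} * infsum g {0<..})) {0<..}"
proof -
  let ?P = "{0<..} :: nat set"
  have prod: "((\<lambda>(a,b). f a * g b) has_sum (infsum f ?P * infsum g ?P)) (?P \<times> ?P)"
  proof (rule has_sum_SigmaI)
    fix a show "((\<lambda>b. case (a, b) of (a, b) \<Rightarrow> f a * g b) has_sum (f a * infsum g ?P)) ?P"
      using abs_summable_summable[OF g] by (simp add: has_sum_cmult_right)
  next
    show "((\<lambda>a. f a * infsum g ?P) has_sum (infsum f ?P * infsum g ?P)) ?P"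
      using abs_summable_summable[OF f] by (simp add: has_sum_cmult_left)
  next
    have "(\<lambda>x. norm (case x of (a, b) \<Rightarrow> f a * g b)) summable_on (?P \<times> ?P)"
    proof (rule summable_on_SigmaI)
      fix a show "((\<lambda>b. norm (case (a, b) of (a, b) \<Rightarrow> f a * g b)) has_sum
                     (norm (f a) * infsum (\<lambda>b. norm (g b)) ?P)) ?P"
        using g by (simp add: has_sum_cmult_right norm_mult)
    next
      show "(\<lambda>a. norm (f a) * infsum (\<lambda>b. norm (g b)) ?P) summable_on ?P"
        using f by (intro summable_on_cmult_left)
    qed auto
    thus "(\<lambda>(a, b). f a * g b) summable_on (?P \<times> ?P)" by (rule abs_summable_summable)
  qed
  have "((\<lambda>(n,a). f a * g (n div a)) has_sum (infsum f ?P * infsum g ?P)) (Sigma ?P (\<lambda>n. {a. a dvd n}))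
        \<longleftrightarrow> ((\<lambda>(a,b). f a * g b) has_sum (infsum f ?P * infsum g ?P)) (?P \<times> ?P)"
    by (rule has_sum_reindex_bij_witness[of _ "\<lambda>(a,b). (a * b, a)" "\<lambda>(n,a). (a, n div a)"])
       (auto elim!: dvdE)
  with prod have "((\<lambda>(n,a). f a * g (n div a)) has_sum (infsum f ?P * infsum g ?P)) (Sigma ?P (\<lambda>n. {a. a dvd n}))"
    by blast
  thus ?thesis by (rule has_sum_SigmaD) auto
qed

lemma norm_of_nat_powr: "n > 0 \<Longrightarrow> norm (of_nat n powr s :: complex) = real n powr Re s"
  by (subst norm_powr_real_powr) auto

lemma of_nat_div_powr:
  assumes "a dvd n" "n > 0"
  shows "(of_nat a :: complex) powr s * of_nat (n div a) powr s = of_nat n powr s"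
  using assms by (auto elim!: dvdE simp: powr_times_real)

lemma summable_on_greaterThan_0_iff:
  fixes f :: "nat \<Rightarrow> real"
  assumes "\<And>n. n > 0 \<Longrightarrow> f n \<ge> 0"
  shows "f summable_on {0<..} \<longleftrightarrow> summable (\<lambda>n. f (Suc n))"
proof -
  have "f summable_on {0<..} \<longleftrightarrow> (\<lambda>n. f (Suc n)) summable_on UNIV"
    by (rule summable_on_reindex_bij_witness[of _ Suc "\<lambda>n. n - 1"]) auto
  also have "\<dots> \<longleftrightarrow> summable (\<lambda>n. f (Suc n))"
    by (rule summable_on_UNIV_nonneg_real_iff) (use assms in auto)
  finally show ?thesis .
qed

lemma abs_summable_dirichlet:
  fixes f :: "nat \<Rightarrow> complex"
  assumes "\<And>n. n > 0 \<Longrightarrow> norm (f n) \<le> 1" "Re s > 1"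
  shows "(\<lambda>n. norm (f n * of_nat n powr (- s))) summable_on {0<..}"
proof (rule summable_on_comparison_test)
  have "summable (\<lambda>n. real n powr (- Re s))" using assms by (simp add: summable_real_powr_iff)
  hence "summable (\<lambda>n. real (Suc n) powr (- Re s))" by (subst summable_Suc_iff)
  thus "(\<lambda>n. real n powr (- Re s)) summable_on {0<..}"
    by (subst summable_on_greaterThan_0_iff) auto
  show "norm (f n * of_nat n powr (- s)) \<le> real n powr (- Re s)" if "n \<in> {0<..}" for n
    using that mult_right_mono[OF assms(1)[of n], of "real n powr (- Re s)"]
    by (simp add: norm_mult norm_of_nat_powr)
qed auto

lemma zeta_has_sum:
  assumes "Re s > 1"
  shows "((\<lambda>n. of_nat n powr (- s)) has_sum zeta s) {0<..}"
proof -
  have "(\<lambda>n. norm (of_nat n powr (- s) :: complex)) summable_on {0<..}"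
    using abs_summable_dirichlet[of "\<lambda>_. 1" s] assms by simp
  hence "summable (\<lambda>n. norm (of_nat (Suc n) powr (- s) :: complex))"
    by (subst (asm) summable_on_greaterThan_0_iff) (auto simp del: of_nat_Suc)
  moreover have "of_nat (Suc n) powr (- s) = 1 / of_nat (Suc n) powr s" for n
    by (subst powr_minus) (simp add: field_simps)
  ultimately have "((\<lambda>n. of_nat (Suc n) powr (- s)) has_sum zeta s) UNIV"
    unfolding zeta_def 
    by (intro norm_summable_imp_has_sum) (auto simp: sums_iff summable_norm_cancel)
  also have "((\<lambda>n. of_nat (Suc n) powr (- s)) has_sum zeta s) UNIV \<longleftrightarrow> ?thesis"
    by (rule has_sum_reindex_bij_witness[of _ "\<lambda>n. n - 1" Suc]) auto
  finally show ?thesis .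
qed

lemma zeta_infsum: "Re s > 1 \<Longrightarrow> (\<Sum>\<^sub>\<infinity>n\<in>{0<..}. of_nat n powr (- s)) = zeta s"
  using zeta_has_sum by (rule infsumI)

definition mu_series :: "complex \<Rightarrow> complex" where
  "mu_series s = (\<Sum>\<^sub>\<infinity>n\<in>{0<..}. of_int (moebius_mu n) * of_nat n powr (- s))"

lemma abs_summable_mu:
  assumes "Re s > 1"
  shows "(\<lambda>n. norm (of_int (moebius_mu n) * of_nat n powr (- s) :: complex)) summable_on {0<..}"
proof (rule abs_summable_dirichlet[OF _ assms])
  show "norm (of_int (moebius_mu n) :: complex) \<le> 1" for n
    using abs_moebius_mu_le[of n] unfolding norm_of_int by linarith
qed

text \<open>Moebius inversion on the level of series. It also shows, without an Euler product, that
  \<open>zeta\<close> has no zeros for \<open>Re s > 1\<close>.\<close>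

lemma zeta_mult_mu_series:
  assumes "Re s > 1"
  shows "mu_series s * zeta s = 1"
proof -
  let ?f = "\<lambda>n. of_int (moebius_mu n) * of_nat n powr (- s) :: complex"
  let ?g = "\<lambda>n. of_nat n powr (- s) :: complex"
  have "((\<lambda>n. \<Sum>a | a dvd n. ?f a * ?g (n div a)) has_sum (infsum ?f {0<..} * infsum ?g {0<..})) {0<..}"
    using abs_summable_mu[OF assms] abs_summable_dirichlet[of "\<lambda>_. 1" s] assms
    by (intro dirichlet_product_has_sum) auto
  also have "?this \<longleftrightarrow> ((\<lambda>n::nat. if n = 1 then 1 else 0) has_sum (infsum ?f {0<..} * infsum ?g {0<..})) {0<..}"
  proof (rule has_sum_cong)
    fix n :: nat assume n: "n \<in> {0<..}"
    have "(\<Sum>a | a dvd n. ?f a * ?g (n div a)) = (\<Sum>a | a dvd n. of_int (moebius_mu a) * of_nat n powr (- s))"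
      using n by (intro sum.cong refl) (simp add: of_nat_div_powr mult.assoc)
    also have "\<dots> = of_int (\<Sum>a | a dvd n. moebius_mu a) * of_nat n powr (- s)"
      by (simp add: sum_distrib_right)
    also have "\<dots> = (if n = 1 then 1 else 0)"
      using n by (subst moebius_mu_divisor_sum) auto
    finally show "(\<Sum>a | a dvd n. ?f a * ?g (n div a)) = (if n = 1 then 1 else 0)" .
  qed
  finally have "((\<lambda>n::nat. if n = 1 then 1 else 0) has_sum (mu_series s * zeta s)) {0<..}"
    unfolding mu_series_def using zeta_infsum[OF assms] by simp
  moreover have "((\<lambda>_. 1 :: complex) has_sum 1) {1::nat}" by (intro has_sum_finiteI) auto
  hence "((\<lambda>n::nat. if n = 1 then 1 else 0 :: complex) has_sum 1) {0<..}"
    by (rule iffD1[OF has_sum_cong_neutral, rotated -1]) auto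
  ultimately show ?thesis by (rule has_sum_unique)
qed

lemma zeta_nonzero: "Re s > 1 \<Longrightarrow> zeta s \<noteq> 0"
  using zeta_mult_mu_series by force

lemma inverse_zeta: "Re s > 1 \<Longrightarrow> mu_series s = 1 / zeta s"
  using zeta_mult_mu_series zeta_nonzero by (simp add: field_simps)

lemma zeta_series_deriv:
  assumes "Re s > 1"
  shows "(zeta has_field_derivative deriv zeta s) (at s)"
    and "(\<lambda>n. ln (real n) * real n powr - Re s) summable_on {0<..}"
    and "((\<lambda>n. of_real (ln (real n)) * of_nat n powr (- s)) has_sum (- deriv zeta s)) {0<..}"
proof -
  let ?f = "\<lambda>n s. of_nat (Suc n) powr (- s) :: complex"
  let ?f' = "\<lambda>n s. - of_real (ln (real (Suc n))) * of_nat (Suc n) powr (- s) :: complex"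
  have "\<exists>g g'. \<forall>x\<in>{s. Re s > 1}. ((\<lambda>n. ?f n x) sums g x) \<and> ((\<lambda>n. ?f' n x) sums g' x) \<and> (g has_field_derivative g' x) (at x)"
  proof (rule series_and_derivative_comparison_local)
    show "open {s. Re s > 1}" by (rule open_halfspace_Re_gt)
    show "(?f n has_field_derivative ?f' n x) (at x)" for n x
      unfolding powr_def
      by (auto intro!: derivative_eq_intros simp: Ln_of_nat simp del: of_nat_Suc)
    fix x :: complex assume "x \<in> {s. Re s > 1}"
    define c where "c = (1 + Re x) / 2"
    have c: "c > 1" "c < Re x" using \<open>x \<in> _\<close> by (auto simp: c_def)
    have "norm (?f n y) \<le> real (Suc n) powr - c" if "y \<in> ball x (Re x - c)" for n y
    proof -
      have "Re y \<ge> c" using that abs_Re_le_cmod[of "x - y"] by (auto simp: dist_norm)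
      thus ?thesis by (simp add: norm_of_nat_powr powr_mono del: of_nat_Suc)
    qed
    moreover have "summable (\<lambda>n. real (Suc n) powr - c)"
      using c by (subst summable_Suc_iff) (simp add: summable_real_powr_iff)
    ultimately show "\<exists>d h. 0 < d \<and> summable h \<and>
        (\<forall>\<^sub>F n in sequentially. \<forall>y\<in>ball x d \<inter> {s. 1 < Re s}. norm (?f n y) \<le> h n)"
      using c by (intro exI[of _ "Re x - c"] exI[of _ "\<lambda>n. real (Suc n) powr - c"]) auto
  qed
  then obtain g g' where g: "\<And>x. Re x > 1 \<Longrightarrow> (\<lambda>n. ?f n x) sums g x"
      "\<And>x. Re x > 1 \<Longrightarrow> (\<lambda>n. ?f' n x) sums g' x"
      "\<And>x. Re x > 1 \<Longrightarrow> (g has_field_derivative g' x) (at x)" by blast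
  have gz: "g x = zeta x" if "Re x > 1" for x
  proof -
    have "?f n x = 1 / of_nat (Suc n) powr x" for n
      by (subst powr_minus) (simp add: field_simps)
    with g(1)[OF that] show ?thesis by (simp add: zeta_def sums_iff)
  qed
  have "(zeta has_field_derivative g' s) (at s)"
    by (rule has_field_derivative_transform_within_open[OF g(3)[OF assms] open_halfspace_Re_gt[of 1]])
       (use assms gz in auto)
  hence dz: "deriv zeta s = g' s" and "(zeta has_field_derivative deriv zeta s) (at s)"
    by (auto simp: DERIV_imp_deriv)
  thus "(zeta has_field_derivative deriv zeta s) (at s)" by simp
  \<comment> \<open>At the real point \<open>Re s\<close> all terms have the same sign, so
    convergence of the derived series there gives absolute convergence at \<open>s\<close>.\<close>
  have "summable (\<lambda>n. ?f' n (of_real (Re s)))" using g(2)[of "of_real (Re s)"] assms by (auto simp: sums_iff)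
  hence "summable (\<lambda>n. Re (- ?f' n (of_real (Re s))))" by (intro summable_Re summable_minus)
  also have "(\<lambda>n. Re (- ?f' n (of_real (Re s)))) = (\<lambda>n. ln (real (Suc n)) * real (Suc n) powr - Re s)"
  proof
    fix n
    have "(of_nat (Suc n) :: complex) powr (- of_real (Re s)) = of_real (real (Suc n) powr - Re s)"
      using powr_of_real[of "real (Suc n)" "- Re s"] by (simp del: of_nat_Suc)
    thus "Re (- ?f' n (of_real (Re s))) = ln (real (Suc n)) * real (Suc n) powr - Re s"
      by (simp del: of_nat_Suc)
  qed
  finally show sm: "(\<lambda>n. ln (real n) * real n powr - Re s) summable_on {0<..}"
    by (subst summable_on_greaterThan_0_iff) auto
  have "((\<lambda>n. - ?f' n s) has_sum (- g' s)) UNIV"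
  proof (rule norm_summable_imp_has_sum)
    show "(\<lambda>n. - ?f' n s) sums (- g' s)" using sums_minus[OF g(2)[OF assms]] .
    have "(\<lambda>n. norm (- ?f' n s)) = (\<lambda>n. ln (real (Suc n)) * real (Suc n) powr - Re s)"
      by (simp add: norm_mult norm_of_nat_powr del: of_nat_Suc)
    thus "summable (\<lambda>n. norm (- ?f' n s))"
      using sm by (subst (asm) summable_on_greaterThan_0_iff) (auto simp del: of_nat_Suc)
  qed
  also have "?this \<longleftrightarrow> ((\<lambda>n. of_real (ln (real n)) * of_nat n powr (- s)) has_sum (- g' s)) {0<..}"
    by (rule has_sum_reindex_bij_witness[of _ "\<lambda>n. n - 1" Suc]) auto
  finally show "((\<lambda>n. of_real (ln (real n)) * of_nat n powr (- s)) has_sum (- deriv zeta s)) {0<..}"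
    by (simp add: dz)
qed


section \<open>Continuation of the zeta function\<close>

lemma powr_diff_mvt:
  fixes a s :: real
  assumes a: "a > 0"
  obtains z where "a < z" "z < a + 1" "(a + 1) powr s - a powr s = s * z powr (s - 1)"
proof -
  have "\<exists>z. a < z \<and> z < a + 1 \<and> (a + 1) powr s - a powr s = (a + 1 - a) * (s * z powr (s - 1))"
    using a by (intro MVT2) (auto intro!: derivative_eq_intros)
  with that show ?thesis by auto
qed

lemma powr_tail_step:
  fixes \<sigma> :: real
  assumes "\<sigma> > 0" "n \<ge> 1"
  shows "real (Suc n) powr (- 1 - \<sigma>) \<le> (real n powr (- \<sigma>) - real (Suc n) powr (- \<sigma>)) / \<sigma>"
proof -
  obtain z where z: "real n < z" "z < real n + 1"
    "(real n + 1) powr (- \<sigma>) - real n powr (- \<sigma>) = - \<sigma> * z powr (- \<sigma> - 1)"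
    using powr_diff_mvt[of "real n" "- \<sigma>"] assms by auto
  have "(real n + 1) powr (- \<sigma> - 1) \<le> z powr (- \<sigma> - 1)"
    using z assms by (intro powr_mono2') auto
  hence "\<sigma> * (real n + 1) powr (- \<sigma> - 1) \<le> \<sigma> * z powr (- \<sigma> - 1)"
    using assms by (intro mult_left_mono) auto
  hence "\<sigma> * (real n + 1) powr (- \<sigma> - 1) \<le> real n powr (- \<sigma>) - (real n + 1) powr (- \<sigma>)"
    using z(3) by linarith
  hence "(real n + 1) powr (- \<sigma> - 1) \<le> (real n powr (- \<sigma>) - (real n + 1) powr (- \<sigma>)) / \<sigma>"
    using assms by (simp add: field_simps)
  moreover have "- 1 - \<sigma> = - \<sigma> - 1" by simp
  ultimately show ?thesis by (simp only: of_nat_Suc add.commute[of 1])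
qed

text \<open>Comparison with an integral, in telescoping form. On the right half of Newman's contour
  \<open>\<sigma>\<close> is \<open>Re z\<close>, and the blow-up of the bound as
  \<open>\<sigma>\<close> tends to 0 is cancelled by the kernel.\<close>

lemma powr_tail:
  fixes \<sigma> :: real
  assumes "\<sigma> > 0" "N \<ge> 1"
  shows "(\<lambda>n. real n powr (- 1 - \<sigma>)) summable_on {N<..}"
    and "(\<Sum>\<^sub>\<infinity>n\<in>{N<..}. real n powr (- 1 - \<sigma>)) \<le> real N powr (- \<sigma>) / \<sigma>"
proof -
  let ?f = "\<lambda>n. real n powr (- 1 - \<sigma>)" and ?g = "\<lambda>k. real (k + N) powr (- \<sigma>) / \<sigma>"
  have lim: "?g \<longlonglongrightarrow> 0"
  proof -
    have "filterlim (\<lambda>k. real (k + N)) at_top sequentially"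
      by (intro filterlim_compose[OF filterlim_real_sequentially] filterlim_add_const_nat_at_top)
    hence "(\<lambda>k. real (k + N) powr (- \<sigma>)) \<longlonglongrightarrow> 0"
      using assms(1) by (intro tendsto_neg_powr) auto
    thus ?thesis using tendsto_divide[of _ 0 sequentially "\<lambda>_. \<sigma>" \<sigma>] assms by simp
  qed
  have tel: "(\<lambda>k. ?g k - ?g (Suc k)) sums (?g 0 - 0)" by (rule telescope_sums'[OF lim])
  have le: "?f (Suc (k + N)) \<le> ?g k - ?g (Suc k)" for k
    using powr_tail_step[of \<sigma> "k + N"] assms by (simp add: diff_divide_distrib)
  have sm: "summable (\<lambda>k. ?f (Suc (k + N)))"
    by (rule summable_comparison_test'[OF sums_summable[OF tel]]) (use le in auto)
  have "(\<Sum>k. ?f (Suc (k + N))) \<le> (\<Sum>k. ?g k - ?g (Suc k))"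
    by (rule suminf_le[OF le sm sums_summable[OF tel]])
  also have "\<dots> = ?g 0" using tel by (simp add: sums_iff)
  finally have sum_le: "(\<Sum>k. ?f (Suc (k + N))) \<le> ?g 0" .
  have "((\<lambda>k. ?f (Suc (k + N))) has_sum (\<Sum>k. ?f (Suc (k + N)))) UNIV"
    using sm by (intro sums_nonneg_imp_has_sum summable_sums) auto
  also have "?this \<longleftrightarrow> (?f has_sum (\<Sum>k. ?f (Suc (k + N)))) {N<..}"
    by (rule has_sum_reindex_bij_witness[of _ "\<lambda>n. n - Suc N" "\<lambda>k. Suc (k + N)"]) auto
  finally have *: "(?f has_sum (\<Sum>k. ?f (Suc (k + N)))) {N<..}" .
  show "?f summable_on {N<..}" using * by (auto simp: summable_on_def)
  show "infsum ?f {N<..} \<le> real N powr (- \<sigma>) / \<sigma>" using infsumI[OF *] sum_le by simp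
qed

text \<open>Counterpart of \<open>powr_tail\<close> for the left half of the contour, with
  \<open>\<sigma> = - Re z\<close>. For \<open>\<sigma> \<ge> 1\<close> the summand does not
  decrease, and comparison with the integral leaves its last value over.\<close>

lemma sum_powr_le:
  fixes \<sigma> :: real
  assumes "\<sigma> > 0" "N \<ge> 1"
  shows "(\<Sum>n=1..N. real n powr (\<sigma> - 1)) \<le> real N powr \<sigma> / \<sigma> + real N powr (\<sigma> - 1)"
proof (cases "\<sigma> \<ge> 1")
  case True
  show ?thesis using assms(2)
  proof (induction N rule: dec_induct)
    case base
    show ?case using assms by simp
  next
    case (step N)
    obtain z where z: "real N < z" "(real N + 1) powr \<sigma> - real N powr \<sigma> = \<sigma> * z powr (\<sigma> - 1)"
      using powr_diff_mvt[of "real N" \<sigma>] step.hyps by auto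
    have "real N powr (\<sigma> - 1) \<le> z powr (\<sigma> - 1)" using z True by (intro powr_mono2) auto
    also have "\<dots> = ((real N + 1) powr \<sigma> - real N powr \<sigma>) / \<sigma>" using z(2) assms by simp
    finally show ?case using step.IH by (simp add: diff_divide_distrib add.commute)
  qed
next
  case False
  have "(\<Sum>n=1..N. real n powr (\<sigma> - 1)) \<le> real N powr \<sigma> / \<sigma>" using assms(2)
  proof (induction N rule: dec_induct)
    case base
    show ?case using assms False by simp
  next
    case (step N)
    obtain z where z: "real N < z" "z < real N + 1" "(real N + 1) powr \<sigma> - real N powr \<sigma> = \<sigma> * z powr (\<sigma> - 1)"
      using powr_diff_mvt[of "real N" \<sigma>] step.hyps by auto
    have "(real N + 1) powr (\<sigma> - 1) \<le> z powr (\<sigma> - 1)" using z False by (intro powr_mono2') auto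
    also have "\<dots> = ((real N + 1) powr \<sigma> - real N powr \<sigma>) / \<sigma>" using z(3) assms by simp
    finally show ?case using step.IH by (simp add: diff_divide_distrib add.commute)
  qed
  thus ?thesis by (simp add: add_increasing2)
qed

text \<open>Read through \<open>mu_series s * zeta s = 1\<close>, this is a lower bound for
  \<open>zeta\<close> to the right of 1, uniform in \<open>Im s\<close>.\<close>

lemma norm_mu_series_le:
  assumes "Re s > 1"
  shows "norm (mu_series s) \<le> 1 + 1 / (Re s - 1)"
proof -
  let ?f = "\<lambda>n. of_int (moebius_mu n) * of_nat n powr (- s) :: complex"
  have split: "{0<..} = insert 1 {Suc 0<..}" by auto
  have t: "(\<lambda>n. real n powr - Re s) summable_on {Suc 0<..}"
    "(\<Sum>\<^sub>\<infinity>n\<in>{Suc 0<..}. real n powr - Re s) \<le> 1 / (Re s - 1)"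
    using powr_tail[of "Re s - 1" "Suc 0"] assms by simp_all
  have s1: "(\<lambda>n. real n powr - Re s) summable_on {0<..}"
    unfolding split by (rule summable_on_insert_iff[THEN iffD2, OF t(1)])
  have "norm (mu_series s) \<le> (\<Sum>\<^sub>\<infinity>n\<in>{0<..}. norm (?f n))"
    unfolding mu_series_def by (rule norm_infsum_bound) (rule abs_summable_mu[OF assms])
  also have "\<dots> \<le> (\<Sum>\<^sub>\<infinity>n\<in>{0<..}. real n powr - Re s)"
  proof (rule infsum_mono[OF abs_summable_mu[OF assms] s1])
    fix n :: nat assume "n \<in> {0<..}"
    moreover have "real_of_int \<bar>moebius_mu n\<bar> \<le> 1" using abs_moebius_mu_le[of n] by linarith
    ultimately show "norm (?f n) \<le> real n powr - Re s"
      by (simp add: norm_mult norm_of_nat_powr mult_left_le_one_le)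
  qed
  also have "\<dots> = 1 + (\<Sum>\<^sub>\<infinity>n\<in>{Suc 0<..}. real n powr - Re s)"
    unfolding split by (subst infsum_insert[OF t(1)]) auto
  finally show ?thesis using t(2) by simp
qed

text \<open>\<open>zeta_reg s\<close> continues \<open>(s - 1) zeta s\<close> to \<open>Re s > 0\<close>: subtract from \<open>(s - 1) n\<^sup>-\<^sup>s\<close> the integral
  of \<open>(s - 1) u\<^sup>-\<^sup>s\<close> over \<open>[n, n + 1]\<close>.\<close>
definition zeta_term :: "nat \<Rightarrow> complex \<Rightarrow> complex" where
  "zeta_term n s = (s - 1) * of_nat n powr (- s) + of_nat (Suc n) powr (1 - s) - of_nat n powr (1 - s)"

definition zeta_reg :: "complex \<Rightarrow> complex" where
  "zeta_reg s = 1 + (\<Sum>k. zeta_term (Suc k) s)"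

text \<open>The term is the increment of \<open>?phi\<close> over \<open>[n, n + 1]\<close>. The
  derivative of \<open>?phi\<close> is \<open>s - 1\<close> times a difference of two values of
  \<open>w powr (- s)\<close>, and a second mean value estimate for this difference gains the factor
  \<open>1 / n\<close> that makes the series converge for \<open>Re s > 0\<close>.\<close>

lemma norm_zeta_term_le:
  assumes s: "Re s > 0" and n: "n > 0"
  shows "norm (zeta_term n s) \<le> norm (s - 1) * norm s * real n powr (- 1 - Re s)"
proof -
  let ?S = "closed_segment (of_nat n) (of_nat (Suc n)) :: complex set"
  have S: "\<exists>u. w = of_real u \<and> real n \<le> u \<and> u \<le> real (Suc n)" if "w \<in> ?S" for w
  proof -
    obtain t where t: "0 \<le> t" "t \<le> 1" "w = (1 - t) *\<^sub>R of_nat n + t *\<^sub>R of_nat (Suc n)"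
      using \<open>w \<in> ?S\<close> by (auto simp: in_segment)
    have "w = of_real (real n + t)" unfolding t(3) by (simp add: scaleR_conv_of_real algebra_simps)
    thus ?thesis using t by (intro exI[of _ "real n + t"]) auto
  qed
  have nonneg: "w \<notin> \<real>\<^sub>\<le>\<^sub>0" if "w \<in> ?S" for w
    using S[OF that] n by (auto simp: complex_nonpos_Reals_iff)
  have ends: "of_nat n \<in> ?S" "of_nat (Suc n) \<in> ?S" by auto
  have inner: "norm (of_nat n powr (- s) - w powr (- s)) \<le> norm s * real n powr (- 1 - Re s)" if w: "w \<in> ?S" for w
  proof -
    have "norm (of_nat n powr (- s) - w powr (- s)) \<le> norm s * real n powr (- 1 - Re s) * norm (of_nat n - w)"
    proof (rule field_differentiable_bound[OF convex_closed_segment[of "of_nat n" "of_nat (Suc n)"]])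
      fix z assume z: "z \<in> ?S"
      show "((\<lambda>w. w powr (- s)) has_field_derivative (- s * z powr (- s - 1))) (at z within ?S)"
        by (rule has_field_derivative_at_within[OF has_field_derivative_powr]) (rule nonneg[OF z])
      obtain u where u: "z = of_real u" "real n \<le> u" using S[OF z] by auto
      have "norm (z powr (- s - 1)) = u powr (- Re s - 1)"
        using u n by (subst norm_powr_real_powr) auto
      also have "\<dots> \<le> real n powr (- Re s - 1)"
        using u n s by (intro powr_mono2') auto
      also have "- Re s - 1 = - 1 - Re s" by simp
      finally show "norm (- s * z powr (- s - 1)) \<le> norm s * real n powr (- 1 - Re s)"
        by (simp add: norm_mult mult_left_mono)
    qed (use ends w in auto)
    also have "norm (of_nat n - w) \<le> 1"
    proof -
      obtain u where u: "w = of_real u" "real n \<le> u" "u \<le> real (Suc n)" using S[OF w] by auto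
      have "norm (of_nat n - w) = \<bar>real n - u\<bar>"
        unfolding u(1) by (metis norm_of_real of_real_diff of_real_of_nat_eq)
      thus ?thesis using u by simp
    qed
    finally show ?thesis by (simp add: mult_left_mono)
  qed
  let ?phi = "\<lambda>w. (s - 1) * of_nat n powr (- s) * w + w powr (1 - s)"
  have "norm (?phi (of_nat (Suc n)) - ?phi (of_nat n)) \<le>
          norm (s - 1) * (norm s * real n powr (- 1 - Re s)) * norm (of_nat (Suc n) - of_nat n :: complex)"
  proof (rule field_differentiable_bound[OF convex_closed_segment[of "of_nat n" "of_nat (Suc n)"]])
    fix z assume z: "z \<in> ?S"
    have "(?phi has_field_derivative ((s - 1) * of_nat n powr (- s) * 1 + (1 - s) * z powr (1 - s - 1))) (at z within ?S)"
      by (intro DERIV_add DERIV_cmult DERIV_ident has_field_derivative_at_within[OF has_field_derivative_powr] nonneg[OF z])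
    moreover have "(s - 1) * of_nat n powr (- s) * 1 + (1 - s) * z powr (1 - s - 1) = (s - 1) * (of_nat n powr (- s) - z powr (- s))"
      by (simp add: algebra_simps)
    ultimately show "(?phi has_field_derivative (s - 1) * (of_nat n powr (- s) - z powr (- s))) (at z within ?S)"
      by simp
    show "norm ((s - 1) * (of_nat n powr (- s) - z powr (- s))) \<le> norm (s - 1) * (norm s * real n powr (- 1 - Re s))"
      using inner[OF z] by (simp add: norm_mult mult_left_mono)
  qed (use ends in auto)
  moreover have "?phi (of_nat (Suc n)) - ?phi (of_nat n) = zeta_term n s"
    by (simp add: zeta_term_def algebra_simps)
  ultimately show ?thesis by (simp add: mult.assoc)
qed

lemma summable_Suc_powr:
  fixes \<sigma> :: real
  assumes "\<sigma> > 0"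
  shows "summable (\<lambda>k. real (Suc k) powr (- 1 - \<sigma>))" and "(\<Sum>k. real (Suc k) powr (- 1 - \<sigma>)) \<le> 1 + 1 / \<sigma>"
proof -
  let ?f = "\<lambda>n. real n powr (- 1 - \<sigma>)"
  have "summable ?f" using assms by (simp add: summable_real_powr_iff)
  thus sm: "summable (\<lambda>k. ?f (Suc k))" by (subst summable_Suc_iff)
  have t: "?f summable_on {Suc 0<..}" "infsum ?f {Suc 0<..} \<le> 1 / \<sigma>"
    using powr_tail[of \<sigma> "Suc 0"] assms by simp_all
  have split: "{0<..} = insert 1 {Suc 0<..}" by auto
  have "((\<lambda>k. ?f (Suc k)) has_sum (\<Sum>k. ?f (Suc k))) UNIV"
    using sm by (intro sums_nonneg_imp_has_sum summable_sums) auto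
  also have "?this \<longleftrightarrow> (?f has_sum (\<Sum>k. ?f (Suc k))) {0<..}"
    by (rule has_sum_reindex_bij_witness[of _ "\<lambda>n. n - 1" Suc]) auto
  finally have "(\<Sum>k. ?f (Suc k)) = infsum ?f {0<..}" by (simp add: infsumI)
  also have "\<dots> = 1 + infsum ?f {Suc 0<..}"
    unfolding split by (subst infsum_insert[OF t(1)]) auto
  finally show "(\<Sum>k. ?f (Suc k)) \<le> 1 + 1 / \<sigma>" using t(2) by simp
qed

text \<open>Serves two purposes: polynomial growth of \<open>zeta_reg\<close> in vertical strips,
  and the absence of zeros near \<open>s = 1\<close>, where the right-hand side is below 1.\<close>

lemma zeta_reg_bound:
  assumes "Re s > 0"
  shows "norm (zeta_reg s - 1) \<le> norm s * norm (s - 1) * (1 + 1 / Re s)"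
proof -
  let ?h = "\<lambda>k. norm (s - 1) * norm s * real (Suc k) powr (- 1 - Re s)"
  have b: "norm (zeta_term (Suc k) s) \<le> ?h k" for k
    by (rule norm_zeta_term_le[OF assms]) simp
  have sh: "summable ?h" by (intro summable_mult summable_Suc_powr assms)
  have sn: "summable (\<lambda>k. norm (zeta_term (Suc k) s))"
    by (rule summable_comparison_test'[OF sh]) (use b in auto)
  have "norm (zeta_reg s - 1) \<le> (\<Sum>k. norm (zeta_term (Suc k) s))"
    unfolding zeta_reg_def using summable_norm[OF sn] by simp
  also have "\<dots> \<le> suminf ?h" by (rule suminf_le[OF b sn sh])
  also have "\<dots> = norm (s - 1) * norm s * (\<Sum>k. real (Suc k) powr (- 1 - Re s))"
    by (intro suminf_mult summable_Suc_powr assms)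
  also have "\<dots> \<le> norm (s - 1) * norm s * (1 + 1 / Re s)"
    by (intro mult_left_mono summable_Suc_powr assms) auto
  finally show ?thesis by (simp add: mult_ac)
qed

lemma zeta_reg_holomorphic: "zeta_reg holomorphic_on {s. Re s > 0}"
proof -
  have "\<exists>g g'. \<forall>x\<in>{s. Re s > 0}. ((\<lambda>k. zeta_term (Suc k) x) sums g x) \<and>
          ((\<lambda>k. deriv (zeta_term (Suc k)) x) sums g' x) \<and> (g has_field_derivative g' x) (at x)"
  proof (rule series_and_derivative_comparison_local)
    show "open {s. Re s > 0}" by (rule open_halfspace_Re_gt)
    show "(zeta_term (Suc k) has_field_derivative deriv (zeta_term (Suc k)) x) (at x)" for k x
    proof (rule holomorphic_derivI[of _ UNIV])
      show "zeta_term (Suc k) holomorphic_on UNIV"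
        unfolding zeta_term_def by (intro holomorphic_intros)
    qed auto
    fix x :: complex assume "x \<in> {s. Re s > 0}"
    define d where "d = Re x / 2"
    have d: "d > 0" "Re x = 2 * d" using \<open>x \<in> _\<close> by (auto simp: d_def)
    define B where "B = (norm x + d + 1) * (norm x + d)"
    have "norm (zeta_term (Suc k) y) \<le> B * real (Suc k) powr (- 1 - d)" if y: "y \<in> ball x d" for y k
    proof -
      have Re: "Re y \<ge> d" using y abs_Re_le_cmod[of "x - y"] d by (auto simp: dist_norm)
      have ny: "norm y \<le> norm x + d"
        using y norm_triangle_ineq2[of y x] by (auto simp: dist_norm norm_minus_commute)
      hence ny1: "norm (y - 1) \<le> norm x + d + 1"
        using norm_triangle_ineq4[of y 1] by simp
      have "norm (zeta_term (Suc k) y) \<le> norm (y - 1) * norm y * real (Suc k) powr (- 1 - Re y)"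
        using Re d by (intro norm_zeta_term_le) auto
      also have "\<dots> \<le> B * real (Suc k) powr (- 1 - d)"
        unfolding B_def using Re ny ny1 d by (intro mult_mono powr_mono) (auto simp: add_nonneg_nonneg)
      finally show ?thesis .
    qed
    thus "\<exists>d h. 0 < d \<and> summable h \<and> (\<forall>\<^sub>F k in sequentially. \<forall>y\<in>ball x d \<inter> {s. 0 < Re s}. norm (zeta_term (Suc k) y) \<le> h k)"
      using d by (intro exI[of _ d] exI[of _ "\<lambda>k. B * real (Suc k) powr (- 1 - d)"] conjI summable_mult summable_Suc_powr) auto
  qed
  then obtain g g' where g: "\<And>x. Re x > 0 \<Longrightarrow> (\<lambda>k. zeta_term (Suc k) x) sums g x"
    "\<And>x. Re x > 0 \<Longrightarrow> (g has_field_derivative g' x) (at x)" by blast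
  have "(\<lambda>s. 1 + g s) holomorphic_on {s. Re s > 0}"
    by (intro holomorphic_intros) (auto simp: holomorphic_on_def field_differentiable_def
          intro: has_field_derivative_at_within g(2))
  thus ?thesis
    by (rule holomorphic_transform) (use g(1) in \<open>auto simp: zeta_reg_def sums_iff\<close>)
qed

lemma zeta_reg_eq:
  assumes "Re s > 1"
  shows "zeta_reg s = (s - 1) * zeta s"
proof -
  have "(\<lambda>k. of_nat (Suc k) powr (- s)) sums zeta s"
  proof -
    have "((\<lambda>k. of_nat (Suc k) powr (- s)) has_sum zeta s) UNIV \<longleftrightarrow> ((\<lambda>n. of_nat n powr (- s)) has_sum zeta s) {0<..}"
      by (rule has_sum_reindex_bij_witness[of _ "\<lambda>n. n - 1" Suc]) auto
    thus ?thesis using zeta_has_sum[OF assms] has_sum_imp_sums by blast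
  qed
  hence 1: "(\<lambda>k. (s - 1) * of_nat (Suc k) powr (- s)) sums ((s - 1) * zeta s)" by (rule sums_mult)
  have "(\<lambda>k. of_nat (Suc k) powr (1 - s) :: complex) \<longlonglongrightarrow> 0"
  proof (rule tendsto_norm_zero_cancel)
    have "(\<lambda>k. real (Suc k) powr (1 - Re s)) \<longlonglongrightarrow> 0"
      using assms by (intro tendsto_neg_powr filterlim_compose[OF filterlim_real_sequentially] filterlim_Suc) auto
    thus "(\<lambda>k. norm (of_nat (Suc k) powr (1 - s) :: complex)) \<longlonglongrightarrow> 0"
      by (simp add: norm_of_nat_powr del: of_nat_Suc)
  qed
  \<comment> \<open>The telescoping part starts at \<open>1 powr (1 - s) = 1\<close> and tends to 0;
    its sum -1 is compensated by the leading 1 of \<open>zeta_reg\<close>.\<close>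
  from telescope_sums[OF this]
  have "(\<lambda>k. of_nat (Suc (Suc k)) powr (1 - s) - of_nat (Suc k) powr (1 - s) :: complex) sums (0 - 1)" by simp
  from sums_add[OF 1 this] have "(\<lambda>k. zeta_term (Suc k) s) sums ((s - 1) * zeta s - 1)"
    by (simp add: zeta_term_def algebra_simps)
  thus ?thesis by (simp add: zeta_reg_def sums_iff)
qed


section \<open>Zeros and logarithmic derivatives\<close>

text \<open>On the disc \<open>f\<close> has a holomorphic logarithm; normalised to vanish at 0 and
  rescaled to the unit disc it is \<open>p\<close>, with real part below \<open>K\<close>. The map
  \<open>w \<mapsto> w / (2 * K - w)\<close> sends this half-plane into the unit disc and fixes 0,
  so Schwarz's lemma applies to \<open>q\<close>: the bound for its derivative gives the first
  claim, the bound for its size the second.\<close>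

lemma borel_caratheodory_nonvanishing:
  fixes f :: "complex \<Rightarrow> complex"
  assumes hol: "f holomorphic_on ball 0 r" and r: "r > 0"
    and nz: "\<And>z. z \<in> ball 0 r \<Longrightarrow> f z \<noteq> 0"
    and bd: "\<And>z. z \<in> ball 0 r \<Longrightarrow> norm (f z) < M"
  shows "norm (deriv f 0 / f 0) \<le> 2 / r * ln (M / norm (f 0))"
    and "\<And>z. z \<in> ball 0 r \<Longrightarrow>
           norm (f z) \<ge> norm (f 0) * exp (- (2 * ln (M / norm (f 0)) * norm z / (r - norm z)))"
proof -
  have f0: "f 0 \<noteq> 0" and M0: "norm (f 0) < M"
    using nz[of 0] bd[of 0] r by auto
  have M: "M > 0" using M0 norm_ge_zero[of "f 0"] by linarith
  define K where "K = ln (M / norm (f 0))"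
  have K: "K > 0" unfolding K_def using f0 M0 by (intro ln_gt_zero) (simp add: field_simps)
  have conv: "simply_connected (ball (0::complex) r)"
    by (simp add: convex_imp_simply_connected)
  obtain g where g: "g holomorphic_on ball 0 r" "\<And>z. z \<in> ball 0 r \<Longrightarrow> f z = exp (g z)"
    using simply_connected_eq_holomorphic_log[of "ball (0::complex) r"] conv hol nz by auto
  define p where "p z = g (of_real r * z) - g 0" for z
  have in_ball: "of_real r * z \<in> ball 0 r" if "norm z < 1" for z :: complex
    using that r by (simp add: norm_mult)
  have p_hol: "p holomorphic_on ball 0 1"
    unfolding p_def using in_ball
    by (intro holomorphic_intros holomorphic_on_compose_gen[OF _ g(1), unfolded o_def]) auto
  have p0: "p 0 = 0" by (simp add: p_def)
  have fp: "f (of_real r * z) = f 0 * exp (p z)" if "norm z < 1" for z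
    using g(2)[OF in_ball[OF that]] g(2)[of 0] r by (simp add: p_def exp_diff)
  have Rep: "Re (p z) < K" if "norm z < 1" for z
  proof -
    have "norm (f 0) * exp (Re (p z)) < M"
      using bd[OF in_ball[OF that]] fp[OF that] by (simp add: norm_mult)
    hence "exp (Re (p z)) < M / norm (f 0)" using f0 by (simp add: field_simps)
    also have "\<dots> = exp K" unfolding K_def using f0 M by simp
    finally show ?thesis by simp
  qed
  define q where "q z = p z / (2 * of_real K - p z)" for z
  have den: "2 * of_real K - p z \<noteq> 0" if "norm z < 1" for z
  proof
    assume "2 * of_real K - p z = 0"
    hence "Re (2 * of_real K - p z) = 0" by simp
    thus False using Rep[OF that] K by simp
  qed
  have q_hol: "q holomorphic_on ball 0 1"
    unfolding q_def using den by (intro holomorphic_intros p_hol) auto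
  have q_lt: "norm (q z) < 1" if "norm z < 1" for z
  proof -
    have "(norm (p z))\<^sup>2 < (norm (2 * of_real K - p z))\<^sup>2"
      using Rep[OF that] K unfolding cmod_power2 
      by (simp add: power2_eq_square algebra_simps)
    hence "norm (p z) < norm (2 * of_real K - p z)"
      by (rule power2_less_imp_less) simp
    thus ?thesis using den[OF that] by (simp add: q_def norm_divide)
  qed
  have q0: "q 0 = 0" by (simp add: q_def p0)
  have schwarz: "norm (q w) \<le> norm w" "norm (deriv q 0) \<le> 1" if "norm w < 1" for w
    using Schwarz_Lemma(1,2)[OF q_hol q0 q_lt that] by auto
  have pq: "p z * (1 + q z) = 2 * of_real K * q z" if "norm z < 1" for z
    using den[OF that] by (simp add: q_def field_simps)
  have p_der: "(p has_field_derivative deriv p 0) (at 0)"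
    using p_hol by (intro holomorphic_derivI[of _ "ball 0 1"]) auto
  have q_der: "(q has_field_derivative deriv p 0 / (2 * of_real K)) (at 0)"
    unfolding q_def
    by (rule derivative_eq_intros p_der | use K p0 in \<open>simp add: field_simps\<close>)+
  have "norm (deriv p 0 / (2 * of_real K)) \<le> 1"
    using schwarz(2)[of 0] DERIV_imp_deriv[OF q_der] by simp
  hence dp: "norm (deriv p 0) \<le> 2 * K"
    using K by (simp add: norm_divide)
  have "deriv p 0 = of_real r * deriv g 0"
  proof (rule DERIV_imp_deriv)
    have gd: "(g has_field_derivative deriv g 0) (at (of_real r * 0))"
      using holomorphic_derivI[OF g(1) open_ball, of 0] r by simp
    show "(p has_field_derivative of_real r * deriv g 0) (at 0)"
      unfolding p_def
      using DERIV_chain2[of g "deriv g 0" "\<lambda>z. of_real r * z" 0 "of_real r" UNIV, OF gd DERIV_cmult_Id]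
      by (auto intro!: derivative_eq_intros simp: mult_ac)
  qed
  moreover have "deriv f 0 = f 0 * deriv g 0"
  proof (rule DERIV_imp_deriv)
    have gd: "(g has_field_derivative deriv g 0) (at 0)"
      using g(1) r by (intro holomorphic_derivI[of _ "ball 0 r"]) auto
    have "((\<lambda>z. exp (g z)) has_field_derivative f 0 * deriv g 0) (at 0)"
      by (rule derivative_eq_intros gd refl | use g(2)[of 0] r in simp)+
    thus "(f has_field_derivative f 0 * deriv g 0) (at 0)"
      by (rule has_field_derivative_transform_within_open[where S = "ball 0 r"])
         (use g(2) r in auto)
  qed
  ultimately have "r * norm (deriv f 0 / f 0) \<le> 2 * K"
    using dp f0 r by (simp add: norm_mult)
  thus "norm (deriv f 0 / f 0) \<le> 2 / r * ln (M / norm (f 0))"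
    using r by (simp add: field_simps K_def)
  show "norm (f z) \<ge> norm (f 0) * exp (- (2 * ln (M / norm (f 0)) * norm z / (r - norm z)))"
    if z: "z \<in> ball 0 r" for z
  proof -
    define w where "w = z / of_real r"
    have w: "norm w < 1" and zw: "z = of_real r * w" and nw: "norm w = norm z / r"
      using z r by (auto simp: w_def norm_divide)
    have qw: "norm (q w) \<le> norm w" using schwarz(1)[OF w] .
    have "norm (p w) * (1 - norm w) \<le> norm (p w) * norm (1 + q w)"
    proof (intro mult_left_mono)
      have "norm (1 + q w) \<ge> norm (1 :: complex) - norm (q w)"
        using norm_triangle_ineq2[of 1 "- q w"] by simp
      thus "1 - norm w \<le> norm (1 + q w)" using qw by simp
    qed simp
    also have "\<dots> = 2 * K * norm (q w)"
      using arg_cong[OF pq[OF w], of norm] K by (simp add: norm_mult)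
    also have "\<dots> \<le> 2 * K * norm w" using qw K by (intro mult_left_mono) auto
    finally have "norm (p w) \<le> 2 * K * norm w / (1 - norm w)"
      using w by (simp add: field_simps)
    also have "\<dots> = 2 * K * norm z / (r - norm z)"
      using r z by (simp add: nw field_simps)
    finally have *: "norm (p w) \<le> 2 * K * norm z / (r - norm z)" .
    have "- (2 * K * norm z / (r - norm z)) \<le> Re (p w)"
      using * abs_Re_le_cmod[of "p w"] by linarith
    hence "exp (- (2 * K * norm z / (r - norm z))) \<le> exp (Re (p w))" by simp
    thus ?thesis using fp[OF w] unfolding K_def zw[symmetric]
      by (simp add: norm_mult mult_left_mono)
  qed
qed

text \<open>Dividing by the Blaschke factor \<open>R (z - a) / (R\<^sup>2 - cnj a z)\<close>, which is unimodular on the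
  circle \<open>norm z = R\<close>, removes a zero without increasing the bound.\<close>
lemma blaschke_quotient:
  fixes f :: "complex \<Rightarrow> complex"
  assumes hol: "f holomorphic_on S" and S: "open S" "cball 0 R \<subseteq> S"
    and bd: "\<And>z. z \<in> cball 0 R \<Longrightarrow> norm (f z) < M"
    and a: "a \<in> ball 0 R" "f a = 0" "a \<noteq> 0" and f0: "f 0 \<noteq> 0"
  obtains g where "g holomorphic_on S" "\<And>z. z \<in> cball 0 R \<Longrightarrow> norm (g z) < M"
    "norm (g 0) = norm (f 0) * (R / norm a)" "\<And>z. z \<in> S \<Longrightarrow> g z = 0 \<Longrightarrow> z \<in> ball 0 R \<Longrightarrow> f z = 0"
    "Re (deriv f 0 / f 0) = Re (deriv g 0 / g 0) - Re a * (1 / (norm a)\<^sup>2 - 1 / R\<^sup>2)"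
proof -
  have R: "R > 0" using a by (metis ball_eq_empty empty_iff not_le)
  have aS: "a \<in> S" using a S by auto
  define h where "h z = (if z = a then deriv f a else (f z - f a) / (z - a))" for z
  have h_hol: "h holomorphic_on S" unfolding h_def by (rule pole_lemma_open[OF hol S(1)])
  have fh: "f z = (z - a) * h z" for z using a by (simp add: h_def)
  define g where "g z = h z * ((of_real R)\<^sup>2 - cnj a * z) / of_real R" for z
  have g_hol: "g holomorphic_on S" unfolding g_def by (intro holomorphic_intros h_hol) (use R in auto)
  have fg: "f z * ((of_real R)\<^sup>2 - cnj a * z) = of_real R * (z - a) * g z" for z
    using R by (simp add: fh g_def)
  have den: "(of_real R)\<^sup>2 - cnj a * z \<noteq> 0" if "z \<in> cball 0 R" for z
  proof
    assume "(of_real R)\<^sup>2 - cnj a * z = 0"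
    hence "norm ((of_real R)\<^sup>2 :: complex) = norm a * norm z"
      by (metis complex_mod_cnj eq_iff_diff_eq_0 norm_mult)
    hence "R * R = norm a * norm z" using R by (simp add: norm_power power2_eq_square[of R])
    moreover have "norm a * norm z < R * R"
    proof -
      have "norm a * norm z \<le> norm a * R" using that by (intro mult_left_mono) auto
      also have "\<dots> < R * R" using a R by simp
      finally show ?thesis .
    qed
    ultimately show False by simp
  qed
  have g_sphere: "norm (g z) = norm (f z)" if z: "norm z = R" for z
  proof -
    have "(of_real R)\<^sup>2 - cnj a * z = z * cnj (z - a)"
      using z by (simp add: algebra_simps complex_norm_square[symmetric])
    hence "norm ((of_real R)\<^sup>2 - cnj a * z) = R * norm (z - a)"
      by (simp only: norm_mult complex_mod_cnj z)
    moreover have "z \<noteq> a" using z a by auto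
    ultimately show ?thesis using arg_cong[OF fg[of z], of norm] R by (simp add: norm_mult)
  qed
  have cont_f: "continuous_on (sphere 0 R) (\<lambda>z. norm (f z))"
    using holomorphic_on_imp_continuous_on[OF hol] S
    by (intro continuous_on_norm) (meson continuous_on_subset order_trans sphere_cball)
  \<comment> \<open>The maximum over the sphere is attained, which keeps the bound for
    \<open>g\<close> strict.\<close>
  obtain z0 where z0: "z0 \<in> sphere 0 R" "\<And>z. z \<in> sphere 0 R \<Longrightarrow> norm (f z) \<le> norm (f z0)"
    using continuous_attains_sup[OF compact_sphere _ cont_f] R by auto
  have g_bd: "norm (g z) < M" if "z \<in> cball 0 R" for z
  proof -
    have "norm (g z) \<le> norm (f z0)"
    proof (rule maximum_modulus_frontier[where S = "cball 0 R" and f = g])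
      have "g holomorphic_on cball 0 R" by (rule holomorphic_on_subset[OF g_hol S(2)])
      thus "g holomorphic_on interior (cball 0 R)" "continuous_on (closure (cball 0 R)) g"
        by (auto intro: holomorphic_on_imp_continuous_on elim: holomorphic_on_subset)
    qed (use that z0 g_sphere in auto)
    also have "\<dots> < M" using bd[of z0] z0 by auto
    finally show ?thesis .
  qed
  have g0: "g 0 * of_real R * a = - f 0 * (of_real R)\<^sup>2" using fg[of 0] by (simp add: algebra_simps)
  have "norm (g 0) * R * norm a = norm (f 0) * R\<^sup>2"
    using arg_cong[OF g0, of norm] R by (simp add: norm_mult norm_power)
  hence ng0: "norm (g 0) = norm (f 0) * (R / norm a)"
    using R a by (simp add: field_simps power2_eq_square)
  have S0: "0 \<in> S" using S R by auto
  have df: "(f has_field_derivative deriv f 0) (at 0)" and dg: "(g has_field_derivative deriv g 0) (at 0)"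
    using hol g_hol S S0 by (auto intro: holomorphic_derivI)
  \<comment> \<open>Both sides of \<open>fg\<close> are differentiated at 0. After division this
    exhibits the logarithmic derivative of the Blaschke factor at 0, namely
    \<open>- 1 / a + cnj a / R\<^sup>2\<close>.\<close>
  have "((\<lambda>z. f z * ((of_real R)\<^sup>2 - cnj a * z)) has_field_derivative
          (deriv f 0 * (of_real R)\<^sup>2 - f 0 * cnj a)) (at 0)"
    by (rule derivative_eq_intros df refl | simp)+
  moreover have "((\<lambda>z. of_real R * (z - a) * g z) has_field_derivative
          (of_real R * g 0 - of_real R * a * deriv g 0)) (at 0)"
    by (rule derivative_eq_intros dg refl | simp)+
  ultimately have der: "deriv f 0 * (of_real R)\<^sup>2 - f 0 * cnj a = of_real R * g 0 - of_real R * a * deriv g 0"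
    unfolding fg by (rule DERIV_unique)
  have "of_real R * (g 0 * a) = of_real R * (- f 0 * of_real R)"
    using g0 by (simp add: power2_eq_square mult_ac)
  hence "g 0 * a = - f 0 * of_real R" using R by (subst (asm) mult_left_cancel) auto
  hence g0': "g 0 = - f 0 * of_real R / a" using a by (simp add: field_simps)
  have gne: "g 0 \<noteq> 0" using g0' f0 R a by simp
  have "deriv f 0 / f 0 = deriv g 0 / g 0 - 1 / a + cnj a / (of_real R)\<^sup>2"
  proof -
    have fR: "f 0 * of_real R = - (g 0 * a)" using g0' a by simp
    have "deriv f 0 / f 0 - cnj a / (of_real R)\<^sup>2 =
            (deriv f 0 * (of_real R)\<^sup>2 - f 0 * cnj a) / (f 0 * (of_real R)\<^sup>2)"
      using f0 R by (simp add: divide_simps)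
    also have "\<dots> = (of_real R * (g 0 - a * deriv g 0)) / (of_real R * (f 0 * of_real R))"
      unfolding der by (simp add: power2_eq_square algebra_simps)
    also have "\<dots> = (g 0 - a * deriv g 0) / (- (g 0 * a))"
      unfolding fR using R by simp
    also have "\<dots> = deriv g 0 / g 0 - 1 / a"
      using gne a by (simp add: field_simps)
    finally show ?thesis by (simp add: algebra_simps)
  qed
  hence "Re (deriv f 0 / f 0) = Re (deriv g 0 / g 0) - Re (1 / a) + Re (cnj a / (of_real R)\<^sup>2)" by simp
  moreover have "Re (1 / a) = Re a / (norm a)\<^sup>2" by (simp add: Re_divide cmod_power2)
  moreover have "Re (cnj a / (of_real R)\<^sup>2) = Re a / R\<^sup>2"
    by (simp flip: of_real_power)
  ultimately have "Re (deriv f 0 / f 0) = Re (deriv g 0 / g 0) - Re a * (1 / (norm a)\<^sup>2 - 1 / R\<^sup>2)"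
    by (simp add: algebra_simps)
  moreover have "f z = 0" if "g z = 0" "z \<in> ball 0 R" for z
    using fg[of z] den[of z] that by auto
  ultimately show ?thesis using that g_hol g_bd ng0 by blast
qed

text \<open>Dividing out a zero raises \<open>norm (f 0)\<close> by a factor of at least \<open>R / r\<close> and preserves the
  bound \<open>M\<close>, so the hypothesis on \<open>n\<close> bounds the number of zeros in the disc.\<close>
lemma landau_log_deriv_nat:
  fixes f :: "complex \<Rightarrow> complex"
  assumes "0 < r" "r < R" "open S" "cball 0 R \<subseteq> S"
    and "f holomorphic_on S" "\<And>z. z \<in> cball 0 R \<Longrightarrow> norm (f z) < M" "f 0 \<noteq> 0"
    and "\<And>z. z \<in> ball 0 r \<Longrightarrow> f z = 0 \<Longrightarrow> Re z \<le> 0"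
    and "M < norm (f 0) * (R / r) ^ n"
  shows "- Re (deriv f 0 / f 0) \<le> 2 / r * ln (M / norm (f 0))"
  using assms(5-)
proof (induction n arbitrary: f)
  case 0
  \<comment> \<open>For \<open>n = 0\<close> the hypothesis \<open>M < norm (f 0)\<close>
    contradicts the bound at the centre.\<close>
  from "0"(2)[of 0] "0"(5) assms(1,2) have False by simp
  thus ?case ..
next
  case (Suc n)
  show ?case
  proof (cases "\<exists>a\<in>ball 0 r. f a = 0")
    case False
    have sub: "ball 0 r \<subseteq> S" using assms(1-4) by auto
    have "norm (deriv f 0 / f 0) \<le> 2 / r * ln (M / norm (f 0))"
      by (rule borel_caratheodory_nonvanishing(1))
         (use Suc.prems(2,3) False sub assms(1,2) holomorphic_on_subset[OF Suc.prems(1) sub] in auto)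
    thus ?thesis using abs_Re_le_cmod[of "deriv f 0 / f 0"] by linarith
  next
    case True
    then obtain a where a: "a \<in> ball 0 r" "f a = 0" by auto
    have a0: "a \<noteq> 0" using a Suc.prems by auto
    have Rea: "Re a \<le> 0" using Suc.prems(4) a by auto
    have aR: "a \<in> ball 0 R" using a assms by auto
    obtain g where g: "g holomorphic_on S" "\<And>z. z \<in> cball 0 R \<Longrightarrow> norm (g z) < M"
      "norm (g 0) = norm (f 0) * (R / norm a)"
      "\<And>z. z \<in> S \<Longrightarrow> g z = 0 \<Longrightarrow> z \<in> ball 0 R \<Longrightarrow> f z = 0"
      "Re (deriv f 0 / f 0) = Re (deriv g 0 / g 0) - Re a * (1 / (norm a)\<^sup>2 - 1 / R\<^sup>2)"
      using blaschke_quotient[OF Suc.prems(1) assms(3,4) Suc.prems(2) aR a(2) a0 Suc.prems(3)] by metis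
    have na: "0 < norm a" "norm a < r" using a a0 by auto
    have g0: "norm (f 0) \<le> norm (g 0)" "norm (f 0) * (R / r) \<le> norm (g 0)"
      using na assms Suc.prems(3) unfolding g(3) by (simp_all add: field_simps)
    have M: "M > 0" using le_less_trans[OF norm_ge_zero Suc.prems(2)[of 0]] assms by simp
    have "- Re (deriv g 0 / g 0) \<le> 2 / r * ln (M / norm (g 0))"
    proof (rule Suc.IH[OF g(1,2)])
      show "g 0 \<noteq> 0" using g0 Suc.prems(3) by auto
      show "Re z \<le> 0" if "z \<in> ball 0 r" "g z = 0" for z
        by (rule Suc.prems(4)[OF that(1)], rule g(4)) (use that assms in auto)
      have "M < norm (f 0) * (R / r) * (R / r) ^ n" using Suc.prems(5) by (simp add: mult_ac)
      also have "\<dots> \<le> norm (g 0) * (R / r) ^ n"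
        using g0 assms by (intro mult_right_mono) auto
      finally show "M < norm (g 0) * (R / r) ^ n" .
    qed auto
    also have "M / norm (g 0) \<le> M / norm (f 0)"
      using g0 Suc.prems(3) M by (intro divide_left_mono mult_pos_pos) auto
    hence "2 / r * ln (M / norm (g 0)) \<le> 2 / r * ln (M / norm (f 0))"
      using g0 \<open>f 0 \<noteq> 0\<close> M assms(1) by (intro mult_left_mono ln_mono divide_pos_pos) (auto intro: less_le_trans[of 0 "norm (f 0)"])
    finally have "- Re (deriv g 0 / g 0) \<le> 2 / r * ln (M / norm (f 0))" .
    \<comment> \<open>A zero with \<open>Re a \<le> 0\<close> only lowers
      \<open>- Re (deriv f 0 / f 0)\<close>, so its contribution may be dropped from an upper
      bound.\<close>
    moreover have "1 / (norm a)\<^sup>2 - 1 / R\<^sup>2 \<ge> 0"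
      using na assms by (simp add: frac_le power_mono)
    hence "Re a * (1 / (norm a)\<^sup>2 - 1 / R\<^sup>2) \<le> 0"
      using Rea by (intro mult_nonpos_nonneg) auto
    ultimately show ?thesis using g(5) by linarith
  qed
qed

text \<open>The zeros in the inner disc lie where they help, so none of them has to be located or
  counted; any \<open>n\<close> large enough starts the induction. The second part retains the
  contribution of a single zero, later the hypothetical one close to the line
  \<open>Re s = 1\<close>.\<close>

lemma landau_log_deriv:
  fixes f :: "complex \<Rightarrow> complex"
  assumes rR: "0 < r" "r < R" and S: "open S" "cball 0 R \<subseteq> S"
    and hol: "f holomorphic_on S" and bd: "\<And>z. z \<in> cball 0 R \<Longrightarrow> norm (f z) < M" and f0: "f 0 \<noteq> 0"
    and zeros: "\<And>z. z \<in> ball 0 r \<Longrightarrow> f z = 0 \<Longrightarrow> Re z \<le> 0"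
  shows "- Re (deriv f 0 / f 0) \<le> 2 / r * ln (M / norm (f 0))"
    and "\<And>a. a \<in> ball 0 r \<Longrightarrow> f a = 0 \<Longrightarrow>
           - Re (deriv f 0 / f 0) \<le> 2 / r * ln (M / norm (f 0)) + Re a * (1 / (norm a)\<^sup>2 - 1 / R\<^sup>2)"
proof -
  have M: "M > 0" using le_less_trans[OF norm_ge_zero bd[of 0]] rR by simp
  have main: "- Re (deriv g 0 / g 0) \<le> 2 / r * ln (M / norm (g 0))"
    if "g holomorphic_on S" "\<And>z. z \<in> cball 0 R \<Longrightarrow> norm (g z) < M" "g 0 \<noteq> 0"
     "\<And>z. z \<in> ball 0 r \<Longrightarrow> g z = 0 \<Longrightarrow> Re z \<le> 0" for g
  proof -
    obtain n where "M / norm (g 0) < (R / r) ^ n"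
      using real_arch_pow[of "R / r"] rR by auto
    hence "M < norm (g 0) * (R / r) ^ n" using that(3) by (simp add: field_simps)
    thus ?thesis by (intro landau_log_deriv_nat[OF rR S that]) auto
  qed
  show "- Re (deriv f 0 / f 0) \<le> 2 / r * ln (M / norm (f 0))"
    by (rule main[OF hol bd f0 zeros])
  fix a assume a: "a \<in> ball 0 r" "f a = 0"
  have a0: "a \<noteq> 0" using a f0 by auto
  have aR: "a \<in> ball 0 R" using a rR by auto
  obtain g where g: "g holomorphic_on S" "\<And>z. z \<in> cball 0 R \<Longrightarrow> norm (g z) < M"
    "norm (g 0) = norm (f 0) * (R / norm a)"
    "\<And>z. z \<in> S \<Longrightarrow> g z = 0 \<Longrightarrow> z \<in> ball 0 R \<Longrightarrow> f z = 0"
    "Re (deriv f 0 / f 0) = Re (deriv g 0 / g 0) - Re a * (1 / (norm a)\<^sup>2 - 1 / R\<^sup>2)"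
    using blaschke_quotient[OF hol S bd aR a(2) a0 f0] by metis
  have na: "0 < norm a" "norm a < r" using a a0 by auto
  have "1 \<le> R / norm a" using na rR by (simp add: field_simps)
  hence "norm (f 0) * 1 \<le> norm (g 0)" unfolding g(3) by (intro mult_left_mono) auto
  hence g0: "norm (f 0) \<le> norm (g 0)" "g 0 \<noteq> 0" using f0 by auto
  have "- Re (deriv g 0 / g 0) \<le> 2 / r * ln (M / norm (g 0))"
  proof (rule main[OF g(1,2) g0(2)])
    show "Re z \<le> 0" if "z \<in> ball 0 r" "g z = 0" for z
      by (rule zeros[OF that(1)], rule g(4)) (use that rR S in auto)
  qed auto
  also have "M / norm (g 0) \<le> M / norm (f 0)"
    using g0 f0 M by (intro divide_left_mono mult_pos_pos) auto
  hence "2 / r * ln (M / norm (g 0)) \<le> 2 / r * ln (M / norm (f 0))"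
    using g0 f0 M rR by (intro mult_left_mono ln_mono divide_pos_pos) auto
  finally show "- Re (deriv f 0 / f 0) \<le> 2 / r * ln (M / norm (f 0)) + Re a * (1 / (norm a)\<^sup>2 - 1 / R\<^sup>2)"
    using g(5) by linarith
qed


section \<open>The zero-free region\<close>

lemma mangoldt_le_ln:
  assumes "n > 0"
  shows "mangoldt n \<le> ln (real n)"
proof -
  have "mangoldt n \<le> (\<Sum>d | d dvd n. mangoldt d :: real)"
    using assms by (intro member_le_sum mangoldt_nonneg) auto
  also have "\<dots> = ln (real n)" using mangoldt_sum[of n, where 'a = real] assms by simp
  finally show ?thesis .
qed

text \<open>The Dirichlet convolution of \<open>mangoldt\<close> with 1 is \<open>ln\<close>, so the
  series times \<open>zeta s\<close> equals \<open>- deriv zeta s\<close>.\<close>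

lemma mangoldt_has_sum:
  assumes s: "Re s > 1"
  shows "((\<lambda>n. mangoldt n * of_nat n powr (- s)) has_sum (- deriv zeta s / zeta s)) {0<..}"
proof -
  let ?f = "\<lambda>n. mangoldt n * of_nat n powr (- s) :: complex"
  let ?g = "\<lambda>n. of_nat n powr (- s) :: complex"
  have f: "(\<lambda>n. norm (?f n)) summable_on {0<..}"
  proof (rule summable_on_comparison_test[OF zeta_series_deriv(2)[OF s]])
    fix n :: nat assume "n \<in> {0<..}"
    thus "norm (?f n) \<le> ln (real n) * real n powr - Re s"
      using mult_right_mono[OF mangoldt_le_ln[of n], of "real n powr - Re s"]
      by (simp add: norm_mult norm_of_nat_powr)
  qed auto
  have "((\<lambda>n. \<Sum>a | a dvd n. ?f a * ?g (n div a)) has_sum (infsum ?f {0<..} * infsum ?g {0<..})) {0<..}"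
    using f abs_summable_dirichlet[of "\<lambda>_. 1" s] s by (intro dirichlet_product_has_sum) auto
  also have "?this \<longleftrightarrow> ((\<lambda>n. of_real (ln (real n)) * of_nat n powr (- s)) has_sum (infsum ?f {0<..} * infsum ?g {0<..})) {0<..}"
  proof (rule has_sum_cong)
    fix n :: nat assume n: "n \<in> {0<..}"
    have "(\<Sum>a | a dvd n. ?f a * ?g (n div a)) = (\<Sum>a | a dvd n. mangoldt a * of_nat n powr (- s))"
      using n by (intro sum.cong refl) (simp add: of_nat_div_powr mult.assoc)
    also have "\<dots> = (\<Sum>a | a dvd n. mangoldt a) * of_nat n powr (- s)"
      by (simp add: sum_distrib_right)
    also have "\<dots> = of_real (ln (real n)) * of_nat n powr (- s)"
      using n by (subst mangoldt_sum) auto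
    finally show "(\<Sum>a | a dvd n. ?f a * ?g (n div a)) = of_real (ln (real n)) * of_nat n powr (- s)" .
  qed
  finally have "infsum ?f {0<..} * zeta s = - deriv zeta s"
    using zeta_series_deriv(3)[OF s] zeta_infsum[OF s] by (auto dest: has_sum_unique)
  hence "infsum ?f {0<..} = - deriv zeta s / zeta s"
    using zeta_nonzero[OF s] by (simp add: field_simps)
  with has_sum_infsum[OF abs_summable_summable[OF f]] show ?thesis by simp
qed

text \<open>The identity \<open>3 + 4 * cos \<theta> + cos (2 * \<theta>) = 2 * (1 + cos
  \<theta>)\<^sup>2\<close> with \<open>\<theta> = t * ln n\<close>, summed against the nonnegative
  weights \<open>mangoldt n * n powr (- (1 + \<eta>))\<close>.\<close>

lemma three_four_one:
  fixes \<eta> t :: real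
  assumes "\<eta> > 0"
  defines "F \<equiv> \<lambda>s. - deriv zeta s / zeta s"
  shows "3 * Re (F (Complex (1 + \<eta>) 0)) + 4 * Re (F (Complex (1 + \<eta>) t)) + Re (F (Complex (1 + \<eta>) (2 * t))) \<ge> 0"
proof -
  let ?a = "\<lambda>n. mangoldt n * real n powr (- (1 + \<eta>)) :: real"
  have 1: "((\<lambda>n. ?a n * cos (u * ln (real n))) has_sum Re (F (Complex (1 + \<eta>) u))) {0<..}" for u
  proof -
    have "((\<lambda>n. Re (mangoldt n * of_nat n powr (- Complex (1 + \<eta>) u))) has_sum Re (F (Complex (1 + \<eta>) u))) {0<..}"
      unfolding F_def using assms(1) by (intro has_sum_Re mangoldt_has_sum) auto
    also have "?this \<longleftrightarrow> ?thesis"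
    proof (rule has_sum_cong)
      fix n :: nat assume n: "n \<in> {0<..}"
      have "Re (of_nat n powr (- Complex (1 + \<eta>) u)) = real n powr (- (1 + \<eta>)) * cos (u * ln (real n))"
        using n by (simp add: powr_def Re_exp Ln_of_nat algebra_simps)
      moreover have "mangoldt n = (of_real (mangoldt n) :: complex)" by simp
      ultimately show "Re (mangoldt n * of_nat n powr (- Complex (1 + \<eta>) u)) = ?a n * cos (u * ln (real n))"
        by (simp add: mult.assoc del: of_real_mangoldt)
    qed
    finally show ?thesis .
  qed
  have "((\<lambda>n. 3 * (?a n * cos (0 * ln (real n))) + 4 * (?a n * cos (t * ln (real n))) + ?a n * cos (2 * t * ln (real n)))
     has_sum (3 * Re (F (Complex (1 + \<eta>) 0)) + 4 * Re (F (Complex (1 + \<eta>) t)) + Re (F (Complex (1 + \<eta>) (2 * t))))) {0<..}"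
    by (intro has_sum_add has_sum_cmult_right 1)
  thus ?thesis
  proof (rule has_sum_nonneg)
    fix n :: nat
    define \<theta> where "\<theta> = t * ln (real n)"
    have "cos (2 * t * ln (real n)) = 2 * (cos \<theta>)\<^sup>2 - 1"
      using cos_double_cos[of \<theta>] by (simp add: \<theta>_def mult.assoc)
    moreover have "3 * (A * cos (0 * L)) + 4 * (A * C) + A * D = A * (2 * (1 + C)\<^sup>2)"
      if "D = 2 * C\<^sup>2 - 1" for A C D L :: real
      unfolding that by (simp add: power2_eq_square algebra_simps)
    ultimately have "3 * (?a n * cos (0 * ln (real n))) + 4 * (?a n * cos (t * ln (real n))) + ?a n * cos (2 * t * ln (real n))
       = ?a n * (2 * (1 + cos \<theta>)\<^sup>2)"
      by (simp only: \<theta>_def)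
    also have "\<dots> \<ge> 0" by (intro mult_nonneg_nonneg mangoldt_nonneg) auto
    finally show "0 \<le> 3 * (?a n * cos (0 * ln (real n))) + 4 * (?a n * cos (t * ln (real n))) + ?a n * cos (2 * t * ln (real n))" .
  qed
qed

lemma zeta_reg_nonzero_right: "Re s > 1 \<Longrightarrow> zeta_reg s \<noteq> 0"
  using zeta_reg_eq[of s] zeta_nonzero[of s] by auto

text \<open>One factor \<open>Re s - 1\<close> comes from the bound for \<open>mu_series\<close>,
  the other from \<open>norm (s - 1)\<close>. The loss is affordable: later \<open>Re s - 1\<close>
  is a negative power of \<open>ln T\<close>, up to a constant.\<close>

lemma zeta_reg_lower:
  assumes "Re s > 1" "Re s \<le> 2"
  shows "norm (zeta_reg s) \<ge> (Re s - 1)\<^sup>2 / 2"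
proof -
  let ?e = "Re s - 1"
  have e: "?e > 0" using assms by simp
  have "1 = norm (mu_series s) * norm (zeta s)"
    using zeta_mult_mu_series[OF assms(1)] by (metis norm_mult norm_one)
  also have "\<dots> \<le> (1 + 1 / ?e) * norm (zeta s)"
    by (intro mult_right_mono norm_mu_series_le assms) auto
  also have "1 \<le> 1 / ?e" using assms by simp
  hence "1 + 1 / ?e \<le> 2 / ?e" by linarith
  hence "(1 + 1 / ?e) * norm (zeta s) \<le> 2 / ?e * norm (zeta s)" by (intro mult_right_mono) auto
  finally have *: "?e / 2 \<le> norm (zeta s)" using e by (simp add: field_simps)
  have "?e * (?e / 2) \<le> norm (s - 1) * norm (zeta s)"
    using * e abs_Re_le_cmod[of "s - 1"] by (intro mult_mono) auto
  thus ?thesis using zeta_reg_eq[OF assms(1)] by (simp add: norm_mult power2_eq_square)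
qed

lemma zeta_reg_upper:
  assumes "Re s \<ge> 1/2" "norm s \<le> X" "norm (s - 1) \<le> X" "X \<ge> 2"
  shows "norm (zeta_reg s) < 4 * X\<^sup>2"
proof -
  have "norm (zeta_reg s) \<le> 1 + norm (zeta_reg s - 1)"
    using norm_triangle_ineq[of 1 "zeta_reg s - 1"] by simp
  also have "norm (zeta_reg s - 1) \<le> norm s * norm (s - 1) * (1 + 1 / Re s)"
    using assms by (intro zeta_reg_bound) auto
  also have "\<dots> \<le> X * X * 3"
    using assms by (intro mult_mono) (auto simp: field_simps)
  also have "1 + X * X * 3 < 4 * X\<^sup>2"
    using mult_mono[OF assms(4) assms(4)] assms(4) by (simp add: power2_eq_square)
  finally show ?thesis by simp
qed

text \<open>Landau's lemma for \<open>zeta_reg\<close> on the discs of radii 1/4 and 1/2 about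
  \<open>Complex (1 + \<eta>) t\<close>. In \<open>K\<close> the quotient of the upper bound
  \<open>4 * (T + 2)\<^sup>2\<close> by the lower bound \<open>\<eta>\<^sup>2 / 2\<close> appears;
  the term \<open>Re (1 / Complex \<eta> t)\<close> stems from the factor \<open>s - 1\<close>, that
  is, from the pole of \<open>zeta\<close>.\<close>

lemma zeta_log_deriv_bound:
  fixes \<eta> t T :: real
  assumes \<eta>: "0 < \<eta>" "\<eta> \<le> 1/8" and t: "\<bar>t\<bar> \<le> T"
  defines "F \<equiv> \<lambda>s. - deriv zeta s / zeta s"
  defines "K \<equiv> 8 * ln (8 * (T + 2)\<^sup>2 / \<eta>\<^sup>2)"
  shows "Re (F (Complex (1 + \<eta>) t)) \<le> K + Re (1 / Complex \<eta> t)"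
    and "\<And>\<beta>. zeta_reg (Complex \<beta> t) = 0 \<Longrightarrow> \<beta> > 3/4 + \<eta> \<Longrightarrow>
         Re (F (Complex (1 + \<eta>) t)) \<le> K + Re (1 / Complex \<eta> t) - 1 / (1 + \<eta> - \<beta>) + 4 * (1 + \<eta> - \<beta>)"
proof -
  define s0 where "s0 = Complex (1 + \<eta>) t"
  define f where "f z = zeta_reg (s0 + z)" for z
  define S where "S = {z. Re z > - Re s0}"
  define M where "M = 4 * (T + 2)\<^sup>2"
  have S: "open S" "cball 0 (1/2) \<subseteq> S"
  proof -
    show "open S" unfolding S_def by (rule open_halfspace_Re_gt)
    show "cball 0 (1/2) \<subseteq> S"
    proof
      fix z :: complex assume "z \<in> cball 0 (1/2)"
      thus "z \<in> S" using abs_Re_le_cmod[of z] \<eta> by (auto simp: S_def s0_def)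
    qed
  qed
  have hol: "f holomorphic_on S"
    unfolding f_def by (rule holomorphic_on_compose_gen[of "\<lambda>z. s0 + z" S zeta_reg, unfolded o_def])
      (auto intro!: holomorphic_intros zeta_reg_holomorphic simp: S_def)
  have bd: "norm (f z) < M" if z: "z \<in> cball 0 (1/2)" for z
    unfolding f_def M_def
  proof (rule zeta_reg_upper)
    have z': "norm z \<le> 1/2" using z by simp
    show "Re (s0 + z) \<ge> 1/2" using abs_Re_le_cmod[of z] z' \<eta> by (simp add: s0_def)
    have "norm s0 \<le> (1 + \<eta>) + \<bar>t\<bar>" unfolding s0_def using cmod_le[of "Complex (1 + \<eta>) t"] \<eta> by simp
    thus "norm (s0 + z) \<le> T + 2" using norm_triangle_ineq[of s0 z] z' \<eta> t by linarith
    have "norm (s0 - 1) \<le> \<eta> + \<bar>t\<bar>" unfolding s0_def using cmod_le[of "Complex (1 + \<eta>) t - 1"] \<eta> by simp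
    thus "norm (s0 + z - 1) \<le> T + 2" using norm_triangle_ineq[of "s0 - 1" z] z' \<eta> t
      by (simp add: algebra_simps)
    show "T + 2 \<ge> 2" using t by linarith
  qed
  have f0': "norm (f 0) \<ge> \<eta>\<^sup>2 / 2"
    using zeta_reg_lower[of s0] \<eta> by (simp add: f_def s0_def)
  have f0: "f 0 \<noteq> 0" using \<eta> by (simp add: f_def s0_def zeta_reg_nonzero_right)
  have zeros: "Re z \<le> 0" if "f z = 0" for z
    using that zeta_reg_nonzero_right[of "s0 + z"] \<eta> by (force simp: f_def s0_def)
  have s0: "Re s0 > 1" using \<eta> by (simp add: s0_def)
  have "s0 \<noteq> 1" using s0 by auto
  have der: "deriv f 0 / f 0 = 1 / (s0 - 1) + deriv zeta s0 / zeta s0"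
  proof -
    have "(zeta_reg has_field_derivative (1 * zeta s0 + deriv zeta s0 * (s0 - 1))) (at s0)"
    proof (rule has_field_derivative_transform_within_open[OF _ open_halfspace_Re_gt[of 1]])
      show "((\<lambda>s. (s - 1) * zeta s) has_field_derivative (1 * zeta s0 + deriv zeta s0 * (s0 - 1))) (at s0)"
        by (rule derivative_eq_intros zeta_series_deriv(1) s0 refl | simp)+
    qed (use s0 zeta_reg_eq in auto)
    hence "(f has_field_derivative (zeta s0 + deriv zeta s0 * (s0 - 1)) * 1) (at 0)"
      unfolding f_def by (intro DERIV_chain2[where f = zeta_reg]) (auto intro!: derivative_eq_intros)
    hence "deriv f 0 = zeta s0 + deriv zeta s0 * (s0 - 1)" by (simp add: DERIV_imp_deriv)
    moreover have "f 0 = (s0 - 1) * zeta s0" using zeta_reg_eq[OF s0] by (simp add: f_def)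
    ultimately have "deriv f 0 / f 0 = (zeta s0 + deriv zeta s0 * (s0 - 1)) / ((s0 - 1) * zeta s0)" by simp
    also have "\<dots> = 1 / (s0 - 1) + deriv zeta s0 / zeta s0"
      using zeta_nonzero[OF s0] \<open>s0 \<noteq> 1\<close> by (simp add: add_divide_distrib)
    finally show ?thesis .
  qed
  have s01: "s0 - 1 = Complex \<eta> t" by (simp add: s0_def complex_eq_iff)
  have F: "Re (F s0) = - Re (deriv f 0 / f 0) + Re (1 / Complex \<eta> t)"
    unfolding der s01 F_def by simp
  have K: "2 / (1/4) * ln (M / norm (f 0)) \<le> K"
  proof -
    have "M > 0" unfolding M_def using t by auto
    moreover have "norm (f 0) > 0" using f0 by simp
    ultimately have "M / norm (f 0) \<le> M / (\<eta>\<^sup>2 / 2)" "0 < M / norm (f 0)"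
      using \<eta> by (auto simp only: intro!: divide_left_mono[OF f0'] divide_pos_pos mult_pos_pos) auto
    hence "ln (M / norm (f 0)) \<le> ln (M / (\<eta>\<^sup>2 / 2))" by (subst ln_le_cancel_iff) auto
    thus ?thesis by (simp add: K_def M_def field_simps)
  qed
  note L = landau_log_deriv[of "1/4" "1/2" S f M, OF _ _ S hol bd f0 zeros, simplified]
  show "Re (F (Complex (1 + \<eta>) t)) \<le> K + Re (1 / Complex \<eta> t)"
    using L(1) K F unfolding s0_def by simp
  fix \<beta> assume \<beta>: "zeta_reg (Complex \<beta> t) = 0" "\<beta> > 3/4 + \<eta>"
  define x where "x = 1 + \<eta> - \<beta>"
  have "\<beta> \<le> 1" using \<beta>(1) zeta_reg_nonzero_right[of "Complex \<beta> t"] by force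
  hence x: "0 < x" "x < 1/4" using \<beta> \<eta> by (auto simp: x_def)
  have fa: "f (of_real (- x)) = 0"
  proof -
    have "s0 + of_real (- x) = Complex \<beta> t" by (simp add: s0_def x_def complex_eq_iff)
    thus ?thesis using \<beta>(1) by (simp add: f_def)
  qed
  have "- Re (deriv f 0 / f 0) \<le> 8 * ln (M / norm (f 0)) + (- x) * (1 / x\<^sup>2 - 4)"
    using L(2)[of "of_real (- x)"] fa x by (simp add: power2_eq_square)
  also have "(- x) * (1 / x\<^sup>2 - 4) = - (1 / x) + 4 * x"
    using x by (simp add: power2_eq_square field_simps)
  finally show "Re (F (Complex (1 + \<eta>) t)) \<le> K + Re (1 / Complex \<eta> t) - 1 / (1 + \<eta> - \<beta>) + 4 * (1 + \<eta> - \<beta>)"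
    using K F unfolding s0_def x_def[symmetric] by simp
qed

text \<open>A zero with real part at least \<open>1 - \<eta> / 8\<close> has distance
  \<open>x \<le> 9/8 * \<eta>\<close> from \<open>1 + \<eta> + i t\<close>, so in the 3-4-1
  inequality it contributes \<open>4 / x \<ge> 32 / (9 * \<eta>)\<close>. The pole supplies only
  \<open>3 / \<eta>\<close>, and by hypothesis all other terms are at most
  \<open>1 / (2 * \<eta>)\<close>; but \<open>32/9 > 7/2\<close>. The height is doubled because the
  inequality involves \<open>2 * t\<close>.\<close>

lemma zeta_reg_zero_free:
  fixes \<eta> T :: real
  assumes \<eta>: "0 < \<eta>" "\<eta> \<le> 1/8"
    and K: "64 * ln (8 * (2 * T + 2)\<^sup>2 / \<eta>\<^sup>2) + 44 \<le> 1 / (2 * \<eta>)"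
    and s: "Re s \<ge> 1 - \<eta> / 8" "\<bar>Im s\<bar> \<le> T"
  shows "zeta_reg s \<noteq> 0"
proof
  assume z: "zeta_reg s = 0"
  define \<beta> t where "\<beta> = Re s" and "t = Im s"
  have sc: "s = Complex \<beta> t" by (simp add: \<beta>_def t_def)
  have \<beta>1: "\<beta> \<le> 1" using z zeta_reg_nonzero_right[of s] by (force simp: \<beta>_def)
  have \<beta>0: "\<beta> \<ge> 1 - \<eta> / 8" using s by (simp add: \<beta>_def)
  show False
  proof (cases "\<bar>t\<bar> < 1/8")
    \<comment> \<open>Near the real axis the pole terms at heights \<open>t\<close> and
      \<open>2 * t\<close> are not small and the inequality is of no use, but there
      \<open>zeta_reg\<close> differs from 1 by at most 7/12.\<close>
    case True
    have "norm (s - 1) \<le> (1 - \<beta>) + \<bar>t\<bar>"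
      using cmod_le[of "s - 1"] \<beta>1 by (simp add: sc)
    hence n1: "norm (s - 1) \<le> 1/6" using True \<beta>0 \<eta> by linarith
    have n2: "norm s \<le> 7/6" using n1 norm_triangle_ineq[of "s - 1" 1] by simp
    have "1 = norm (zeta_reg s - 1)" using z by simp
    also have "\<dots> \<le> norm s * norm (s - 1) * (1 + 1 / Re s)"
      using \<beta>0 \<eta> by (intro zeta_reg_bound) (simp add: \<beta>_def)
    also have "\<dots> \<le> (7/6) * (1/6) * 3"
      using n1 n2 \<beta>0 \<eta> unfolding \<beta>_def by (intro mult_mono) (auto simp: field_simps)
    finally show False by simp
  next
    case False
    define F where "F s = - deriv zeta s / zeta s" for s
    define K' where "K' = 8 * ln (8 * (2 * T + 2)\<^sup>2 / \<eta>\<^sup>2)"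
    define x where "x = 1 + \<eta> - \<beta>"
    have x: "0 < x" "x \<le> 9/8 * \<eta>" using \<beta>0 \<beta>1 \<eta> by (auto simp: x_def)
    have tT: "\<bar>t\<bar> \<le> 2 * T" "\<bar>2 * t\<bar> \<le> 2 * T" "\<bar>0::real\<bar> \<le> 2 * T" using s by (auto simp: t_def)
    have r: "Re (1 / Complex \<eta> u) \<le> 64 * \<eta>" if "\<bar>u\<bar> \<ge> 1/8" for u
    proof -
      have "u\<^sup>2 \<ge> 1/64" using power_mono[OF that, of 2] by (simp add: power2_eq_square)
      hence "1/64 \<le> \<eta>\<^sup>2 + u\<^sup>2" using zero_le_power2[of \<eta>] by linarith
      hence "\<eta> / (\<eta>\<^sup>2 + u\<^sup>2) \<le> \<eta> / (1/64)" using \<eta> by (intro divide_left_mono) (auto intro!: mult_pos_pos add_pos_nonneg)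
      thus ?thesis by (simp add: Re_divide)
    qed
    have r0: "Re (1 / Complex \<eta> 0) = 1 / \<eta>" using \<eta> by (simp add: Re_divide power2_eq_square)
    have "0 \<le> 3 * Re (F (Complex (1 + \<eta>) 0)) + 4 * Re (F (Complex (1 + \<eta>) t)) + Re (F (Complex (1 + \<eta>) (2 * t)))"
      unfolding F_def by (rule three_four_one[OF \<eta>(1)])
    moreover have "Re (F (Complex (1 + \<eta>) 0)) \<le> K' + 1 / \<eta>"
      using zeta_log_deriv_bound(1)[OF \<eta> tT(3)] unfolding F_def K'_def r0 .
    moreover have "Re (F (Complex (1 + \<eta>) t)) \<le> K' + 64 * \<eta> - 1 / x + 4 * x"
      using zeta_log_deriv_bound(2)[OF \<eta> tT(1), of \<beta>] r[of t] False z \<beta>0 \<eta> unfolding F_def K'_def x_def sc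
      by simp
    moreover have "Re (F (Complex (1 + \<eta>) (2 * t))) \<le> K' + 64 * \<eta>"
      using zeta_log_deriv_bound(1)[OF \<eta> tT(2)] r[of "2 * t"] False unfolding F_def K'_def abs_mult by simp
    ultimately have "4 * (1 / x) \<le> 3 * (1 / \<eta>) + (8 * K' + 16 * x + 320 * \<eta>)" by (simp add: algebra_simps)
    \<comment> \<open>From \<open>x \<le> 9/8 * \<eta>\<close> and \<open>\<eta> \<le> 1/8\<close>
      the last two terms are at most \<open>338/8\<close>, which the constant 44 in the hypothesis
      covers.\<close>
    also have "8 * K' + 16 * x + 320 * \<eta> \<le> 1 / (2 * \<eta>)"
      using K x \<eta> unfolding K'_def by simp
    also have "3 * (1 / \<eta>) + 1 / (2 * \<eta>) = 7 / (2 * \<eta>)" using \<eta> by (simp add: field_simps)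
    finally have "8 * \<eta> \<le> 7 * x" using x \<eta> by (simp add: field_simps)
    thus False using x \<eta> by simp
  qed
qed


section \<open>Sums of the Moebius function\<close>

text \<open>The lower bound \<open>a\<close> at a point \<open>s0\<close> just right of the line
  \<open>Re s = 1\<close> is carried across it inside the disc of radius \<open>W\<close> about
  \<open>s0\<close>, which is free of zeros. Since \<open>s\<close> is within \<open>W / 10\<close>
  of \<open>s0\<close>, the quotient \<open>norm z / (W - norm z)\<close> is at most 1/9, and the
  loss is only \<open>(M / a) powr (2/9)\<close>. As \<open>M\<close> grows like
  \<open>T\<^sup>2\<close>, this is about \<open>T powr (4/9)\<close>; the denominator 20 is chosen
  to stay below \<open>T powr (1/2)\<close>.\<close>

lemma zeta_reg_strip_lower:
  fixes W T :: real
  assumes W: "0 < W" "W \<le> 1/4" and T: "T \<ge> 0"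
    and nz: "\<And>s. Re s \<ge> 1 - W \<Longrightarrow> \<bar>Im s\<bar> \<le> T + 1 \<Longrightarrow> zeta_reg s \<noteq> 0"
    and s: "\<bar>Re s - 1\<bar> \<le> W / 20" "\<bar>Im s\<bar> \<le> T"
  defines "a \<equiv> (W / 20)\<^sup>2 / 2" and "M \<equiv> 4 * (T + 4)\<^sup>2"
  shows "norm (zeta_reg s) \<ge> a * exp (- (2 / 9 * ln (M / a)))"
proof -
  define s0 where "s0 = Complex (1 + W / 20) (Im s)"
  define f where "f z = zeta_reg (s0 + z)" for z
  have Re_z: "\<bar>Re z\<bar> < W" "\<bar>Im z\<bar> < W" if "z \<in> ball 0 W" for z
    using that abs_Re_le_cmod[of z] abs_Im_le_cmod[of z] by auto
  have hol: "f holomorphic_on ball 0 W"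
    unfolding f_def
  proof (rule holomorphic_on_compose_gen[of "\<lambda>z. s0 + z" _ zeta_reg, unfolded o_def])
    show "(\<lambda>z. s0 + z) ` ball 0 W \<subseteq> {s. Re s > 0}"
    proof safe
      fix z :: complex assume "z \<in> ball 0 W"
      from Re_z[OF this] W show "Re (s0 + z) > 0" by (simp add: s0_def)
    qed
  qed (auto intro!: holomorphic_intros zeta_reg_holomorphic)
  have nz': "f z \<noteq> 0" if "z \<in> ball 0 W" for z
    unfolding f_def using Re_z[OF that] W s by (intro nz) (auto simp: s0_def)
  have bd: "norm (f z) < M" if z: "z \<in> ball 0 W" for z
    unfolding f_def M_def
  proof (rule zeta_reg_upper)
    show "Re (s0 + z) \<ge> 1/2" using Re_z[OF z] W by (simp add: s0_def)
    have "norm s0 \<le> (1 + W / 20) + \<bar>Im s\<bar>" unfolding s0_def using cmod_le[of "Complex (1 + W/20) (Im s)"] W by simp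
    thus "norm (s0 + z) \<le> T + 4" using norm_triangle_ineq[of s0 z] z W s by simp
    have "norm (s0 - 1) \<le> W / 20 + \<bar>Im s\<bar>" unfolding s0_def using cmod_le[of "Complex (1 + W/20) (Im s) - 1"] W by simp
    thus "norm (s0 + z - 1) \<le> T + 4" using norm_triangle_ineq[of "s0 - 1" z] z W s
      by (simp add: algebra_simps)
    show "T + 4 \<ge> 2" using T by linarith
  qed
  have a: "a > 0" using W by (simp add: a_def)
  have a_le: "a \<le> norm (f 0)"
    using zeta_reg_lower[of s0] W by (simp add: f_def s0_def a_def)
  have M0: "norm (f 0) < M" using bd[of 0] W by simp
  define z where "z = s - s0"
  have z: "norm z \<le> W / 10"
  proof -
    have "norm z = \<bar>Re s - 1 - W / 20\<bar>" by (simp add: z_def s0_def cmod_eq_Re)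
    thus ?thesis using s by linarith
  qed
  \<comment> \<open>In this form the expression is visibly increasing in \<open>a\<close>, so the
    unknown \<open>norm (f 0)\<close> can be replaced by its lower bound.\<close>
  have "a * exp (- (2 / 9 * ln (M / a))) = a powr (11/9) * M powr (- 2/9)" if "a > 0" "M > 0" for a M :: real
  proof -
    have "a * exp (- (2 / 9 * ln (M / a))) = exp (ln a) * exp (- (2 / 9 * (ln M - ln a)))"
      using that by (simp add: ln_div)
    also have "\<dots> = exp (11/9 * ln a + (-2/9) * ln M)"
      unfolding exp_add[symmetric] by (simp add: field_simps)
    also have "\<dots> = a powr (11/9) * M powr (- 2/9)"
      using that by (subst exp_add) (simp add: powr_def)
    finally show ?thesis .
  qed
  note eq = this
  have Mpos: "M > 0" using M0 by (rule le_less_trans[OF norm_ge_zero])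
  have "a * exp (- (2 / 9 * ln (M / a))) \<le> norm (f 0) * exp (- (2 / 9 * ln (M / norm (f 0))))"
    unfolding eq[OF a Mpos] eq[OF less_le_trans[OF a a_le] Mpos]
    using a a_le by (intro mult_right_mono powr_mono2) auto
  also have "\<dots> \<le> norm (f 0) * exp (- (2 * ln (M / norm (f 0)) * norm z / (W - norm z)))"
  proof -
    have "norm z / (W - norm z) \<le> 1 / 9" using z W by (simp add: field_simps)
    moreover have "ln (M / norm (f 0)) \<ge> 0" using M0 a a_le by (intro ln_ge_zero) (subst le_divide_eq_1_pos, auto)
    ultimately have "2 * ln (M / norm (f 0)) * (norm z / (W - norm z)) \<le> 2 * ln (M / norm (f 0)) * (1/9)"
      by (intro mult_left_mono) auto
    thus ?thesis by (intro mult_left_mono) auto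
  qed
  also have "\<dots> \<le> norm (f z)"
    by (rule borel_caratheodory_nonvanishing(2)[OF hol W(1) nz' bd]) (use z W in auto)
  also have "f z = zeta_reg s" by (simp add: f_def z_def)
  finally show ?thesis .
qed

text \<open>The parametrisation of the circle starts at angle 0, in the middle of the right half;
  periodicity moves the last quarter to the front.\<close>

lemma contour_integral_circlepath_split:
  assumes r: "r > 0" and f: "continuous_on (sphere 0 r) f"
  shows "contour_integral (circlepath 0 r) f =
         contour_integral (part_circlepath 0 r (- pi / 2) (pi / 2)) f +
         contour_integral (part_circlepath 0 r (pi / 2) (3 * pi / 2)) f"
proof -
  define h where "h t = f (r * cis t) * r * \<i> * cis t" for t
  have cont: "continuous_on A h" for A
    unfolding h_def
    by (intro continuous_intros continuous_on_compose2[OF f]) (use r in \<open>auto simp: norm_mult\<close>)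
  have eq: "contour_integral (part_circlepath 0 r a b) f = integral {a..b} h" if "a < b" for a b
    using that by (subst contour_integral_part_circlepath_eq) (simp_all add: h_def[abs_def])
  have int: "h integrable_on {a..b}" for a b
    by (intro integrable_continuous_real cont)
  have shift: "integral {3 * pi / 2..2 * pi} h = integral {- pi / 2..0} h"
  proof -
    have "integral {- pi / 2..0} (h \<circ> (+) (2 * pi)) = integral {3 * pi / 2..2 * pi} h"
      using integral_shift_Icc_real[of "- pi / 2" 0 h "2 * pi"] by simp
    moreover have "h \<circ> (+) (2 * pi) = h" by (simp add: h_def fun_eq_iff flip: cis_mult)
    ultimately show ?thesis by simp
  qed
  have "contour_integral (circlepath 0 r) f = integral {0..2 * pi} h"
    unfolding circlepath_def by (rule eq) simp
  also have "\<dots> = integral {0..pi / 2} h + integral {pi / 2..2 * pi} h"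
    by (rule Henstock_Kurzweil_Integration.integral_combine[symmetric]) (use int in auto)
  also have "integral {pi / 2..2 * pi} h = integral {pi / 2..3 * pi / 2} h + integral {3 * pi / 2..2 * pi} h"
    by (rule Henstock_Kurzweil_Integration.integral_combine[symmetric]) (use int in auto)
  also have "integral {0..pi / 2} h + (integral {pi / 2..3 * pi / 2} h + integral {3 * pi / 2..2 * pi} h) =
      (integral {- pi / 2..0} h + integral {0..pi / 2} h) + integral {pi / 2..3 * pi / 2} h"
    unfolding shift by simp
  also have "integral {- pi / 2..0} h + integral {0..pi / 2} h = integral {- pi / 2..pi / 2} h"
    by (rule Henstock_Kurzweil_Integration.integral_combine) (use int in auto)
  finally show ?thesis by (simp add: eq)
qed

text \<open>On the circle \<open>1 / z = cnj z / R\<^sup>2\<close>, so the kernel is real there. It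
  vanishes at the two points with \<open>Re z = 0\<close>, which compensates the factors
  \<open>1 / \<bar>Re z\<bar>\<close> in the estimates for the Dirichlet series.\<close>

lemma newman_kernel_circle:
  assumes "norm z = R" "R > 0"
  shows "norm (1 / z + z / of_real R ^ 2 :: complex) = 2 * \<bar>Re z\<bar> / R\<^sup>2"
proof -
  have "z \<noteq> 0" using assms by auto
  have "z * cnj z = of_real R ^ 2" using assms complex_norm_square[of z] by simp
  hence "1 / z = cnj z / of_real R ^ 2" using \<open>z \<noteq> 0\<close> assms by (simp add: field_simps)
  hence "1 / z + z / of_real R ^ 2 = (z + cnj z) / of_real R ^ 2" by (simp add: add_divide_distrib)
  also have "\<dots> = of_real (2 * Re z / R\<^sup>2)" by (simp add: complex_add_cnj)
  finally have "norm (1 / z + z / of_real R ^ 2) = \<bar>2 * Re z / R\<^sup>2\<bar>" by (simp only: norm_of_real)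
  thus ?thesis by (simp add: abs_mult)
qed

text \<open>Newman's contour argument for \<open>1 / zeta (1 + z)\<close>. As this vanishes at \<open>z = 0\<close>, its product with
  the kernel \<open>N\<^sup>z (1 / z + z / R\<^sup>2)\<close> has no pole, so only the Dirichlet polynomial leaves a residue.\<close>
lemma newman_moebius_bound:
  fixes R W \<delta> B :: real and N :: nat
  assumes N: "N \<ge> 1" and R: "R \<ge> 1" and \<delta>: "0 < \<delta>" "\<delta> < W" "W < 1" and B: "B \<ge> 0"
    and nz: "\<And>s. Re s \<ge> 1 - W \<Longrightarrow> \<bar>Im s\<bar> \<le> R + 1 \<Longrightarrow> zeta_reg s \<noteq> 0"
    and lower: "\<And>s. \<bar>Re s - 1\<bar> \<le> \<delta> \<Longrightarrow> \<bar>Im s\<bar> \<le> R \<Longrightarrow> norm (1 / zeta_reg s) \<le> B"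
  shows "\<bar>\<Sum>n=1..N. of_int (moebius_mu n) / real n\<bar> \<le> 2 / R + 1 / N + B * (1 / R + R * real N powr (- \<delta>))"
proof -
  define P where "P z = (\<Sum>n=1..N. of_int (moebius_mu n) * of_nat n powr (- 1 - z) :: complex)" for z
  \<comment> \<open>This is \<open>k z / zeta (1 + z)\<close>: writing
    \<open>1 / zeta (1 + z) = z / zeta_reg (1 + z)\<close>, the factor \<open>z\<close> is
    multiplied into the kernel, so that \<open>G\<close> makes sense at 0 and to the left of the
    line.\<close>
  define G where "G z = of_nat N powr z * (1 + z\<^sup>2 / of_real R ^ 2) / zeta_reg (1 + z)" for z
  define k where "k z = of_nat N powr z * (1 / z + z / of_real R ^ 2 :: complex)" for z
  define ra la where "ra = part_circlepath 0 R (- pi / 2) (pi / 2)" and "la = part_circlepath 0 R (pi / 2) (3 * pi / 2)"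
  define V where "V = {z. Re z > - W} \<inter> {z. Im z < R + 1} \<inter> {z. Im z > - (R + 1)}"
  have V: "convex V"
    unfolding V_def by (intro convex_Int convex_halfspace_Re_gt convex_halfspace_Im_lt convex_halfspace_Im_gt)
  have G_hol: "G holomorphic_on V"
  proof -
    have "(\<lambda>z. zeta_reg (1 + z)) holomorphic_on V"
      by (rule holomorphic_on_compose_gen[of "\<lambda>z. 1 + z" _ zeta_reg, unfolded o_def])
         (use \<delta> in \<open>auto intro!: holomorphic_intros zeta_reg_holomorphic simp: V_def\<close>)
    thus ?thesis unfolding G_def by (intro holomorphic_intros) (use nz R in \<open>auto simp: V_def\<close>)
  qed
  have sphere_V: "z \<in> V" if "norm z = R" "Re z \<ge> 0" for z
    using that abs_Im_le_cmod[of z] \<delta> by (auto simp: V_def)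
  have ra_im: "norm z = R \<and> Re z \<ge> 0" if "z \<in> path_image ra" for z
    using that R unfolding ra_def path_image_part_circlepath'
    by (auto simp: norm_mult cos_ge_zero closed_segment_eq_real_ivl)
  have la_im: "norm z = R \<and> Re z \<le> 0" if z: "z \<in> path_image la" for z
  proof -
    obtain t where t: "pi / 2 \<le> t" "t \<le> 3 * pi / 2" "z = R * cis t"
      using z R unfolding la_def path_image_part_circlepath'
      by (auto simp: closed_segment_eq_real_ivl)
    have "cos (t - pi) \<ge> 0" using t by (intro cos_ge_zero) auto
    hence "cos t \<le> 0" by (simp add: cos_diff)
    thus ?thesis using t R by (auto simp: norm_mult mult_nonneg_nonpos)
  qed
  have ends: "pathstart ra = - (\<i> * R)" "pathfinish ra = \<i> * R"
    unfolding ra_def pathstart_part_circlepath pathfinish_part_circlepath cis_conv_exp[symmetric]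
    by (simp_all add: complex_eq_iff)
  define p q where "p = Complex (- \<delta>) R" and "q = Complex (- \<delta>) (- R)"
  define l1 l2 l3 where "l1 = linepath (\<i> * R) p" and "l2 = linepath p q" and "l3 = linepath q (- (\<i> * R))"
  have corners: "\<i> * R \<in> V" "p \<in> V" "q \<in> V" "- (\<i> * R) \<in> V"
    using \<delta> R by (auto simp: V_def p_def q_def)
  have l_sub: "path_image l1 \<subseteq> V" "path_image l2 \<subseteq> V" "path_image l3 \<subseteq> V"
    unfolding l1_def l2_def l3_def path_image_linepath
    by (rule closed_segment_subset[OF _ _ V]; (rule corners))+
  have ra_sub: "path_image ra \<subseteq> V" using ra_im sphere_V by auto
  \<comment> \<open>The right arc followed by three sides of a rectangle reaching to
    \<open>Re z = - \<delta>\<close> is closed and stays in the convex set \<open>V\<close>, where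
    \<open>G\<close> is holomorphic. The arc can therefore be exchanged for the sides.\<close>
  have cauchy: "(G has_contour_integral 0) (ra +++ l1 +++ l2 +++ l3)"
    by (rule Cauchy_theorem_convex_simple[OF G_hol V])
       (use l_sub ra_sub ends in \<open>auto simp: l1_def l2_def l3_def ra_def[symmetric] path_image_join
          intro!: valid_path_join\<close>, auto simp: ra_def)
  have valid: "valid_path ra" "valid_path l1" "valid_path l2" "valid_path l3" "valid_path la"
    by (auto simp: ra_def l1_def l2_def l3_def la_def)
  have G_cont: "continuous_on V G" by (rule holomorphic_on_imp_continuous_on[OF G_hol])
  have G_int: "G contour_integrable_on ra" "G contour_integrable_on l1" "G contour_integrable_on l2" "G contour_integrable_on l3"
    unfolding ra_def l1_def l2_def l3_def
    by (intro contour_integrable_continuous_part_circlepath contour_integrable_continuous_linepath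
          continuous_on_subset[OF G_cont] ra_sub[unfolded ra_def] l_sub[unfolded l1_def l2_def l3_def path_image_linepath])+
  have sum0: "contour_integral ra G + (contour_integral l1 G + (contour_integral l2 G + contour_integral l3 G)) = 0"
  proof -
    have "(G has_contour_integral (contour_integral ra G + (contour_integral l1 G + (contour_integral l2 G + contour_integral l3 G))))
      (ra +++ l1 +++ l2 +++ l3)"
      by (intro has_contour_integral_join has_contour_integral_integral G_int valid_path_join valid)
         (auto simp: l1_def l2_def l3_def)
    thus ?thesis using cauchy has_contour_integral_unique by blast
  qed
  have normN: "norm (of_nat N powr z :: complex) = real N powr Re z" for z
    using N by (intro norm_of_nat_powr) auto
  have normZ: "norm (1 / zeta_reg (1 + z)) \<le> B" if "\<bar>Re z\<bar> \<le> \<delta>" "\<bar>Im z\<bar> \<le> R" for z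
    using that by (intro lower) auto
  \<comment> \<open>The factor \<open>1 + z\<^sup>2 / R\<^sup>2\<close> vanishes at the two corners
    on the imaginary axis, hence is \<open>O(1 / R)\<close> on the horizontal sides.\<close>
  have horiz: "norm (G z) \<le> B * (3 / R)" if z: "Re z \<in> {-\<delta>..0}" "\<bar>Im z\<bar> = R" for z
  proof -
    have "1 + z\<^sup>2 / of_real R ^ 2 = (of_real R ^ 2 + z\<^sup>2) / of_real R ^ 2"
      using R by (simp add: field_simps)
    also have "of_real R ^ 2 + z\<^sup>2 = Complex ((Re z)\<^sup>2) (2 * Re z * Im z)"
    proof -
      have "(Im z)\<^sup>2 = R\<^sup>2" using z(2) by (metis power2_abs)
      thus ?thesis by (simp add: complex_eq_iff power2_eq_square flip: of_real_power)
    qed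
    finally have "norm (1 + z\<^sup>2 / of_real R ^ 2) \<le> ((Re z)\<^sup>2 + 2 * \<bar>Re z\<bar> * R) / R\<^sup>2"
      using cmod_le[of "Complex ((Re z)\<^sup>2) (2 * Re z * Im z)"] z R
      by (simp add: norm_divide norm_power abs_mult divide_right_mono)
    also have "\<dots> \<le> (1 * R + 2 * 1 * R) / R\<^sup>2"
    proof -
      have "\<bar>Re z\<bar> \<le> 1" using z \<delta> by auto
      moreover from this have "(Re z)\<^sup>2 \<le> 1" by (simp add: abs_square_le_1)
      ultimately show ?thesis using R by (intro divide_right_mono add_mono mult_mono) auto
    qed
    also have "\<dots> = 3 / R" using R by (simp add: power2_eq_square)
    finally have 1: "norm (1 + z\<^sup>2 / of_real R ^ 2) \<le> 3 / R" .
    have 2: "real N powr Re z \<le> 1" using z N powr_mono[of "Re z" 0 "real N"] by simp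
    have "norm (G z) = real N powr Re z * norm (1 + z\<^sup>2 / of_real R ^ 2) * norm (1 / zeta_reg (1 + z))"
      by (simp add: G_def norm_mult norm_divide normN)
    also have "\<dots> \<le> 1 * (3 / R) * B"
      using 1 2 z \<delta> R B by (intro mult_mono normZ) auto
    finally show ?thesis by (simp add: mult_ac)
  qed
  have vert: "norm (G z) \<le> B * 3 * real N powr (- \<delta>)" if z: "Re z = - \<delta>" "\<bar>Im z\<bar> \<le> R" for z
  proof -
    have "norm (1 + z\<^sup>2 / of_real R ^ 2) \<le> 1 + (norm z)\<^sup>2 / R\<^sup>2"
      using norm_triangle_ineq[of 1 "z\<^sup>2 / of_real R ^ 2"] R by (simp add: norm_divide norm_power)
    also have "(norm z)\<^sup>2 = \<delta>\<^sup>2 + (Im z)\<^sup>2" using z by (simp add: cmod_power2)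
    also have "\<dots> \<le> R\<^sup>2 + R\<^sup>2" using z \<delta> R by (intro add_mono) (auto simp: abs_le_square_iff[symmetric])
    hence "1 + (\<delta>\<^sup>2 + (Im z)\<^sup>2) / R\<^sup>2 \<le> 3" using R by (simp add: field_simps)
    finally have 1: "norm (1 + z\<^sup>2 / of_real R ^ 2) \<le> 3" .
    have "norm (G z) = real N powr (- \<delta>) * norm (1 + z\<^sup>2 / of_real R ^ 2) * norm (1 / zeta_reg (1 + z))"
      by (simp add: G_def norm_mult norm_divide normN z)
    also have "\<dots> \<le> real N powr (- \<delta>) * 3 * B"
      using 1 z \<delta> R B by (intro mult_mono normZ) auto
    finally show ?thesis by (simp add: mult_ac)
  qed
  have seg_re: "Re z \<in> {-\<delta>..0} \<and> \<bar>Im z\<bar> = R" if "z \<in> closed_segment (\<i> * R) p \<or> z \<in> closed_segment q (- (\<i> * R))" for z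
  proof -
    obtain u :: real where u: "0 \<le> u" "u \<le> 1" "z = (1 - u) *\<^sub>R (\<i> * R) + u *\<^sub>R p \<or> z = (1 - u) *\<^sub>R q + u *\<^sub>R (- (\<i> * R))"
      using \<open>z \<in> _ \<or> _\<close> by (auto simp: in_segment)
    have "\<exists>v. 0 \<le> v \<and> v \<le> 1 \<and> Re z = - (v * \<delta>) \<and> \<bar>Im z\<bar> = R"
    proof (cases "z = (1 - u) *\<^sub>R (\<i> * R) + u *\<^sub>R p")
      case True
      have "Re z = - (u * \<delta>)" "Im z = R" unfolding True by (simp_all add: p_def algebra_simps)
      thus ?thesis using u R by (intro exI[of _ u]) auto
    next
      case False
      hence z: "z = (1 - u) *\<^sub>R q + u *\<^sub>R (- (\<i> * R))" using u by blast
      have "Re z = - ((1 - u) * \<delta>)" "Im z = - R" unfolding z by (simp_all add: q_def algebra_simps)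
      thus ?thesis using u R by (intro exI[of _ "1 - u"]) auto
    qed
    thus ?thesis using \<delta> by (auto simp: mult_left_le_one_le)
  qed
  have seg_v: "Re z = - \<delta> \<and> \<bar>Im z\<bar> \<le> R" if z: "z \<in> closed_segment p q" for z
  proof -
    have "Re z = - \<delta> \<and> Im z \<in> closed_segment R (- R)"
      using z closed_segment_same_Re[of p q] by (simp add: p_def q_def)
    thus ?thesis using R by (auto simp: closed_segment_eq_real_ivl)
  qed
  have b1: "norm (contour_integral l1 G) \<le> B * (3 / R) * norm (p - \<i> * R)"
    unfolding l1_def by (rule contour_integral_bound_linepath)
      (use G_int(2) horiz seg_re B R in \<open>auto simp: l1_def\<close>)
  have b3: "norm (contour_integral l3 G) \<le> B * (3 / R) * norm (- (\<i> * R) - q)"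
    unfolding l3_def by (rule contour_integral_bound_linepath)
      (use G_int(4) horiz seg_re B R in \<open>auto simp: l3_def\<close>)
  have b2: "norm (contour_integral l2 G) \<le> B * 3 * real N powr (- \<delta>) * norm (q - p)"
    unfolding l2_def by (rule contour_integral_bound_linepath)
      (use G_int(3) vert seg_v B R in \<open>auto simp: l2_def\<close>)
  have len: "norm (p - \<i> * R) = \<delta>" "norm (- (\<i> * R) - q) = \<delta>" "norm (q - p) = 2 * R"
    using \<delta> R by (simp_all add: p_def q_def cmod_def real_sqrt_unique)
  have "norm (contour_integral ra G) = norm (contour_integral l1 G + (contour_integral l2 G + contour_integral l3 G))"
    using sum0 by (metis add_eq_0_iff norm_minus_cancel)
  also have "\<dots> \<le> norm (contour_integral l1 G) + (norm (contour_integral l2 G) + norm (contour_integral l3 G))"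
    by (intro order_trans[OF norm_triangle_ineq] add_mono norm_triangle_ineq order_refl)
  also have "\<dots> \<le> B * (3 / R) * 1 + (B * 3 * real N powr (- \<delta>) * (2 * R) + B * (3 / R) * 1)"
  proof (intro add_mono)
    have "B * (3 / R) * \<delta> \<le> B * (3 / R) * 1" using B R \<delta> by (intro mult_left_mono) auto
    thus "norm (contour_integral l1 G) \<le> B * (3 / R) * 1" "norm (contour_integral l3 G) \<le> B * (3 / R) * 1"
      using b1 b3 unfolding len by linarith+
    show "norm (contour_integral l2 G) \<le> B * 3 * real N powr (- \<delta>) * (2 * R)" using b2 unfolding len .
  qed
  also have "\<dots> = 6 * (B * (1 / R + R * real N powr (- \<delta>)))" by (simp add: algebra_simps)
  finally have raG: "norm (contour_integral ra G) \<le> 6 * (B * (1 / R + R * real N powr (- \<delta>)))" .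
  have P_hol: "P holomorphic_on UNIV" unfolding P_def by (intro holomorphic_intros)
  have k_cont: "continuous_on (sphere 0 R) k" unfolding k_def
    using N R by (intro continuous_intros) auto
  have Pk_cont: "continuous_on (sphere 0 R) (\<lambda>z. P z * k z)"
    by (intro continuous_intros k_cont continuous_on_subset[OF holomorphic_on_imp_continuous_on[OF P_hol]]) auto
  have ra_sphere: "path_image ra \<subseteq> sphere 0 R" using ra_im by auto
  have la_sphere: "path_image la \<subseteq> sphere 0 R" using la_im by auto
  have Pk_int: "(\<lambda>z. P z * k z) contour_integrable_on ra" "(\<lambda>z. P z * k z) contour_integrable_on la"
    unfolding ra_def la_def
    by (intro contour_integrable_continuous_part_circlepath continuous_on_subset[OF Pk_cont]
         ra_sphere[unfolded ra_def] la_sphere[unfolded la_def])+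
  \<comment> \<open>The polynomial \<open>P\<close> is entire, so for it the left half of the circle
    itself can be used. With \<open>a = - Re z\<close> the leading factors
    \<open>N powr a / a\<close>, \<open>N powr (- a)\<close> and \<open>2 * a / R\<^sup>2\<close>
    multiply to \<open>2 / R\<^sup>2\<close>.\<close>
  have left: "norm (contour_integral la (\<lambda>z. P z * k z)) \<le> (2 / R\<^sup>2 + 2 / (N * R)) * R * (3 * pi / 2 - pi / 2)"
    unfolding la_def
  \<comment> \<open>The pointwise estimate divides by \<open>Re z\<close>; the two endpoints, where
    this is 0, form a finite exceptional set and do not influence the integral.\<close>
  proof (rule contour_integral_bound_part_circlepath_strong[where k = "{\<i> * R, - (\<i> * R)}"])
    show "(\<lambda>z. P z * k z) contour_integrable_on part_circlepath 0 R (pi / 2) (3 * pi / 2)"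
      using Pk_int(2) by (simp add: la_def)
    fix z assume "z \<in> path_image (part_circlepath 0 R (pi / 2) (3 * pi / 2)) - {\<i> * R, - (\<i> * R)}"
    hence z: "norm z = R" "Re z \<le> 0" "z \<noteq> \<i> * R" "z \<noteq> - (\<i> * R)" using la_im by (auto simp: la_def)
    have "Re z \<noteq> 0"
    proof
      assume "Re z = 0"
      hence "\<bar>Im z\<bar> = R" using z(1) by (simp add: cmod_eq_Im)
      thus False using z \<open>Re z = 0\<close> by (auto simp: complex_eq_iff abs_if split: if_splits)
    qed
    define a where "a = - Re z"
    have a: "a > 0" "a \<le> R" using z \<open>Re z \<noteq> 0\<close> abs_Re_le_cmod[of z] by (auto simp: a_def)
    have e: "- 1 - Re z = a - 1" by (simp add: a_def)
    have "norm (P z) \<le> (\<Sum>n=1..N. real n powr (a - 1))"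
      unfolding P_def
    proof (intro sum_norm_le)
      fix n assume n: "n \<in> {1..N}"
      have "real_of_int \<bar>moebius_mu n\<bar> \<le> 1" using abs_moebius_mu_le[of n] by linarith
      thus "norm (of_int (moebius_mu n) * of_nat n powr (- 1 - z) :: complex) \<le> real n powr (a - 1)"
        using n by (simp add: norm_mult norm_of_nat_powr e mult_left_le_one_le)
    qed
    also have "\<dots> \<le> real N powr a / a + real N powr (a - 1)"
      using sum_powr_le[of a N] a N by simp
    finally have P: "norm (P z) \<le> real N powr a / a + real N powr (a - 1)" .
    have k: "norm (k z) = real N powr (- a) * (2 * a / R\<^sup>2)"
      using newman_kernel_circle[OF z(1)] R a by (simp add: k_def norm_mult normN a_def)
    have "norm (P z * k z) \<le> (real N powr a / a + real N powr (a - 1)) * (real N powr (- a) * (2 * a / R\<^sup>2))"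
      unfolding norm_mult k by (intro mult_right_mono P) (use a in auto)
    also have "\<dots> = (real N powr a * real N powr (- a)) * (2 / R\<^sup>2) +
        (real N powr (a - 1) * real N powr (- a)) * (2 * a / R\<^sup>2)"
      using a by (simp add: field_simps)
    also have "real N powr a * real N powr (- a) = 1" using N by (simp flip: powr_add)
    also have "real N powr (a - 1) * real N powr (- a) = 1 / real N"
      using N powr_add[of "real N" "a - 1" "- a"] by (simp add: powr_minus_divide)
    also have "1 * (2 / R\<^sup>2) + 1 / real N * (2 * a / R\<^sup>2) \<le> 2 / R\<^sup>2 + 1 / real N * (2 * R / R\<^sup>2)"
      using a by (intro add_mono mult_left_mono divide_right_mono) auto
    also have "\<dots> = 2 / R\<^sup>2 + 2 / (N * R)" using R by (simp add: power2_eq_square)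
    finally show "norm (P z * k z) \<le> 2 / R\<^sup>2 + 2 / (N * R)" .
  qed (use R N in auto)
  \<comment> \<open>On the right arc the integrand is the kernel times the tail of the series of
    \<open>1 / zeta\<close>, and \<open>powr_tail\<close> again leaves exactly
    \<open>2 / R\<^sup>2\<close>.\<close>
  have right: "norm (contour_integral ra (\<lambda>z. G z - P z * k z)) \<le> (2 / R\<^sup>2) * R * (pi / 2 - - pi / 2)"
    unfolding ra_def
  proof (rule contour_integral_bound_part_circlepath_strong[where k = "{\<i> * R, - (\<i> * R)}"])
    show "(\<lambda>z. G z - P z * k z) contour_integrable_on part_circlepath 0 R (- pi / 2) (pi / 2)"
      using contour_integrable_diff[OF G_int(1) Pk_int(1)] by (simp add: ra_def)
    fix z assume "z \<in> path_image (part_circlepath 0 R (- pi / 2) (pi / 2)) - {\<i> * R, - (\<i> * R)}"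
    hence z: "norm z = R" "Re z \<ge> 0" "z \<noteq> \<i> * R" "z \<noteq> - (\<i> * R)" using ra_im by (auto simp: ra_def)
    have "Re z \<noteq> 0"
    proof
      assume "Re z = 0"
      hence "\<bar>Im z\<bar> = R" using z(1) by (simp add: cmod_eq_Im)
      thus False using z \<open>Re z = 0\<close> by (auto simp: complex_eq_iff abs_if split: if_splits)
    qed
    hence a: "Re z > 0" using z by auto
    have z0: "z \<noteq> 0" using z R by auto
    let ?f = "\<lambda>n. of_int (moebius_mu n) * of_nat n powr (- (1 + z)) :: complex"
    have G: "G z = mu_series (1 + z) * k z"
      using z0 a zeta_nonzero[of "1 + z"] unfolding G_def k_def
      by (subst zeta_reg_eq) (simp_all add: inverse_zeta field_simps power2_eq_square)
    have sm: "(\<lambda>n. norm (?f n)) summable_on {0<..}" using a by (intro abs_summable_mu) auto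
    have split: "{0<..} = {1..N} \<union> {N<..}" using N by auto
    have sm2: "(\<lambda>n. norm (?f n)) summable_on {N<..}"
      by (rule summable_on_subset_banach[OF sm]) auto
    have "mu_series (1 + z) = infsum ?f {1..N} + infsum ?f {N<..}"
      unfolding mu_series_def split
      by (rule infsum_Un_disjoint) (use abs_summable_summable[OF sm2] in auto)
    also have "infsum ?f {1..N} = P z" by (simp add: P_def)
    finally have "mu_series (1 + z) - P z = infsum ?f {N<..}" by simp
    also have "norm \<dots> \<le> (\<Sum>\<^sub>\<infinity>n\<in>{N<..}. norm (?f n))" by (rule norm_infsum_bound[OF sm2])
    also have "\<dots> \<le> (\<Sum>\<^sub>\<infinity>n\<in>{N<..}. real n powr (- 1 - Re z))"
    proof (rule infsum_mono[OF sm2 powr_tail(1)[OF a N]])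
      fix n assume n: "n \<in> {N<..}"
      have "real_of_int \<bar>moebius_mu n\<bar> \<le> 1" using abs_moebius_mu_le[of n] by linarith
      thus "norm (?f n) \<le> real n powr (- 1 - Re z)"
        using n by (simp add: norm_mult norm_of_nat_powr mult_left_le_one_le)
    qed
    also have "\<dots> \<le> real N powr (- Re z) / Re z" by (rule powr_tail(2)[OF a N])
    finally have D: "norm (mu_series (1 + z) - P z) \<le> real N powr (- Re z) / Re z" .
    have k: "norm (k z) = real N powr Re z * (2 * Re z / R\<^sup>2)"
      using newman_kernel_circle[OF z(1)] R a by (simp add: k_def norm_mult normN)
    have "norm (G z - P z * k z) = norm (mu_series (1 + z) - P z) * norm (k z)"
      unfolding G by (simp flip: norm_mult add: algebra_simps)
    also have "\<dots> \<le> real N powr (- Re z) / Re z * (real N powr Re z * (2 * Re z / R\<^sup>2))"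
      unfolding k by (intro mult_right_mono D) (use a in auto)
    also have "\<dots> = (real N powr (- Re z) * real N powr Re z) * (2 / R\<^sup>2)"
      using a by (simp add: field_simps)
    also have "real N powr (- Re z) * real N powr Re z = 1" using N by (simp flip: powr_add)
    finally show "norm (G z - P z * k z) \<le> 2 / R\<^sup>2" by simp
  qed (use R in auto)
  have residue: "contour_integral (circlepath 0 R) (\<lambda>z. P z * k z) = 2 * pi * \<i> * P 0"
  proof -
    have hol: "(\<lambda>z. P z * (of_nat N powr z * (1 + z\<^sup>2 / of_real R ^ 2))) holomorphic_on cball 0 R"
      using R by (intro holomorphic_intros holomorphic_on_subset[OF P_hol]) auto
    have "((\<lambda>z. P z * (of_nat N powr z * (1 + z\<^sup>2 / of_real R ^ 2)) / (z - 0)) has_contour_integral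
        (2 * of_real pi * \<i> * (P 0 * (of_nat N powr 0 * (1 + 0\<^sup>2 / of_real R ^ 2))))) (circlepath 0 R)"
      by (rule Cauchy_integral_circlepath_simple[OF hol]) (use R in auto)
    moreover have "P 0 * (of_nat N powr 0 * (1 + 0\<^sup>2 / of_real R ^ 2)) = P 0" using N by simp
    ultimately have "((\<lambda>z. P z * (of_nat N powr z * (1 + z\<^sup>2 / of_real R ^ 2)) / (z - 0))
        has_contour_integral (2 * of_real pi * \<i> * P 0)) (circlepath 0 R)" by (simp only:)
    hence "((\<lambda>z. P z * k z) has_contour_integral (2 * of_real pi * \<i> * P 0)) (circlepath 0 R)"
    proof (rule has_contour_integral_eq)
      fix z assume "z \<in> path_image (circlepath 0 R)"
      hence "z \<noteq> 0" using R by auto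
      thus "P z * (of_nat N powr z * (1 + z\<^sup>2 / of_real R ^ 2)) / (z - 0) = P z * k z"
        using R by (simp add: k_def field_simps power2_eq_square)
    qed
    thus ?thesis by (simp add: contour_integral_unique)
  qed
  have "2 * pi * \<i> * P 0 = contour_integral ra (\<lambda>z. P z * k z) + contour_integral la (\<lambda>z. P z * k z)"
    unfolding residue[symmetric] ra_def la_def using R Pk_cont by (intro contour_integral_circlepath_split) auto
  also have "contour_integral ra (\<lambda>z. P z * k z) = contour_integral ra G - contour_integral ra (\<lambda>z. G z - P z * k z)"
    using contour_integral_diff[OF G_int(1) Pk_int(1)] by simp
  finally have "norm (2 * pi * \<i> * P 0) \<le> norm (contour_integral ra G) + norm (contour_integral ra (\<lambda>z. G z - P z * k z))
      + norm (contour_integral la (\<lambda>z. P z * k z))"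
    by (simp only:) (intro order_trans[OF norm_triangle_ineq] add_mono norm_triangle_ineq4 order_refl)
  also have "\<dots> \<le> 6 * (B * (1 / R + R * real N powr (- \<delta>))) + (2 / R\<^sup>2) * R * (pi / 2 - - pi / 2)
      + (2 / R\<^sup>2 + 2 / (N * R)) * R * (3 * pi / 2 - pi / 2)"
    by (intro add_mono raG right left)
  also have "\<dots> = 6 * (B * (1 / R + R * real N powr (- \<delta>))) + 2 * pi * (2 / R + 1 / N)"
    using R N by (simp add: field_simps power2_eq_square)
  \<comment> \<open>The coefficient 6 collected on the three sides fits into \<open>2 * pi\<close>,
    by which the whole estimate is divided next.\<close>
  also have "6 * (B * (1 / R + R * real N powr (- \<delta>))) \<le> 2 * pi * (B * (1 / R + R * real N powr (- \<delta>)))"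
    using pi_gt3 B R by (intro mult_right_mono) auto
  finally have "norm (P 0) \<le> B * (1 / R + R * real N powr (- \<delta>)) + (2 / R + 1 / N)"
    by (simp add: norm_mult distrib_left[symmetric])
  moreover have "P 0 = of_real (\<Sum>n=1..N. of_int (moebius_mu n) / real n)"
    unfolding P_def of_real_sum by (intro sum.cong refl) (simp add: powr_minus_divide)
  hence "norm (P 0) = \<bar>\<Sum>n=1..N. of_int (moebius_mu n) / real n\<bar>" by (simp only: norm_of_real)
  ultimately show ?thesis by linarith
qed


lemma eventually_bound_imp_bound:
  fixes f g :: "nat \<Rightarrow> real"
  assumes ev: "eventually (\<lambda>n. \<bar>f n\<bar> \<le> g n) sequentially" and g: "\<And>n. n \<ge> 1 \<Longrightarrow> g n > 0"
  shows "\<exists>C>0. \<forall>n\<ge>1. \<bar>f n\<bar> \<le> C * g n"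
proof -
  obtain n0 where n0: "\<And>n. n \<ge> n0 \<Longrightarrow> \<bar>f n\<bar> \<le> g n"
    using ev by (auto simp: eventually_at_top_linorder)
  define C where "C = 1 + (\<Sum>n=1..<n0. \<bar>f n\<bar> / g n)"
  have C: "C \<ge> 1" unfolding C_def using g by (auto intro!: sum_nonneg simp: less_imp_le)
  have "\<bar>f n\<bar> \<le> C * g n" if n: "n \<ge> 1" for n
  proof (cases "n < n0")
    case True
    have "\<bar>f n\<bar> / g n \<le> (\<Sum>n=1..<n0. \<bar>f n\<bar> / g n)"
      using True n g by (intro member_le_sum) (auto simp: less_imp_le)
    hence "\<bar>f n\<bar> / g n \<le> C" by (simp add: C_def)
    thus ?thesis using g[OF n] by (simp add: field_simps)
  next
    case False
    have "\<bar>f n\<bar> \<le> 1 * g n" using n0[of n] False by simp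
    also have "\<dots> \<le> C * g n" using C g[OF n] by (intro mult_right_mono) auto
    finally show ?thesis .
  qed
  with C show ?thesis by (intro exI[of _ C]) auto
qed

text \<open>Taking the width \<open>(ln T) powr (-11/10)\<close> instead of \<open>c / ln T\<close> lets asymptotics absorb
  all constants; any exponent above \<open>-2\<close> would suffice in the end.\<close>
lemma zero_free_asymp:
  "eventually (\<lambda>T. let W = ln T powr (-11/10) / 8 in
     (\<forall>s. Re s \<ge> 1 - W \<longrightarrow> \<bar>Im s\<bar> \<le> T + 1 \<longrightarrow> zeta_reg s \<noteq> 0) \<and>
     (\<forall>s. \<bar>Re s - 1\<bar> \<le> W / 20 \<longrightarrow> \<bar>Im s\<bar> \<le> T \<longrightarrow> norm (1 / zeta_reg s) \<le> T powr (1/2))) at_top"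
proof -
  have e1: "eventually (\<lambda>T::real. ln T powr (-11/10) > 0) at_top" by real_asymp
  have e2: "eventually (\<lambda>T::real. ln T powr (-11/10) \<le> 1/8) at_top" by real_asymp
  \<comment> \<open>The left side has order \<open>ln T\<close>, the right side
    \<open>(ln T) powr (11/10)\<close>.\<close>
  have e3: "eventually (\<lambda>T::real. 64 * ln (8 * (2 * (T + 1) + 2)\<^sup>2 / (ln T powr (-11/10))\<^sup>2) + 44 \<le> 1 / (2 * ln T powr (-11/10))) at_top"
    by real_asymp
  \<comment> \<open>Up to powers of \<open>ln T\<close> the left side is
    \<open>T powr (-4/9)\<close>.\<close>
  have e4: "eventually (\<lambda>T::real. (ln T powr (-11/10) / 8 / 20)\<^sup>2 / 2 * exp (- (2 / 9 * ln (4 * (T + 4)\<^sup>2 / ((ln T powr (-11/10) / 8 / 20)\<^sup>2 / 2)))) \<ge> T powr (-1/2)) at_top"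
    by real_asymp
  show ?thesis using e1 e2 e3 e4 eventually_ge_at_top[of 1]
  proof eventually_elim
    case (elim T)
    define W where "W = ln T powr (-11/10) / 8"
    have W: "0 < W" "W \<le> 1/4" using elim by (auto simp: W_def)
    have nz: "zeta_reg s \<noteq> 0" if "Re s \<ge> 1 - W" "\<bar>Im s\<bar> \<le> T + 1" for s
      by (rule zeta_reg_zero_free[OF elim(1,2,3)]) (use that in \<open>auto simp: W_def\<close>)
    have "norm (1 / zeta_reg s) \<le> T powr (1/2)" if "\<bar>Re s - 1\<bar> \<le> W / 20" "\<bar>Im s\<bar> \<le> T" for s
    proof -
      have "T powr (-1/2) \<le> norm (zeta_reg s)"
        using zeta_reg_strip_lower[OF W _ nz that] elim(4,5) unfolding W_def by linarith
      moreover have "T powr (-1/2) = 1 / T powr (1/2)" by (simp flip: powr_minus_divide)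
      ultimately have "1 / T powr (1/2) \<le> norm (zeta_reg s)" by simp
      moreover have "0 < T powr (1/2)" using elim by simp
      ultimately have "1 \<le> norm (zeta_reg s) * T powr (1/2)" by (simp add: field_simps)
      moreover have "Re s \<ge> 1 - W" using that(1) W by linarith
      hence "norm (zeta_reg s) > 0" using nz[of s] that by auto
      ultimately show ?thesis by (simp add: norm_divide field_simps)
    qed
    thus ?case using nz unfolding W_def Let_def by blast
  qed
qed

lemma moebius_harmonic_sum_bound:
  "\<exists>C>0. \<forall>N\<ge>1. \<bar>\<Sum>n=1..N. of_int (moebius_mu n) / real n\<bar> \<le> C * exp (- (ln (real N) powr (2/5)))"
proof (rule eventually_bound_imp_bound)
  \<comment> \<open>With \<open>L = ln x\<close> the width \<open>W\<close> is
    \<open>L powr (-99/200) / 8\<close>, so \<open>x powr (- (W x / 20))\<close> is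
    \<open>exp (- (L powr (101/200)) / 160)\<close> and outweighs
    \<open>R powr (3/2) = exp (3/2 * L powr (9/20))\<close>. The largest remaining term is
    \<open>R powr (-1/2)\<close>, which is below \<open>exp (- (L powr (2/5)))\<close>.\<close>
  define R where "R x = exp (ln x powr (9/20))" for x :: real
  define W where "W x = (ln x powr (9/20)) powr (-11/10) / 8" for x :: real
  have R_lim: "filterlim R at_top at_top" unfolding R_def by real_asymp
  have e1: "eventually (\<lambda>x. 0 < W x / 20) at_top" unfolding W_def by real_asymp
  have e2: "eventually (\<lambda>x. W x < 1) at_top" unfolding W_def by real_asymp
  have e3: "eventually (\<lambda>x. 2 / R x + 1 / x + R x powr (1/2) * (1 / R x + R x * x powr (- (W x / 20)))
      \<le> exp (- (ln x powr (2/5)))) at_top" unfolding R_def W_def by real_asymp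
  have e4: "eventually (\<lambda>x. R x \<ge> 1) at_top"
    using R_lim by (auto simp: filterlim_at_top)
  note e5 = eventually_compose_filterlim[OF zero_free_asymp R_lim]
  have "eventually (\<lambda>x::real. \<forall>N::nat. x = real N \<longrightarrow> \<bar>\<Sum>n=1..N. of_int (moebius_mu n) / real n\<bar> \<le> exp (- (ln N powr (2/5)))) at_top"
    using e1 e2 e3 e4 e5 eventually_ge_at_top[of 1]
  proof eventually_elim
    case (elim x)
    have lnR: "ln (R x) = ln x powr (9/20)" by (simp add: R_def)
    show ?case
    proof safe
      fix N :: nat assume x: "x = real N"
      have N: "N \<ge> 1" using elim(6) x by simp
      have nz: "\<And>s. Re s \<ge> 1 - W x \<Longrightarrow> \<bar>Im s\<bar> \<le> R x + 1 \<Longrightarrow> zeta_reg s \<noteq> 0"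
       and lo: "\<And>s. \<bar>Re s - 1\<bar> \<le> W x / 20 \<Longrightarrow> \<bar>Im s\<bar> \<le> R x \<Longrightarrow> norm (1 / zeta_reg s) \<le> R x powr (1/2)"
        using elim(5) unfolding Let_def lnR W_def by blast+
      have W: "W x / 20 < W x" using elim(1) by simp
      have "\<bar>\<Sum>n=1..N. of_int (moebius_mu n) / real n\<bar> \<le>
         2 / R x + 1 / N + R x powr (1/2) * (1 / R x + R x * real N powr (- (W x / 20)))"
        by (rule newman_moebius_bound[OF N elim(4,1) W elim(2) _ nz lo]) auto
      also have "\<dots> \<le> exp (- (ln N powr (2/5)))" using elim(3) by (simp add: x)
      finally show "\<bar>\<Sum>n=1..N. of_int (moebius_mu n) / real n\<bar> \<le> exp (- (ln N powr (2/5)))" .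
    qed
  qed
  from eventually_compose_filterlim[OF this filterlim_real_sequentially]
  show "eventually (\<lambda>N. \<bar>\<Sum>n=1..N. of_int (moebius_mu n) / real n\<bar> \<le> exp (- (ln (real N) powr (2/5)))) sequentially"
    by (rule eventually_mono) auto
qed auto


section \<open>Partial sums of \<open>mu\<close> and of its convolution square\<close>

definition mertens :: "nat \<Rightarrow> real" where
  "mertens N = (\<Sum>n=1..N. of_int (moebius_mu n))"

lemma mertens_abel:
  "mertens N = real N * (\<Sum>n=1..N. of_int (moebius_mu n) / real n) -
     (\<Sum>k=1..<N. \<Sum>n=1..k. of_int (moebius_mu n) / real n)"
proof (induction N)
  case (Suc N)
  let ?m = "\<lambda>N. \<Sum>n=1..N. of_int (moebius_mu n) / real n"
  have "(\<Sum>k=1..<Suc N. ?m k) = (\<Sum>k=1..<N. ?m k) + ?m N"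
    by (cases N) auto
  moreover have "mertens (Suc N) = mertens N + of_int (moebius_mu (Suc N))" by (simp add: mertens_def)
  moreover have "?m (Suc N) = ?m N + of_int (moebius_mu (Suc N)) / real (Suc N)" by simp
  moreover have "real (Suc N) * (?m N + of_int (moebius_mu (Suc N)) / real (Suc N)) =
      real N * ?m N + ?m N + of_int (moebius_mu (Suc N))"
    unfolding distrib_left by (simp add: distrib_right del: of_nat_Suc) (simp add: distrib_right)
  ultimately have "real (Suc N) * ?m (Suc N) = real N * ?m N + ?m N + of_int (moebius_mu (Suc N))" by (simp only:)
  with \<open>(\<Sum>k=1..<Suc N. ?m k) = _\<close> \<open>mertens (Suc N) = _\<close> show ?case using Suc.IH by linarith
qed (auto simp: mertens_def)

text \<open>In Abel's formula the terms with \<open>k \<le> sqrt N\<close> are bounded trivially,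
  and in the others \<open>ln k \<ge> ln N / 2\<close>. Halving the logarithm only changes a
  constant inside the exponential, which the passage from 2/5 to 39/100 absorbs.\<close>

lemma mertens_bound:
  "\<exists>C>0. \<forall>N\<ge>1. \<bar>mertens N\<bar> \<le> C * (real N * exp (- (ln (real N) powr (39/100))))"
proof -
  define \<epsilon> where "\<epsilon> t = exp (- (t powr (2/5)))" for t :: real
  obtain C where C: "C > 0" and Cm: "\<And>N. N \<ge> 1 \<Longrightarrow> \<bar>\<Sum>n=1..N. of_int (moebius_mu n) / real n\<bar> \<le> C * \<epsilon> (ln (real N))"
    using moebius_harmonic_sum_bound unfolding \<epsilon>_def by blast
  have \<epsilon>_mono: "\<epsilon> t \<le> \<epsilon> u" if "0 \<le> u" "u \<le> t" for t u
    unfolding \<epsilon>_def using that by (simp add: powr_mono2)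
  have \<epsilon>_le: "\<epsilon> t \<le> 1" for t by (simp add: \<epsilon>_def)
  have bound: "\<bar>mertens N\<bar> \<le> C * (real N * \<epsilon> (ln N) + (sqrt N + real N * \<epsilon> (ln N / 2)))" if N: "N \<ge> 1" for N
  proof -
    have "(\<Sum>k=1..<N. \<bar>\<Sum>n=1..k. of_int (moebius_mu n) / real n\<bar>) \<le>
          (\<Sum>k=1..<N. C * ((if real k \<le> sqrt N then 1 else 0) + \<epsilon> (ln N / 2)))"
    proof (rule sum_mono)
      fix k assume k: "k \<in> {1..<N}"
      have "\<epsilon> (ln k) \<le> (if real k \<le> sqrt N then 1 else 0) + \<epsilon> (ln N / 2)"
      proof (cases "real k \<le> sqrt N")
        case True
        thus ?thesis using \<epsilon>_le[of "ln k"] by (simp add: \<epsilon>_def add_increasing2)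
      next
        case False
        hence "ln (sqrt N) \<le> ln k" using k by (subst ln_le_cancel_iff) auto
        hence "ln N / 2 \<le> ln k" using N by (simp add: ln_sqrt)
        thus ?thesis using False N by (simp add: \<epsilon>_mono)
      qed
      thus "\<bar>\<Sum>n=1..k. of_int (moebius_mu n) / real n\<bar> \<le> C * ((if real k \<le> sqrt N then 1 else 0) + \<epsilon> (ln N / 2))"
        using Cm[of k] k C by (meson atLeastLessThan_iff less_imp_le mult_left_mono order_trans)
    qed
    also have "\<dots> = C * (real (card {k\<in>{1..<N}. real k \<le> sqrt N}) + real (N - 1) * \<epsilon> (ln N / 2))"
      by (simp add: sum_distrib_left[symmetric] sum.distrib sum.If_cases Int_def)
    also have "\<dots> \<le> C * (sqrt N + real N * \<epsilon> (ln N / 2))"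
    proof -
      have "card {k\<in>{1..<N}. real k \<le> sqrt N} \<le> card {1..nat \<lfloor>sqrt N\<rfloor>}"
        by (intro card_mono) (auto simp: le_nat_iff le_floor_iff)
      hence "card {k\<in>{1..<N}. real k \<le> sqrt N} \<le> nat \<lfloor>sqrt N\<rfloor>" by simp
      hence "real (card {k\<in>{1..<N}. real k \<le> sqrt N}) \<le> real (nat \<lfloor>sqrt N\<rfloor>)" by (simp only: of_nat_le_iff)
      hence "real (card {k\<in>{1..<N}. real k \<le> sqrt N}) \<le> sqrt N"
        by (rule order_trans) (simp add: of_nat_floor)
      thus ?thesis using C by (intro mult_left_mono add_mono mult_right_mono) (auto simp: \<epsilon>_def)
    qed
    finally have 1: "(\<Sum>k=1..<N. \<bar>\<Sum>n=1..k. of_int (moebius_mu n) / real n\<bar>) \<le> C * (sqrt N + real N * \<epsilon> (ln N / 2))" .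
    have "\<bar>mertens N\<bar> \<le> real N * \<bar>\<Sum>n=1..N. of_int (moebius_mu n) / real n\<bar> + (\<Sum>k=1..<N. \<bar>\<Sum>n=1..k. of_int (moebius_mu n) / real n\<bar>)"
      unfolding mertens_abel
      by (rule order_trans[OF abs_triangle_ineq4]) (simp add: abs_mult sum_abs)
    also have "\<dots> \<le> real N * (C * \<epsilon> (ln N)) + C * (sqrt N + real N * \<epsilon> (ln N / 2))"
      by (intro add_mono mult_left_mono Cm N 1) auto
    finally show ?thesis by (simp add: algebra_simps)
  qed
  have "eventually (\<lambda>x::real. x * \<epsilon> (ln x) \<le> 1/3 * (x * exp (- (ln x powr (39/100))))) at_top"
    unfolding \<epsilon>_def by real_asymp
  moreover have "eventually (\<lambda>x::real. sqrt x \<le> 1/3 * (x * exp (- (ln x powr (39/100))))) at_top"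
    by real_asymp
  moreover have "eventually (\<lambda>x::real. x * \<epsilon> (ln x / 2) \<le> 1/3 * (x * exp (- (ln x powr (39/100))))) at_top"
    unfolding \<epsilon>_def by real_asymp
  ultimately have "eventually (\<lambda>x::real. x * \<epsilon> (ln x) + (sqrt x + x * \<epsilon> (ln x / 2)) \<le> x * exp (- (ln x powr (39/100)))) at_top"
    by eventually_elim linarith
  hence "eventually (\<lambda>N. real N * \<epsilon> (ln (real N)) + (sqrt (real N) + real N * \<epsilon> (ln (real N) / 2)) \<le> real N * exp (- (ln (real N) powr (39/100)))) sequentially"
    by (rule eventually_compose_filterlim) (rule filterlim_real_sequentially)
  hence ev: "eventually (\<lambda>N. \<bar>mertens N / C\<bar> \<le> real N * exp (- (ln (real N) powr (39/100)))) sequentially"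
    using eventually_ge_at_top[of 1]
  proof eventually_elim
    case (elim N)
    have "\<bar>mertens N / C\<bar> = \<bar>mertens N\<bar> / C" using C by simp
    also have "\<dots> \<le> real N * \<epsilon> (ln (real N)) + (sqrt (real N) + real N * \<epsilon> (ln (real N) / 2))"
      using bound[OF elim(2)] C by (simp add: field_simps)
    finally show ?case using elim(1) by linarith
  qed
  obtain D where D: "D > 0" "\<And>N. N \<ge> 1 \<Longrightarrow> \<bar>mertens N / C\<bar> \<le> D * (real N * exp (- (ln (real N) powr (39/100))))"
    using eventually_bound_imp_bound[OF ev] by auto
  show ?thesis
  proof (intro exI[of _ "C * D"] conjI allI impI)
    fix N :: nat assume "N \<ge> 1"
    thus "\<bar>mertens N\<bar> \<le> C * D * (real N * exp (- (ln (real N) powr (39/100))))"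
      using D(2)[of N] C by (simp add: field_simps)
  qed (use C D in auto)
qed

text \<open>The Dirichlet coefficients of \<open>1 / zeta\<^sup>2\<close>.\<close>
definition mu_conv :: "nat \<Rightarrow> real" where
  "mu_conv n = (\<Sum>a | a dvd n. of_int (moebius_mu a * moebius_mu (n div a)))"

definition mu_conv_sum :: "nat \<Rightarrow> real" where
  "mu_conv_sum N = (\<Sum>n=1..N. mu_conv n)"

lemma sum_divisor_pairs:
  fixes F :: "nat \<Rightarrow> nat \<Rightarrow> real"
  shows "(\<Sum>n=1..N. \<Sum>a | a dvd n. F a (n div a)) = (\<Sum>(a, b)\<in>{(a, b). 0 < a \<and> 0 < b \<and> a * b \<le> N}. F a b)"
proof -
  have "(\<Sum>n=1..N. \<Sum>a | a dvd n. F a (n div a)) = (\<Sum>(n, a)\<in>Sigma {1..N} (\<lambda>n. {a. a dvd n}). F a (n div a))"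
    by (rule sum.Sigma) auto
  also have "\<dots> = (\<Sum>(a, b)\<in>{(a, b). 0 < a \<and> 0 < b \<and> a * b \<le> N}. F a b)"
    by (rule sum.reindex_bij_witness[of _ "\<lambda>(a, b). (a * b, a)" "\<lambda>(n, a). (a, n div a)"])
       (auto elim!: dvdE)
  finally show ?thesis .
qed

text \<open>Of two factors with product at most \<open>N\<close> one is at most \<open>K\<close>, so
  the pairs split into those with \<open>a \<le> K\<close> and those with
  \<open>b \<le> K < a\<close>. The point of this splitting is that \<open>mertens\<close> is
  evaluated only at arguments \<open>\<ge> K\<close>, where its bound is strong.\<close>

lemma mu_conv_sum_hyperbola:
  assumes "K * K \<le> N" "N < Suc K * Suc K"
  shows "mu_conv_sum N = (\<Sum>a=1..K. of_int (moebius_mu a) * (2 * mertens (N div a) - mertens K))"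
proof (cases "K = 0")
  case False
  let ?P = "{(a, b). 0 < a \<and> 0 < b \<and> a * b \<le> N}"
  define f where "f a b = (of_int (moebius_mu a) * of_int (moebius_mu b) :: real)" for a b
  define P1 where "P1 = Sigma {1..K} (\<lambda>a. {1..N div a})"
  define P2 where "P2 = Sigma {1..K} (\<lambda>b. {K<..N div b})"
  have le_div: "b \<le> N div a \<longleftrightarrow> a * b \<le> N" if "a > 0" for a b
    using that by (simp add: less_eq_div_iff_mult_less_eq mult.commute)
  have 1: "?P = P1 \<union> (\<lambda>(b, a). (a, b)) ` P2"
  proof -
    have small: "b \<le> K" if "a * b \<le> N" "a > K" for a b
    proof (rule ccontr)
      assume "\<not> b \<le> K"
      hence "Suc K * Suc K \<le> a * b" using that by (intro mult_le_mono) auto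
      thus False using that assms by simp
    qed
    have img: "(a, b) \<in> (\<lambda>(b, a). (a, b)) ` P2 \<longleftrightarrow> (b, a) \<in> P2" for a b by auto
    have "(a, b) \<in> ?P \<longleftrightarrow> (a, b) \<in> P1 \<union> (\<lambda>(b, a). (a, b)) ` P2" for a b
      unfolding Un_iff img using small[of a b] le_div[of a b] le_div[of b a]
      by (cases "a \<le> K") (auto simp: P1_def P2_def mult.commute)
    thus ?thesis unfolding set_eq_iff split_paired_All by blast
  qed
  have "mu_conv_sum N = (\<Sum>(a, b)\<in>?P. f a b)"
    unfolding mu_conv_sum_def mu_conv_def sum_divisor_pairs[symmetric] by (simp add: f_def)
  also have "\<dots> = (\<Sum>(a, b)\<in>P1. f a b) + (\<Sum>(a, b)\<in>(\<lambda>(b, a). (a, b)) ` P2. f a b)"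
    unfolding 1 by (rule sum.union_disjoint) (auto simp: P1_def P2_def)
  also have "(\<Sum>(a, b)\<in>(\<lambda>(b, a). (a, b)) ` P2. f a b) = (\<Sum>(b, a)\<in>P2. f b a)"
    by (subst sum.reindex) (auto simp: inj_on_def f_def mult.commute intro!: sum.cong)
  also have "(\<Sum>(a, b)\<in>P1. f a b) = (\<Sum>a=1..K. of_int (moebius_mu a) * mertens (N div a))"
    unfolding P1_def f_def mertens_def sum_distrib_left by (rule sum.Sigma[symmetric]) auto
  also have "(\<Sum>(b, a)\<in>P2. f b a) = (\<Sum>b=1..K. of_int (moebius_mu b) * (mertens (N div b) - mertens K))"
  proof -
    have "(\<Sum>(b, a)\<in>P2. f b a) = (\<Sum>b=1..K. \<Sum>a\<in>{K<..N div b}. f b a)"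
      unfolding P2_def by (rule sum.Sigma[symmetric]) auto
    also have "\<dots> = (\<Sum>b=1..K. of_int (moebius_mu b) * (mertens (N div b) - mertens K))"
    proof (rule sum.cong[OF refl])
      fix b assume b: "b \<in> {1..K}"
      have "b * K \<le> K * K" using b by (intro mult_le_mono1) auto
      hence "b * K \<le> N" using assms(1) by (rule order_trans)
      hence "K \<le> N div b" using b by (subst le_div) auto
      hence "{1..N div b} = {1..K} \<union> {K<..N div b}" by auto
      hence "mertens (N div b) = mertens K + (\<Sum>a\<in>{K<..N div b}. of_int (moebius_mu a))"
        unfolding mertens_def by (simp only:) (rule sum.union_disjoint, auto)
      thus "(\<Sum>a\<in>{K<..N div b}. f b a) = of_int (moebius_mu b) * (mertens (N div b) - mertens K)"
        by (simp add: f_def sum_distrib_left)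
    qed
    finally show ?thesis .
  qed
  finally show ?thesis by (simp add: sum.distrib[symmetric] algebra_simps)
qed (use assms in \<open>simp add: mu_conv_sum_def\<close>)

lemma harm_le_one_plus_ln: "n \<ge> 1 \<Longrightarrow> harm n \<le> 1 + ln (real n)"
  using euler_mascheroni_sequence_decreasing[of 1 n] by (simp add: harm_expand)

text \<open>Every value of \<open>mertens\<close> in the hyperbola formula has its argument at least
  about \<open>sqrt N\<close> and thus carries the full saving; summing \<open>N / a\<close> over
  \<open>a \<le> K\<close> costs one logarithm.\<close>

lemma mu_conv_sum_bound:
  "\<exists>C>0. \<forall>N\<ge>1. \<bar>mu_conv_sum N\<bar> \<le> C * (real N * exp (- (ln (real N) powr (38/100))))"
proof -
  define \<epsilon> where "\<epsilon> t = exp (- (t powr (39/100)))" for t :: real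
  obtain C where C: "C > 0" and Cm: "\<And>N. N \<ge> 1 \<Longrightarrow> \<bar>mertens N\<bar> \<le> C * (real N * \<epsilon> (ln (real N)))"
    using mertens_bound unfolding \<epsilon>_def by blast
  have \<epsilon>_mono: "\<epsilon> t \<le> \<epsilon> u" if "0 \<le> u" "u \<le> t" for t u
    unfolding \<epsilon>_def using that by (simp add: powr_mono2)
  have bound: "\<bar>mu_conv_sum N\<bar> \<le> C * (3 * N * \<epsilon> (ln N / 2 - ln 2) * (1 + ln N))" if N: "N \<ge> 4" for N
  proof -
    define K where "K = nat \<lfloor>sqrt N\<rfloor>"
    have s: "sqrt N \<ge> 2" using N by (simp add: real_le_rsqrt)
    have K: "real K \<le> sqrt N" "sqrt N < real K + 1" "K \<ge> 1" using s unfolding K_def by linarith+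
    have KK: "K * K \<le> N" "N < Suc K * Suc K"
    proof -
      have "real K * real K \<le> sqrt N * sqrt N" using K by (intro mult_mono) auto
      hence "real (K * K) \<le> real N" by simp
      thus "K * K \<le> N" by (simp only: of_nat_le_iff)
      have "sqrt N * sqrt N < real (Suc K) * real (Suc K)" using K by (intro mult_strict_mono') auto
      hence "real N < real (Suc K * Suc K)" by (simp add: algebra_simps)
      thus "N < Suc K * Suc K" by (simp only: of_nat_less_iff)
    qed
    \<comment> \<open>Rounding \<open>sqrt N\<close> down loses at most a factor 2 because
      \<open>sqrt N \<ge> 2\<close>.\<close>
    have lnK: "ln N / 2 - ln 2 \<le> ln K"
    proof -
      have "sqrt N / 2 \<le> K" using K s by linarith
      hence "ln (sqrt N / 2) \<le> ln K" using s N by (intro ln_mono) auto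
      thus ?thesis using N s by (simp add: ln_div ln_sqrt)
    qed
    have ln0: "ln N / 2 - ln 2 \<ge> 0"
    proof -
      have "ln (2 ^ 2 :: real) \<le> ln N" using N by (subst ln_le_cancel_iff) auto
      moreover have "ln (2 ^ 2 :: real) = 2 * ln 2" by (subst ln_realpow) auto
      ultimately show ?thesis by linarith
    qed
    define e where "e = \<epsilon> (ln N / 2 - ln 2)"
    have Mb: "\<bar>mertens v\<bar> \<le> C * (real v * e)" if "v \<ge> K" for v
    proof -
      have "ln K \<le> ln v" using that K by (intro ln_mono) auto
      hence "\<epsilon> (ln v) \<le> e" unfolding e_def using lnK ln0 by (intro \<epsilon>_mono) auto
      moreover have "\<bar>mertens v\<bar> \<le> C * (real v * \<epsilon> (ln v))" using that K by (intro Cm) auto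
      ultimately show ?thesis using C by (meson less_imp_le mult_left_mono of_nat_0_le_iff order_trans)
    qed
    have "\<bar>mu_conv_sum N\<bar> \<le> (\<Sum>a=1..K. \<bar>of_int (moebius_mu a) * (2 * mertens (N div a) - mertens K)\<bar>)"
      unfolding mu_conv_sum_hyperbola[OF KK] by (rule sum_abs)
    also have "\<dots> \<le> (\<Sum>a=1..K. 3 * C * e * N * (1 / a))"
    proof (rule sum_mono)
      fix a assume a: "a \<in> {1..K}"
      have "a * K \<le> K * K" using a by (intro mult_le_mono1) auto
      hence "a * K \<le> N" using KK(1) by (rule order_trans)
      hence Ka: "K \<le> N div a" using a by (simp add: less_eq_div_iff_mult_less_eq mult.commute)
      have div: "real (N div a) \<le> N / a" by (rule of_nat_div_le_of_nat)
      have e0: "e \<ge> 0" by (simp add: e_def \<epsilon>_def)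
      have "real_of_int \<bar>moebius_mu a\<bar> \<le> 1" using abs_moebius_mu_le[of a] by linarith
      hence "\<bar>of_int (moebius_mu a) * (2 * mertens (N div a) - mertens K)\<bar> \<le> 1 * \<bar>2 * mertens (N div a) - mertens K\<bar>"
        unfolding abs_mult by (intro mult_right_mono) auto
      also have "\<dots> \<le> 2 * (C * (real (N div a) * e)) + C * (real K * e)"
      proof -
        have "\<bar>2 * u - v\<bar> \<le> 2 * A + B" if "\<bar>u\<bar> \<le> A" "\<bar>v\<bar> \<le> B" for u v A B :: real
          using that by linarith
        from this[OF Mb[OF Ka] Mb[OF order_refl]] show ?thesis unfolding mult_1 .
      qed
      also have "\<dots> \<le> 2 * (C * (N / a * e)) + C * (N / a * e)"
        using div Ka C e0 by (intro add_mono mult_left_mono mult_right_mono) auto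
      finally show "\<bar>of_int (moebius_mu a) * (2 * mertens (N div a) - mertens K)\<bar> \<le> 3 * C * e * N * (1 / a)"
        by simp
    qed
    also have "\<dots> = 3 * C * e * N * harm K"
      unfolding harm_def sum_distrib_left by (simp add: divide_inverse)
    also have "\<dots> \<le> 3 * C * e * N * (1 + ln N)"
    proof -
      have "harm K \<le> 1 + ln (real K)" by (rule harm_le_one_plus_ln) (rule K)
      also have "real K \<le> N" using K(1) s real_sqrt_le_mono[of 1 "real N"] KK(1) by (metis le_square of_nat_le_iff order_trans)
      hence "ln (real K) \<le> ln (real N)" using K by (intro ln_mono) auto
      finally have "harm K \<le> 1 + ln (real N)" by simp
      thus ?thesis using C by (intro mult_left_mono) (auto simp: e_def \<epsilon>_def)
    qed
    finally show ?thesis by (simp add: e_def mult_ac)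
  qed
  have "eventually (\<lambda>x::real. 3 * x * \<epsilon> (ln x / 2 - ln 2) * (1 + ln x) \<le> x * exp (- (ln x powr (38/100)))) at_top"
    unfolding \<epsilon>_def by real_asymp
  hence "eventually (\<lambda>N. 3 * real N * \<epsilon> (ln (real N) / 2 - ln 2) * (1 + ln (real N)) \<le> real N * exp (- (ln (real N) powr (38/100)))) sequentially"
    by (rule eventually_compose_filterlim) (rule filterlim_real_sequentially)
  hence ev: "eventually (\<lambda>N. \<bar>mu_conv_sum N / C\<bar> \<le> real N * exp (- (ln (real N) powr (38/100)))) sequentially"
    using eventually_ge_at_top[of 4]
  proof eventually_elim
    case (elim N)
    have "\<bar>mu_conv_sum N / C\<bar> = \<bar>mu_conv_sum N\<bar> / C" using C by simp
    also have "\<dots> \<le> 3 * real N * \<epsilon> (ln (real N) / 2 - ln 2) * (1 + ln (real N))"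
      using bound[OF elim(2)] C by (simp add: field_simps)
    finally show ?case using elim(1) by linarith
  qed
  obtain D where D: "D > 0" "\<And>N. N \<ge> 1 \<Longrightarrow> \<bar>mu_conv_sum N / C\<bar> \<le> D * (real N * exp (- (ln (real N) powr (38/100))))"
    using eventually_bound_imp_bound[OF ev] by auto
  show ?thesis
  proof (intro exI[of _ "C * D"] conjI allI impI)
    fix N :: nat assume "N \<ge> 1"
    thus "\<bar>mu_conv_sum N\<bar> \<le> C * D * (real N * exp (- (ln (real N) powr (38/100))))"
      using D(2)[of N] C by (simp add: field_simps)
  qed (use C D in auto)
qed


section \<open>The divisor problem\<close>

text \<open>The value at integers is -1/2 instead of the customary 0, so that the integer part of
  \<open>v\<close> is \<open>v - 1/2 - saw v\<close> without exception.\<close>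

definition saw :: "real \<Rightarrow> real" where
  "saw v = frac v - 1 / 2"

lemma abs_saw_le: "\<bar>saw v\<bar> \<le> 1 / 2"
  using frac_ge_0[of v] frac_lt_1[of v] by (simp add: saw_def abs_if)

lemma saw_add_of_int [simp]: "saw (v + of_int n) = saw v"
  by (simp add: saw_def)

text \<open>As \<open>a\<close> is coprime to \<open>q\<close>, the multiples \<open>j * a\<close>
  run through all residues, and \<open>b\<close> may be reduced modulo \<open>1 / q\<close> to
  \<open>c\<close> with \<open>0 \<le> c < 1 / q\<close>. Then no fractional part wraps around, and
  the sum equals \<open>c * q - 1/2\<close>.\<close>

lemma complete_sum_saw:
  fixes a q :: int and b :: real
  assumes q: "q > 0" and cop: "coprime a q"
  shows "\<bar>\<Sum>j\<in>{0..<q}. saw (b + of_int (j * a) / of_int q)\<bar> \<le> 1 / 2"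
proof -
  define m where "m = \<lfloor>of_int q * b\<rfloor>"
  define c where "c = b - of_int m / of_int q"
  have c: "0 \<le> c" "c * of_int q < 1"
  proof -
    have "of_int m \<le> of_int q * b" "of_int q * b < of_int m + 1"
      unfolding m_def by linarith+
    moreover have "c * of_int q = of_int q * b - of_int m" using q by (simp add: c_def field_simps)
    ultimately have "0 \<le> c * of_int q" "c * of_int q < 1" by linarith+
    thus "0 \<le> c" "c * of_int q < 1" using q by (auto simp: zero_le_mult_iff)
  qed
  have inj: "inj_on (\<lambda>j. (j * a + m) mod q) {0..<q}"
  proof
    fix i j assume ij: "i \<in> {0..<q}" "j \<in> {0..<q}" and eq: "(i * a + m) mod q = (j * a + m) mod q"
    have "q dvd (i * a + m) - (j * a + m)" using eq by (simp add: mod_eq_dvd_iff)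
    hence "q dvd (i - j) * a" by (simp add: algebra_simps)
    hence "q dvd i - j" using coprime_dvd_mult_left_iff[of q a "i - j"] coprime_commute[of a q] cop by blast
    moreover have "\<bar>i - j\<bar> < q" using ij by auto
    ultimately show "i = j" using dvd_imp_le_int[of "i - j" q] by linarith
  qed
  have img: "(\<lambda>j. (j * a + m) mod q) ` {0..<q} = {0..<q}"
    by (rule endo_inj_surj[OF _ _ inj]) (use q in auto)
  have "(\<Sum>j\<in>{0..<q}. saw (b + of_int (j * a) / of_int q)) =
        (\<Sum>j\<in>{0..<q}. saw (c + of_int ((j * a + m) mod q) / of_int q))"
  proof (rule sum.cong[OF refl])
    fix j
    have "of_int (j * a + m) = of_int ((j * a + m) div q) * of_int q + (of_int ((j * a + m) mod q) :: real)"
      by (metis div_mult_mod_eq of_int_add of_int_mult)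
    hence "(of_int (j * a) + of_int m) / of_int q = of_int ((j * a + m) div q) + (of_int ((j * a + m) mod q) / of_int q :: real)"
      using q by (simp add: field_simps)
    hence "b + of_int (j * a) / of_int q = (c + of_int ((j * a + m) mod q) / of_int q) + of_int ((j * a + m) div q)"
      unfolding c_def by (simp add: add_divide_distrib)
    thus "saw (b + of_int (j * a) / of_int q) = saw (c + of_int ((j * a + m) mod q) / of_int q)"
      by (simp only: saw_add_of_int)
  qed
  also have "\<dots> = (\<Sum>i\<in>(\<lambda>j. (j * a + m) mod q) ` {0..<q}. saw (c + of_int i / of_int q))"
    by (subst sum.reindex[OF inj]) simp
  also have "\<dots> = (\<Sum>i\<in>{0..<q}. saw (c + of_int i / of_int q))" unfolding img ..
  also have "\<dots> = (\<Sum>i\<in>{0..<q}. c + of_int i / of_int q - 1 / 2)"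
  proof (rule sum.cong[OF refl])
    fix i assume i: "i \<in> {0..<q}"
    have "(of_int i :: real) \<le> of_int (q - 1)" using i by (simp only: of_int_le_iff) auto
    hence "c * of_int q + of_int i < of_int q" using c by simp
    hence "c + of_int i / of_int q < 1" using q by (simp add: field_simps)
    moreover have "0 \<le> c + of_int i / of_int q" using c i q by simp
    ultimately show "saw (c + of_int i / of_int q) = c + of_int i / of_int q - 1 / 2"
      by (simp add: saw_def frac_eq)
  qed
  also have "\<dots> = of_int q * (c - 1/2) + (\<Sum>i\<in>{0..<q}. of_int i) / of_int q"
    using q by (simp add: sum.distrib sum_subtractf sum_divide_distrib algebra_simps)
  also have "(\<Sum>i\<in>{0..<q}. of_int i :: real) = of_int q * (of_int q - 1) / 2"
  proof -
    have "(\<Sum>i\<in>{0..<q}. of_int i :: real) = (\<Sum>i<nat q. real i)"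
      by (rule sum.reindex_bij_witness[of _ int nat]) auto
    also have "(\<Sum>i<k. real i) = real k * (real k - 1) / 2" for k
      by (induction k) (simp_all add: field_simps)
    finally show ?thesis using q by simp
  qed
  also have "of_int q * (c - 1/2) + of_int q * (of_int q - 1) / 2 / of_int q = c * of_int q - 1 / 2"
    using q by (simp add: field_simps)
  finally show ?thesis using c(2) mult_nonneg_nonneg[OF c(1), of "of_int q"] q by linarith
qed

text \<open>The jumps of \<open>saw\<close> rule out a continuity argument, but the integer part is
  monotone: moving the arguments to the progressions based at \<open>b - e\<close> and
  \<open>b + e\<close> bounds each term from above and below with a loss of
  \<open>2 * e\<close>.\<close>

lemma complete_sum_saw_perturbed:
  fixes a q :: int and b e :: real
  assumes q: "q > 0" and cop: "coprime a q"
    and v: "\<And>j. j \<in> {0..<q} \<Longrightarrow> \<bar>v j - (b + of_int (j * a) / of_int q)\<bar> \<le> e"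
  shows "\<bar>\<Sum>j\<in>{0..<q}. saw (v j)\<bar> \<le> 2 * of_int q * e + 1 / 2"
proof -
  let ?w = "\<lambda>j. b + of_int (j * a) / of_int q"
  have "(\<Sum>j\<in>{0..<q}. saw (v j)) \<le> (\<Sum>j\<in>{0..<q}. saw ((b - e) + of_int (j * a) / of_int q) + 2 * e)"
  proof (rule sum_mono)
    fix j assume j: "j \<in> {0..<q}"
    have "\<lfloor>(b - e) + of_int (j * a) / of_int q\<rfloor> \<le> \<lfloor>v j\<rfloor>"
      using v[OF j] by (intro floor_mono) linarith
    thus "saw (v j) \<le> saw ((b - e) + of_int (j * a) / of_int q) + 2 * e"
      using v[OF j] by (simp add: saw_def frac_def)
  qed
  also have "\<dots> = (\<Sum>j\<in>{0..<q}. saw ((b - e) + of_int (j * a) / of_int q)) + 2 * of_int q * e"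
    using q by (simp add: sum.distrib)
  finally have 1: "(\<Sum>j\<in>{0..<q}. saw (v j)) \<le> 1 / 2 + 2 * of_int q * e"
    using complete_sum_saw[OF q cop, of "b - e"] by linarith
  have "(\<Sum>j\<in>{0..<q}. saw (v j)) \<ge> (\<Sum>j\<in>{0..<q}. saw ((b + e) + of_int (j * a) / of_int q) - 2 * e)"
  proof (rule sum_mono)
    fix j assume j: "j \<in> {0..<q}"
    have "\<lfloor>v j\<rfloor> \<le> \<lfloor>(b + e) + of_int (j * a) / of_int q\<rfloor>"
      using v[OF j] by (intro floor_mono) linarith
    thus "saw ((b + e) + of_int (j * a) / of_int q) - 2 * e \<le> saw (v j)"
      using v[OF j] by (simp add: saw_def frac_def)
  qed
  moreover have "(\<Sum>j\<in>{0..<q}. saw ((b + e) + of_int (j * a) / of_int q) - 2 * e) =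
     (\<Sum>j\<in>{0..<q}. saw ((b + e) + of_int (j * a) / of_int q)) - 2 * of_int q * e"
    using q by (simp add: sum_subtractf)
  ultimately have 2: "(\<Sum>j\<in>{0..<q}. saw (v j)) \<ge> - (1 / 2) - 2 * of_int q * e"
    using complete_sum_saw[OF q cop, of "b + e"] by linarith
  show ?thesis using 1 2 by linarith
qed

text \<open>Inside a block of \<open>q\<close> consecutive \<open>h\<close> the slope
  \<open>\<alpha>\<close> may be replaced by \<open>a / q\<close> with an error of at most
  \<open>q / (q * Q) = 1 / Q\<close>, and the block becomes a perturbed complete sum of size
  \<open>O(1)\<close>. The incomplete last block is bounded trivially by
  \<open>q / 2\<close>.\<close>

lemma saw_sum_blocks:
  fixes \<alpha> b E :: real and a :: int and q H Q :: nat
  assumes q: "q > 0" "q \<le> Q" and cop: "coprime a (int q)"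
    and \<alpha>: "\<bar>\<alpha> - of_int a / real q\<bar> \<le> 1 / (real q * real Q)"
    and v: "\<And>h. h < H \<Longrightarrow> \<bar>v h - (b + real h * \<alpha>)\<bar> \<le> E"
  shows "\<bar>\<Sum>h<H. saw (v h)\<bar> \<le> H * (2 * (1 / Q + E)) + H / (2 * q) + q / 2"
proof -
  define B r where "B = H div q" and "r = H mod q"
  have H: "H = B * q + r" by (simp add: B_def r_def)
  have Q: "Q > 0" using q by simp
  have block: "\<bar>\<Sum>h\<in>{i*q..<i*q+q}. saw (v h)\<bar> \<le> 2 * q * (1 / Q + E) + 1 / 2" if i: "i < B" for i
  proof -
    have iq: "i * q + q \<le> H"
    proof -
      have "Suc i * q \<le> B * q" using i by (intro mult_le_mono1) simp
      thus ?thesis using H by simp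
    qed
    have "(\<Sum>h\<in>{c..<c+q}. F h) = (\<Sum>j\<in>{0..<int q}. F (c + nat j))" for c and F :: "nat \<Rightarrow> real"
      by (rule sum.reindex_bij_witness[of _ "\<lambda>j. c + nat j" "\<lambda>h. int (h - c)"]) (auto simp flip: of_nat_diff)
    hence "(\<Sum>h\<in>{i*q..<i*q+q}. saw (v h)) = (\<Sum>j\<in>{0..<int q}. saw (v (i * q + nat j)))" .
    also have "\<bar>\<dots>\<bar> \<le> 2 * of_int (int q) * (1 / Q + E) + 1 / 2"
    proof (rule complete_sum_saw_perturbed)
      show "int q > 0" "coprime a (int q)" using q cop by auto
      fix j assume j: "j \<in> {0..<int q}"
      define n where "n = nat j"
      have n: "n < q" "j = int n" using j by (auto simp: n_def)
      have "\<bar>v (i * q + n) - (b + real (i * q + n) * \<alpha>)\<bar> \<le> E" using n iq by (intro v) auto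
      moreover have "\<bar>real n * (\<alpha> - of_int a / real q)\<bar> \<le> real q * (1 / (real q * real Q))"
        unfolding abs_mult using n \<alpha> by (intro mult_mono) auto
      hence "\<bar>real n * \<alpha> - real n * of_int a / real q\<bar> \<le> 1 / Q"
        using q by (simp add: algebra_simps)
      moreover have "b + real (i * q + n) * \<alpha> = b + real (i * q) * \<alpha> + real n * \<alpha>" by (simp add: algebra_simps)
      ultimately have "\<bar>v (i * q + n) - (b + real (i * q) * \<alpha> + real n * of_int a / real q)\<bar> \<le> 1 / Q + E" by linarith
      thus "\<bar>v (i * q + nat j) - (b + real (i * q) * \<alpha> + of_int (j * a) / of_int (int q))\<bar> \<le> 1 / real Q + E"
        using n by simp
    qed
    finally show ?thesis by simp
  qed
  have rest: "\<bar>\<Sum>h\<in>{B*q..<H}. saw (v h)\<bar> \<le> q / 2"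
  proof -
    have "\<bar>\<Sum>h\<in>{B*q..<H}. saw (v h)\<bar> \<le> (\<Sum>h\<in>{B*q..<H}. 1 / 2)"
      by (rule order_trans[OF sum_abs sum_mono]) (rule abs_saw_le)
    also have "\<dots> = r / 2" using H by simp
    also have "r < q" using q by (simp add: r_def)
    finally show ?thesis by simp
  qed
  have "(\<Sum>h<H. saw (v h)) = (\<Sum>h<B*q. saw (v h)) + (\<Sum>h\<in>{B*q..<H}. saw (v h))"
    using H by (subst sum.atLeastLessThan_concat[of 0 "B * q" H, symmetric, unfolded atLeast0LessThan]) auto
  also have "(\<Sum>h<B*q. saw (v h)) = (\<Sum>i<B. \<Sum>h\<in>{i*q..<i*q+q}. saw (v h))"
    by (rule sum.nat_group[symmetric])
  finally have "\<bar>\<Sum>h<H. saw (v h)\<bar> \<le> \<bar>\<Sum>i<B. \<Sum>h\<in>{i*q..<i*q+q}. saw (v h)\<bar> + q / 2"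
    using rest by linarith
  also have "\<bar>\<Sum>i<B. \<Sum>h\<in>{i*q..<i*q+q}. saw (v h)\<bar> \<le> (\<Sum>i<B. 2 * q * (1 / Q + E) + 1 / 2)"
    by (rule order_trans[OF sum_abs sum_mono]) (use block in auto)
  also have "\<dots> = (real B * q) * (2 * (1 / Q + E)) + real B / 2" by (simp add: algebra_simps)
  also have "\<dots> \<le> H * (2 * (1 / Q + E)) + H / (2 * q)"
  proof (cases "H = 0")
    case True
    thus ?thesis by (simp add: B_def)
  next
    case False
    have "E \<ge> 0" using v[of 0] False by linarith
    moreover have Bq: "real B * q \<le> H" using H by (metis le_add1 of_nat_le_iff of_nat_mult)
    moreover have "real B / 2 \<le> H / (2 * q)" using Bq q by (simp add: field_simps)
    ultimately show ?thesis using Q by (intro add_mono mult_right_mono) auto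
  qed
  finally show ?thesis by simp
qed

text \<open>Each shift by one exchanges a single term at either end, and both are at most 1/2 in
  modulus.\<close>

lemma saw_sum_shift:
  fixes f :: "nat \<Rightarrow> real"
  shows "\<bar>(\<Sum>n\<in>{M<..N}. saw (f n)) - (\<Sum>n\<in>{M<..N}. saw (f (n + h)))\<bar> \<le> h"
proof (induction h)
  case (Suc h)
  have "(\<Sum>n\<in>{M<..N}. saw (f (n + h))) - (\<Sum>n\<in>{M<..N}. saw (f (n + Suc h))) =
        (if M \<le> N then saw (f (Suc M + h)) - saw (f (Suc N + h)) else 0)"
  proof (cases "M \<le> N")
    case True
    have "(\<Sum>n\<in>{M<..N}. saw (f (n + h)) - saw (f (n + Suc h))) = - (\<Sum>n\<in>{Suc M..N}. saw (f (Suc n + h)) - saw (f (n + h)))"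
      by (simp add: sum_negf[symmetric] atLeastSucAtMost_greaterThanAtMost)
    also have "(\<Sum>n\<in>{Suc M..N}. saw (f (Suc n + h)) - saw (f (n + h))) = saw (f (Suc N + h)) - saw (f (Suc M + h))"
      using True by (subst sum_Suc_diff[of "Suc M" N "\<lambda>n. saw (f (n + h))"]) auto
    finally show ?thesis using True by (simp add: sum_subtractf)
  qed auto
  also have "\<bar>\<dots>\<bar> \<le> 1" using abs_saw_le[of "f (Suc M + h)"] abs_saw_le[of "f (Suc N + h)"] by auto
  finally show ?case using Suc.IH by simp
qed auto

lemma card_le_of_diff_le:
  fixes S :: "nat set"
  assumes "finite S" "\<And>m n. m \<in> S \<Longrightarrow> n \<in> S \<Longrightarrow> m < n \<Longrightarrow> n - m \<le> L"
  shows "card S \<le> L + 1"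
proof (cases "S = {}")
  case False
  have "S \<subseteq> {Min S..Min S + L}"
  proof
    fix n assume n: "n \<in> S"
    have m: "Min S \<in> S" "Min S \<le> n" using False n assms by auto
    thus "n \<in> {Min S..Min S + L}" using assms(2)[OF m(1) n] by (cases "Min S = n") auto
  qed
  from card_mono[OF _ this] show ?thesis by simp
qed auto

text \<open>For arguments up to \<open>sqrt y\<close> the function \<open>y / n\<^sup>2\<close>
  falls by at least \<open>1 / sqrt y\<close> per step, so the \<open>n\<close> in question lie in a
  range of length \<open>2 * d * sqrt y\<close>.\<close>

lemma card_near_fraction:
  fixes y r d :: real and N :: nat
  assumes y: "y \<ge> 1" and N: "real N \<le> sqrt y" and d: "d \<ge> 0"
  shows "real (card {n\<in>{1..N}. \<bar>y / (real n)\<^sup>2 - r\<bar> \<le> d}) \<le> 2 * d * sqrt y + 1"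
proof -
  let ?S = "{n\<in>{1..N}. \<bar>y / (real n)\<^sup>2 - r\<bar> \<le> d}"
  define L where "L = nat \<lfloor>2 * d * sqrt y\<rfloor>"
  have "card ?S \<le> L + 1"
  proof (rule card_le_of_diff_le)
    fix m n assume mn: "m \<in> ?S" "n \<in> ?S" "m < n"
    have pos: "0 < real m" "real m < real n" "real n \<le> sqrt y" using mn N by auto
    have sy: "sqrt y > 0" using y by simp
    have "y / (real m)\<^sup>2 - y / (real n)\<^sup>2 \<le> 2 * d" using mn(1,2) by auto
    moreover have "y / (real m)\<^sup>2 - y / (real n)\<^sup>2 \<ge> (real n - real m) / sqrt y"
    proof -
      have "y / (real m)\<^sup>2 - y / (real n)\<^sup>2 = (real n - real m) * (y * (real n + real m) / ((real m)\<^sup>2 * (real n)\<^sup>2))"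
        using pos by (simp add: field_simps power2_eq_square)
      moreover have "y * (real n + real m) / ((real m)\<^sup>2 * (real n)\<^sup>2) \<ge> 1 / sqrt y"
      proof -
        have "(real m)\<^sup>2 \<le> (sqrt y)\<^sup>2" using pos by (intro power_mono) auto
        hence m2: "(real m)\<^sup>2 \<le> y" using y by simp
        have "(real m)\<^sup>2 * (real n)\<^sup>2 = (real m)\<^sup>2 * (real n * real n)" by (simp add: power2_eq_square)
        also have "\<dots> \<le> y * (real n * sqrt y)" using m2 pos y by (intro mult_mono) auto
        also have "\<dots> \<le> y * ((real n + real m) * sqrt y)" using pos y by (intro mult_left_mono mult_right_mono) auto
        finally have "(real m)\<^sup>2 * (real n)\<^sup>2 \<le> y * (real n + real m) * sqrt y" by (simp add: mult_ac)
        thus ?thesis using pos sy by (simp add: field_simps)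
      qed
      hence "(real n - real m) * (1 / sqrt y) \<le> (real n - real m) * (y * (real n + real m) / ((real m)\<^sup>2 * (real n)\<^sup>2))"
        using pos by (intro mult_left_mono) auto
      moreover have "(real n - real m) / sqrt y = (real n - real m) * (1 / sqrt y)" by simp
      ultimately show ?thesis by linarith
    qed
    ultimately have "(real n - real m) / sqrt y \<le> 2 * d" by linarith
    hence "real (n - m) \<le> 2 * d * sqrt y" using pos sy by (simp add: field_simps of_nat_diff)
    thus "n - m \<le> L" unfolding L_def by (simp add: le_nat_floor)
  qed auto
  hence "real (card ?S) \<le> real L + 1" by linarith
  also have "real L \<le> 2 * d * sqrt y" unfolding L_def using d y by (simp add: of_nat_floor)
  finally show ?thesis by simp
qed


text \<open>Put \<open>k \<approx> y powr (1/40)\<close>. For \<open>n \<le> k ^ 19\<close> the trivial bound is enough. For larger \<open>n\<close> the sum is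
  averaged over shifts \<open>h < k ^ 8\<close>, on which \<open>y / (n + h)\<close> is linear up to \<open>O(1 / k)\<close>. Approximating the slope
  \<open>y / n\<^sup>2\<close> by a fraction of denominator \<open>q \<le> k ^ 7\<close>, each block of \<open>q\<close> shifts contributes \<open>O(1)\<close>; the
  slope is monotone in \<open>n\<close>, so few \<open>n\<close> have \<open>q \<le> k\<close>.\<close>
lemma saw_hyperbola_sum:
  "\<exists>C>0. \<forall>y\<ge>1. \<bar>\<Sum>n=1..nat \<lfloor>sqrt y\<rfloor>. saw (y / real n)\<bar> \<le> C * y powr (19/40)"
proof (intro exI[of _ "2 ^ 67"] conjI allI impI)
  fix y :: real assume y: "y \<ge> 1"
  define N where "N = nat \<lfloor>sqrt y\<rfloor>"
  \<comment> \<open>In these units \<open>sqrt y\<close> is about \<open>k ^ 20\<close>, so the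
    target \<open>k ^ 19\<close> saves one factor \<open>k\<close> over the trivial bound.\<close>
  define k where "k = nat \<lfloor>y powr (1/40)\<rfloor>"
  have "y powr (1/40) \<ge> 1" using y by (simp add: ge_one_powr_ge_zero)
  moreover from this have "\<lfloor>y powr (1/40)\<rfloor> \<ge> 1" by simp
  ultimately have k1: "k \<ge> 1" and k_le: "real k \<le> y powr (1/40)" and k_ge: "y powr (1/40) \<le> 2 * real k"
    unfolding k_def by linarith+
  have k1': "real k \<ge> 1" using k1 by simp
  have ypow: "(y powr (1/40)) ^ n = y powr (real n / 40)" for n
    using y by (simp add: powr_power)
  \<comment> \<open>Rounding \<open>k\<close> down costs a factor 2, here raised to the 40th power;
    this is the source of the large constants.\<close>
  have y_le: "y \<le> (2 * real k) ^ 40"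
    using power_mono[OF k_ge, of 40] ypow[of 40] y by simp
  have k19: "real k ^ 19 \<le> y powr (19/40)"
    using power_mono[OF k_le, of 19] ypow[of 19] by simp
  have sqrt_le: "sqrt y \<le> 2 ^ 20 * real k ^ 20"
  proof (rule real_le_lsqrt)
    show "y \<le> (2 ^ 20 * real k ^ 20)\<^sup>2" using y_le by (simp add: power_mult_distrib flip: power_mult)
  qed (use k1 y in auto)
  have N_le: "real N \<le> sqrt y" unfolding N_def using y by (simp add: of_nat_floor)
  have "\<bar>\<Sum>n=1..N. saw (y / real n)\<bar> \<le> 2 ^ 67 * real k ^ 19"
  proof (cases "N \<le> k ^ 19")
    case True
    have "\<bar>\<Sum>n=1..N. saw (y / real n)\<bar> \<le> (\<Sum>n=1..N. 1 / 2)"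
      by (rule order_trans[OF sum_abs sum_mono]) (rule abs_saw_le)
    also have "\<dots> \<le> real N" by simp
    also have "\<dots> \<le> real (k ^ 19)" using True by (simp only: of_nat_le_iff)
    also have "\<dots> \<le> 2 ^ 67 * real k ^ 19" using k1' by simp
    finally show ?thesis .
  next
    case False
    define I where "I = {k ^ 19<..N}"
    define Q H where "Q = k ^ 7" and "H = k ^ 8"
    have Q: "Q > 0" and H: "H > 0" using k1 by (auto simp: Q_def H_def)
    have I_pos: "real n \<ge> real k ^ 19" "n > 0" "real n \<le> sqrt y" "n \<in> {1..N}" if "n \<in> I" for n
    proof -
      have "k ^ 19 < n" "n \<le> N" using that by (auto simp: I_def)
      thus "n > 0" "real n \<le> sqrt y" "n \<in> {1..N}" using N_le by auto
      show "real n \<ge> real k ^ 19" using \<open>k ^ 19 < n\<close> by (metis less_imp_le of_nat_le_iff of_nat_power)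
    qed
    have "\<exists>a q. coprime a (int q) \<and> 0 < q \<and> q \<le> Q \<and> \<bar>real q * (y / (real n)\<^sup>2) - of_int a\<bar> < 1 / Q" for n
    proof -
      obtain a q where "coprime a q" "0 < q" "q \<le> int Q" "\<bar>of_int q * (y / (real n)\<^sup>2) - of_int a\<bar> < 1 / Q"
        using Dirichlet_approx_coprime[OF Q, of "y / (real n)\<^sup>2"] by metis
      thus ?thesis by (intro exI[of _ a] exI[of _ "nat q"]) auto
    qed
    then obtain a q where aq: "\<And>n. coprime (a n) (int (q n))" "\<And>n. 0 < q n" "\<And>n. q n \<le> Q"
      "\<And>n. \<bar>real (q n) * (y / (real n)\<^sup>2) - of_int (a n)\<bar> < 1 / Q"
      by metis
    have near: "\<bar>y / (real n)\<^sup>2 - of_int (a n) / real (q n)\<bar> \<le> 1 / (real (q n) * real Q)" for n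
    proof -
      have "\<bar>y / (real n)\<^sup>2 - of_int (a n) / real (q n)\<bar> * real (q n) = \<bar>real (q n) * (y / (real n)\<^sup>2) - of_int (a n)\<bar>"
      proof -
        have "(y / (real n)\<^sup>2 - of_int (a n) / real (q n)) * real (q n) = real (q n) * (y / (real n)\<^sup>2) - of_int (a n)"
          using aq(2)[of n] by (simp add: left_diff_distrib)
        thus ?thesis by (metis abs_mult abs_of_nat)
      qed
      thus ?thesis using aq(2,4)[of n] by (simp add: field_simps)
    qed
    \<comment> \<open>Deviation from linearity: \<open>h\<^sup>2 * y / n ^ 3\<close> with
      \<open>h < k ^ 8\<close>, \<open>y \<le> (2 * k) ^ 40\<close> and
      \<open>n \<ge> k ^ 19\<close>.\<close>
    define E where "E = 2 ^ 40 / real k"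
    have inner: "\<bar>\<Sum>h<H. saw (y / real (n + h))\<bar> \<le> H * (2 * (1 / Q + E)) + H / (2 * q n) + q n / 2" if n: "n \<in> I" for n
    proof (rule saw_sum_blocks[where \<alpha> = "- (y / (real n)\<^sup>2)" and b = "y / real n" and a = "- a n"])
      show "q n > 0" "q n \<le> Q" "coprime (- a n) (int (q n))" using aq by auto
      show "\<bar>- (y / (real n)\<^sup>2) - of_int (- a n) / real (q n)\<bar> \<le> 1 / (real (q n) * real Q)"
        using near[of n] by linarith
      fix h assume h: "h < H"
      have n0: "real n > 0" using I_pos[OF n] by simp
      have c: "real k ^ 19 \<le> real n + real h" using I_pos(1)[OF n] of_nat_0_le_iff[of h] by linarith
      have "y / real (n + h) - (y / real n + real h * - (y / (real n)\<^sup>2)) = (real h)\<^sup>2 * y / ((real n)\<^sup>2 * (real n + real h))"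
        using n0 by (simp add: field_simps power2_eq_square)
      moreover have "\<dots> \<ge> 0" using y n0 by simp
      moreover have "(real h)\<^sup>2 * y / ((real n)\<^sup>2 * (real n + real h)) \<le> (real k ^ 8)\<^sup>2 * (2 * real k) ^ 40 / ((real k ^ 19)\<^sup>2 * real k ^ 19)"
      proof (rule frac_le)
        have "real h \<le> real k ^ 8" using h unfolding H_def by (metis less_imp_le of_nat_le_iff of_nat_power)
        thus "(real h)\<^sup>2 * y \<le> (real k ^ 8)\<^sup>2 * (2 * real k) ^ 40"
          using y y_le by (intro mult_mono power_mono) auto
        show "(real k ^ 19)\<^sup>2 * real k ^ 19 \<le> (real n)\<^sup>2 * (real n + real h)"
          by (intro mult_mono power_mono c I_pos(1)[OF n]) auto
      qed (use k1 in auto)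
      moreover have "(real k ^ 8)\<^sup>2 * (2 * real k) ^ 40 / ((real k ^ 19)\<^sup>2 * real k ^ 19) = E"
      proof -
        have "(real k ^ 8)\<^sup>2 * (2 * real k) ^ 40 = 2 ^ 40 * real k ^ 56"
          by (simp add: power_mult_distrib flip: power_mult power_add)
        moreover have "(real k ^ 19)\<^sup>2 * real k ^ 19 = real k ^ 56 * real k"
          using power_add[of "real k" 56 1] by (simp flip: power_mult power_add)
        ultimately have "(real k ^ 8)\<^sup>2 * (2 * real k) ^ 40 / ((real k ^ 19)\<^sup>2 * real k ^ 19) = 2 ^ 40 * real k ^ 56 / (real k ^ 56 * real k)"
          by (simp only:)
        thus ?thesis using k1 by (simp add: E_def)
      qed
      ultimately show "\<bar>y / real (n + h) - (y / real n + real h * - (y / (real n)\<^sup>2))\<bar> \<le> E" by simp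
    qed
    define Bad where "Bad = {n\<in>I. q n \<le> k}"
    have finI: "finite I" by (simp add: I_def)
    have card_I: "real (card I) \<le> 2 ^ 20 * real k ^ 20"
    proof -
      have "card I \<le> N" by (simp add: I_def)
      thus ?thesis using N_le sqrt_le by linarith
    qed
    have good: "\<bar>\<Sum>h<H. saw (y / real (n + h))\<bar> \<le> H * (2 ^ 42 / k)" if n: "n \<in> I - Bad" for n
    proof -
      have qk: "q n > k" using n by (auto simp: Bad_def)
      have 1: "1 / real Q \<le> 1 / k"
      proof -
        have "real k ^ 1 \<le> real k ^ 7" using k1' by (intro power_increasing) auto
        thus ?thesis using k1 by (simp add: Q_def field_simps)
      qed
      have 2: "real H / (2 * q n) \<le> H * (1 / k)"
        using qk k1 by (simp add: field_simps mult_mono)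
      \<comment> \<open>The range \<open>H = k * Q\<close> of shifts exceeds every denominator by a
        factor \<open>k\<close>, so the incomplete block is negligible.\<close>
      have "real (q n) / 2 \<le> Q" using aq(3)[of n] by simp
      also have "\<dots> = H * (1 / k)" using k1 power_add[of "real k" 7 1] by (simp add: Q_def H_def)
      finally have 3: "real (q n) / 2 \<le> H * (1 / k)" .
      have "\<bar>\<Sum>h<H. saw (y / real (n + h))\<bar> \<le> H * (2 * (1 / Q + E)) + H / (2 * q n) + q n / 2"
        using n by (intro inner) auto
      also have "\<dots> \<le> H * (2 * (1 / k + E)) + H * (1 / k) + H * (1 / k)"
        using 1 2 3 by (intro add_mono mult_left_mono) auto
      also have "\<dots> = H * ((4 + 2 ^ 41) / k)" by (simp add: E_def field_simps)
      also have "\<dots> \<le> H * (2 ^ 42 / k)" by (intro mult_left_mono divide_right_mono) auto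
      finally show ?thesis .
    qed
    have triv: "\<bar>\<Sum>h<H. saw (y / real (n + h))\<bar> \<le> H" for n
    proof -
      have "\<bar>\<Sum>h<H. saw (y / real (n + h))\<bar> \<le> (\<Sum>h<H. 1 / 2)"
        by (rule order_trans[OF sum_abs sum_mono]) (rule abs_saw_le)
      thus ?thesis by simp
    qed
    \<comment> \<open>The slopes are at most \<open>2 ^ 40 * k\<^sup>2\<close>, so only
      \<open>O(k ^ 4)\<close> fractions with denominator at most \<open>k\<close> can occur. Each is
      within \<open>1 / Q\<close> of the slope for \<open>O(sqrt y / Q) = O(k ^ 13)\<close> values
      of \<open>n\<close>, which makes \<open>O(k ^ 17)\<close> in all.\<close>
    have card_bad: "real (card Bad) \<le> 2 ^ 64 * real k ^ 19"
    proof -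
      define A where "A = 2 ^ 41 * k ^ 3"
      define S where "S = (\<lambda>(q, a). {n\<in>{1..N}. \<bar>y / (real n)\<^sup>2 - real a / real q\<bar> \<le> 1 / Q})"
      have sub: "Bad \<subseteq> (\<Union>p\<in>{1..k} \<times> {0..A}. S p)"
      proof
        fix n assume n: "n \<in> Bad"
        hence nI: "n \<in> I" and qk: "q n \<le> k" by (auto simp: Bad_def)
        have n0: "real n > 0" using I_pos[OF nI] by simp
        have Q1: "1 / real Q \<le> 1" using Q by simp
        have \<theta>: "y / (real n)\<^sup>2 \<le> 2 ^ 40 * real k ^ 2"
        proof -
          have "y / (real n)\<^sup>2 \<le> (2 * real k) ^ 40 / (real k ^ 19)\<^sup>2"
            using y_le I_pos(1)[OF nI] k1 y by (intro frac_le power_mono) auto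
          also have "\<dots> = 2 ^ 40 * real k ^ 2"
            using k1 power_diff[of "real k" 38 40] by (simp add: power_mult_distrib flip: power_mult)
          finally show ?thesis .
        qed
        have a_gt: "of_int (a n) > real (q n) * (y / (real n)\<^sup>2) - 1" and a_lt: "of_int (a n) < real (q n) * (y / (real n)\<^sup>2) + 1"
          using aq(4)[of n] Q1 by linarith+
        have "real (q n) * (y / (real n)\<^sup>2) \<ge> 0" using y by simp
        hence "of_int (a n) > (-1 :: real)" using a_gt by linarith
        hence a0: "a n \<ge> 0" by linarith
        have "real (q n) * (y / (real n)\<^sup>2) \<le> real k * (2 ^ 40 * real k ^ 2)"
          using qk \<theta> y by (intro mult_mono) auto
        hence "of_int (a n) < real k * (2 ^ 40 * real k ^ 2) + 1" using a_lt by linarith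
        also have "\<dots> = 2 ^ 40 * real k ^ 3 + 1" by (simp add: power2_eq_square power3_eq_cube)
        also have "\<dots> \<le> 2 ^ 41 * real k ^ 3" using one_le_power[OF k1', of 3] by simp
        also have "\<dots> = real A" by (simp add: A_def)
        finally have "of_int (a n) < real A" .
        hence aA: "nat (a n) \<le> A" by linarith
        have "1 / (real (q n) * real Q) \<le> 1 / Q"
          using aq(2)[of n] Q by (intro divide_left_mono) auto
        hence "n \<in> S (q n, nat (a n))"
          using near[of n] a0 I_pos(4)[OF nI] by (simp add: S_def)
        moreover have "(q n, nat (a n)) \<in> {1..k} \<times> {0..A}" using aq(2)[of n] qk aA by auto
        ultimately show "n \<in> (\<Union>p\<in>{1..k} \<times> {0..A}. S p)" by blast
      qed
      have cS: "real (card (S p)) \<le> 2 ^ 22 * real k ^ 13" for p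
      proof -
        obtain q' a' where p: "p = (q', a')" by (cases p)
        have "real (card (S p)) \<le> 2 * (1 / Q) * sqrt y + 1"
          unfolding S_def p prod.case by (rule card_near_fraction[OF y N_le]) auto
        also have "2 * (1 / Q) * sqrt y \<le> 2 * (1 / Q) * (2 ^ 20 * real k ^ 20)"
          by (intro mult_left_mono sqrt_le) auto
        also have "\<dots> = 2 ^ 21 * real k ^ 13"
          using k1 power_diff[of "real k" 7 20] by (simp add: Q_def)
        also have "2 ^ 21 * real k ^ 13 + 1 \<le> 2 ^ 22 * real k ^ 13" using one_le_power[OF k1', of 13] by simp
        finally show ?thesis by simp
      qed
      have "card Bad \<le> card (\<Union>p\<in>{1..k} \<times> {0..A}. S p)"
        by (rule card_mono[OF _ sub]) (auto simp: S_def)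
      also have "\<dots> \<le> (\<Sum>p\<in>{1..k} \<times> {0..A}. card (S p))" by (rule card_UN_le) simp
      finally have "real (card Bad) \<le> (\<Sum>p\<in>{1..k} \<times> {0..A}. real (card (S p)))"
        by (metis of_nat_le_iff of_nat_sum)
      also have "\<dots> \<le> (\<Sum>p\<in>{1..k} \<times> {0..A}. 2 ^ 22 * real k ^ 13)" by (intro sum_mono cS)
      also have "\<dots> = real k * (real A + 1) * (2 ^ 22 * real k ^ 13)" by (simp add: card_cartesian_product algebra_simps)
      also have "\<dots> \<le> real k * (2 ^ 42 * real k ^ 3) * (2 ^ 22 * real k ^ 13)"
        using one_le_power[OF k1', of 3] by (intro mult_left_mono mult_right_mono) (auto simp: A_def)
      also have "\<dots> = 2 ^ 64 * real k ^ 17"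
        using power_add[of "real k" 16 1] by (simp add: mult_ac)
      also have "\<dots> \<le> 2 ^ 64 * real k ^ 19" using k1' by (intro mult_left_mono power_increasing) auto
      finally show ?thesis .
    qed
    \<comment> \<open>Averaging: the sum is compared with its shifts by all \<open>h < H\<close>.
      Each comparison costs less than \<open>H\<close>, so the average is off by at most
      \<open>H = k ^ 8\<close>.\<close>
    have "real H * \<bar>\<Sum>n\<in>I. saw (y / real n)\<bar> = \<bar>\<Sum>h<H. \<Sum>n\<in>I. saw (y / real n)\<bar>" by (simp add: abs_mult)
    also have "\<dots> = \<bar>(\<Sum>h<H. (\<Sum>n\<in>I. saw (y / real n)) - (\<Sum>n\<in>I. saw (y / real (n + h)))) + (\<Sum>n\<in>I. \<Sum>h<H. saw (y / real (n + h)))\<bar>"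
      by (subst (2) sum.swap) (simp add: sum_subtractf)
    also have "\<dots> \<le> (\<Sum>h<H. \<bar>(\<Sum>n\<in>I. saw (y / real n)) - (\<Sum>n\<in>I. saw (y / real (n + h)))\<bar>) + (\<Sum>n\<in>I. \<bar>\<Sum>h<H. saw (y / real (n + h))\<bar>)"
      by (intro order_trans[OF abs_triangle_ineq] add_mono sum_abs)
    also have "(\<Sum>h<H. \<bar>(\<Sum>n\<in>I. saw (y / real n)) - (\<Sum>n\<in>I. saw (y / real (n + h)))\<bar>) \<le> (\<Sum>h<H. real H)"
    proof (rule sum_mono)
      fix h assume "h \<in> {..<H}"
      thus "\<bar>(\<Sum>n\<in>I. saw (y / real n)) - (\<Sum>n\<in>I. saw (y / real (n + h)))\<bar> \<le> real H"
        using saw_sum_shift[of "\<lambda>n. y / real n" "k ^ 19" N h] unfolding I_def by simp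
    qed
    also have "(\<Sum>n\<in>I. \<bar>\<Sum>h<H. saw (y / real (n + h))\<bar>) \<le> (\<Sum>n\<in>I. H * (2 ^ 42 / k) + (if n \<in> Bad then real H else 0))"
    proof (rule sum_mono)
      fix n assume n: "n \<in> I"
      have "0 \<le> H * (2 ^ 42 / real k)" by simp
      thus "\<bar>\<Sum>h<H. saw (y / real (n + h))\<bar> \<le> H * (2 ^ 42 / k) + (if n \<in> Bad then real H else 0)"
        using order_trans[OF triv[of n], of "H * (2 ^ 42 / k) + H"] good[of n] n
        by (cases "n \<in> Bad") simp_all
    qed
    also have "\<dots> = H * (real (card I) * (2 ^ 42 / k) + real (card Bad))"
    proof -
      have "I \<inter> Bad = Bad" by (auto simp: Bad_def)
      thus ?thesis using finI by (simp add: sum.distrib sum.If_cases algebra_simps)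
    qed
    finally have "real H * \<bar>\<Sum>n\<in>I. saw (y / real n)\<bar> \<le> real H * (real H + (real (card I) * (2 ^ 42 / k) + real (card Bad)))"
      by (simp add: algebra_simps)
    hence "\<bar>\<Sum>n\<in>I. saw (y / real n)\<bar> \<le> real H + (real (card I) * (2 ^ 42 / k) + real (card Bad))"
      using H by simp
    also have "\<dots> \<le> real k ^ 19 + (2 ^ 62 * real k ^ 19 + 2 ^ 64 * real k ^ 19)"
    proof (intro add_mono card_bad)
      have "k ^ 8 \<le> k ^ 19" using k1 by (intro power_increasing) auto
      thus "real H \<le> real k ^ 19" unfolding H_def by (metis of_nat_le_iff of_nat_power)
      have "real (card I) * (2 ^ 42 / k) \<le> 2 ^ 20 * real k ^ 20 * (2 ^ 42 / k)"
        by (intro mult_right_mono card_I) auto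
      also have "\<dots> = 2 ^ 62 * real k ^ 19"
        using k1 power_add[of "real k" 19 1] by simp
      finally show "real (card I) * (2 ^ 42 / k) \<le> 2 ^ 62 * real k ^ 19" .
    qed
    finally have main: "\<bar>\<Sum>n\<in>I. saw (y / real n)\<bar> \<le> 2 ^ 66 * real k ^ 19" using one_le_power[OF k1', of 19] by simp
    have "\<bar>\<Sum>n=1..k^19. saw (y / real n)\<bar> \<le> (\<Sum>n=1..k^19. 1 / 2)"
      by (rule order_trans[OF sum_abs sum_mono]) (rule abs_saw_le)
    hence small: "\<bar>\<Sum>n=1..k^19. saw (y / real n)\<bar> \<le> real k ^ 19" by simp
    have "{1..N} = {1..k^19} \<union> I" using False by (auto simp: I_def)
    hence "(\<Sum>n=1..N. saw (y / real n)) = (\<Sum>n=1..k^19. saw (y / real n)) + (\<Sum>n\<in>I. saw (y / real n))"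
      by (simp only:) (rule sum.union_disjoint, auto simp: I_def)
    moreover have "2 ^ 66 * real k ^ 19 + real k ^ 19 \<le> 2 ^ 67 * real k ^ 19" using one_le_power[OF k1', of 19] by simp
    ultimately show ?thesis using main small by linarith
  qed
  also have "\<dots> \<le> 2 ^ 67 * y powr (19/40)" using k19 by (intro mult_left_mono) auto
  finally show "\<bar>\<Sum>n=1..nat \<lfloor>sqrt y\<rfloor>. saw (y / real n)\<bar> \<le> 2 ^ 67 * y powr (19/40)" unfolding N_def .
qed simp


section \<open>From the sawtooth sum to the divisor sum\<close>

definition div_sum :: "real \<Rightarrow> real" where
  "div_sum y = real (card {(m :: nat, n :: nat). m > 0 \<and> n > 0 \<and> real (m * n) \<le> y})"

lemma div_sum_hyperbola:
  assumes y: "y \<ge> 1"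
  defines "N \<equiv> nat \<lfloor>sqrt y\<rfloor>"
  shows "div_sum y = 2 * (\<Sum>m=1..N. of_int \<lfloor>y / real m\<rfloor>) - (real N)\<^sup>2"
proof -
  define A where "A = Sigma {1..N} (\<lambda>m. {1..nat \<lfloor>y / real m\<rfloor>})"
  define B where "B = (\<lambda>(m, n). (n, m)) ` A"
  let ?S = "{(m :: nat, n :: nat). m > 0 \<and> n > 0 \<and> real (m * n) \<le> y}"
  have A_iff: "(m, n) \<in> A \<longleftrightarrow> m > 0 \<and> n > 0 \<and> m \<le> N \<and> real (m * n) \<le> y" for m n
  proof (cases "m > 0")
    case True
    have "n \<le> nat \<lfloor>y / real m\<rfloor> \<longleftrightarrow> real n \<le> y / real m"
      using y by (simp add: le_nat_iff le_floor_iff)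
    also have "\<dots> \<longleftrightarrow> real (m * n) \<le> y" using True by (simp add: field_simps)
    finally show ?thesis using True by (auto simp: A_def)
  qed (auto simp: A_def)
  have B_iff: "(m, n) \<in> B \<longleftrightarrow> (n, m) \<in> A" for m n by (auto simp: B_def)
  have finA: "finite A" by (simp add: A_def)
  have cA: "real (card A) = (\<Sum>m=1..N. of_int \<lfloor>y / real m\<rfloor>)"
    using y by (simp add: A_def)
  have cB: "card B = card A" unfolding B_def by (rule card_image) (auto simp: inj_on_def)
  have N_iff: "n \<le> N \<longleftrightarrow> real n \<le> sqrt y" for n
    unfolding N_def using y by (simp add: le_nat_iff le_floor_iff)
  have AB: "?S = A \<union> B"
  proof -
    have "m \<le> N \<or> n \<le> N" if "real (m * n) \<le> y" for m n
    proof (rule ccontr)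
      assume "\<not> (m \<le> N \<or> n \<le> N)"
      hence "real m > sqrt y" "real n > sqrt y" by (auto simp: N_iff)
      hence "real m * real n > sqrt y * sqrt y" using y by (intro mult_strict_mono') auto
      thus False using that y by simp
    qed
    hence "(m, n) \<in> ?S \<longleftrightarrow> (m, n) \<in> A \<union> B" for m n
      unfolding Un_iff B_iff A_iff by (auto simp: mult.commute)
    thus ?thesis unfolding set_eq_iff split_paired_All by blast
  qed
  have "A \<inter> B = {1..N} \<times> {1..N}"
  proof -
    have "real (m * n) \<le> y" if "m \<le> N" "n \<le> N" for m n
    proof -
      have "real m * real n \<le> sqrt y * sqrt y" using that y by (intro mult_mono) (auto simp: N_iff)
      thus ?thesis using y by simp
    qed
    hence "(m, n) \<in> A \<inter> B \<longleftrightarrow> (m, n) \<in> {1..N} \<times> {1..N}" for m n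
      unfolding Int_iff B_iff A_iff by (auto simp: mult.commute)
    thus ?thesis unfolding set_eq_iff split_paired_All by blast
  qed
  hence "card (A \<inter> B) = N\<^sup>2" by (simp add: card_cartesian_product power2_eq_square)
  moreover have "card (A \<union> B) + card (A \<inter> B) = card A + card B"
    by (rule card_Un_Int[symmetric]) (use finA in \<open>auto simp: B_def\<close>)
  ultimately have "card (A \<union> B) + N\<^sup>2 = 2 * card A" using cB by simp
  hence "real (card (A \<union> B)) + (real N)\<^sup>2 = 2 * real (card A)" by (metis of_nat_add of_nat_mult of_nat_numeral of_nat_power)
  thus ?thesis unfolding div_sum_def AB cA by simp
qed

lemma ln_add_one_bounds:
  fixes t :: real
  assumes "0 \<le> t"
  shows "\<bar>ln (1 + t) - t\<bar> \<le> t\<^sup>2"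
proof -
  have "ln (1 + t) \<le> t" using assms by (simp add: ln_add_one_self_le_self)
  moreover have "ln (1 + t) \<ge> t / (1 + t)"
    using ln_le_minus_one[of "1 / (1 + t)"] assms by (simp add: ln_div field_simps)
  moreover have "t / (1 + t) \<ge> t - t\<^sup>2"
    using assms by (simp add: field_simps power2_eq_square)
  ultimately show ?thesis using assms by (simp add: abs_le_iff)
qed

text \<open>Apart from the sawtooth sum, all terms of the hyperbola formula beyond the main term
  cancel up to \<open>O(1)\<close>. As the harmonic sum is multiplied by \<open>2 * y\<close>, it
  has to be known up to \<open>O(1 / y)\<close>; hence the second-order term
  \<open>1 / (2 * (s + p))\<close> in \<open>e\<close>.\<close>

lemma div_sum_asymptotic:
  "\<exists>C>0. \<forall>y\<ge>1. \<bar>div_sum y - y * (ln y + 2 * euler_mascheroni - 1)\<bar> \<le> C * y powr (19/40)"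
proof -
  obtain C where C: "C > 0" "\<And>y. y \<ge> 1 \<Longrightarrow> \<bar>\<Sum>n=1..nat \<lfloor>sqrt y\<rfloor>. saw (y / real n)\<bar> \<le> C * y powr (19/40)"
    using saw_hyperbola_sum by blast
  have "\<bar>div_sum y - y * (ln y + 2 * euler_mascheroni - 1)\<bar> \<le> (2 * C + 20) * y powr (19/40)" if y: "y \<ge> 1" for y
  proof -
    define N s where "N = nat \<lfloor>sqrt y\<rfloor>" and "s = sqrt y"
    have s: "s \<ge> 1" "y = s\<^sup>2" using y by (auto simp: s_def)
    have N: "N \<ge> 1" "real N \<le> s" "s < real N + 1" 
    proof -
      have "\<lfloor>sqrt y\<rfloor> \<ge> 1" using y by simp
      thus "N \<ge> 1" "real N \<le> s" "s < real N + 1" unfolding N_def s_def by linarith+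
    qed
    \<comment> \<open>The available bounds for \<open>euler_mascheroni\<close> contain the logarithm
      of \<open>N + 1 = s + p\<close>; everything is then expanded about
      \<open>s = sqrt y\<close>.\<close>
    define p where "p = real N + 1 - s"
    have p: "0 < p" "p \<le> 1" using N by (auto simp: p_def)
    have fl: "of_int \<lfloor>v\<rfloor> = v - 1 / 2 - saw v" for v by (simp add: saw_def frac_def)
    have "(\<Sum>m=1..N. of_int \<lfloor>y / real m\<rfloor>) = y * harm N - N / 2 - (\<Sum>m=1..N. saw (y / real m))"
    proof -
      have "(\<Sum>m=1..N. y / real m) = y * harm N"
        unfolding harm_def sum_distrib_left by (intro sum.cong refl) (simp add: divide_inverse)
      thus ?thesis unfolding fl sum_subtractf by simp
    qed
    hence D: "div_sum y = 2 * y * harm N - N - 2 * (\<Sum>m=1..N. saw (y / real m)) - (real N)\<^sup>2"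
      using div_sum_hyperbola[OF y] unfolding N_def by simp
    define e where "e = harm N - ln (s + p) + 1 / (2 * (s + p)) - euler_mascheroni"
    have e: "\<bar>e\<bar> \<le> 1 / (2 * real N * (s + p))"
    proof -
      obtain n where n: "N = Suc n" using N by (cases N) auto
      have sp: "real (n + 2) = s + p" using n by (simp add: p_def)
      have sp2: "real (2 * (n + 2)) = 2 * (s + p)" "real (2 * (n + 1)) = 2 * real N" using sp n by simp_all
      have "euler_mascheroni \<ge> harm N - ln (s + p) + 1 / (2 * (s + p))"
        using euler_mascheroni_lower[of n] unfolding sp sp2 n[symmetric] by simp
      moreover have "euler_mascheroni \<le> harm N - ln (s + p) + 1 / (2 * real N)"
        using euler_mascheroni_upper[of n] unfolding sp sp2 n[symmetric] by simp
      moreover have "1 / (2 * real N) - 1 / (2 * (s + p)) = 1 / (2 * real N * (s + p))"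
        using N p by (simp add: field_simps p_def)
      ultimately show ?thesis unfolding e_def by (simp add: abs_le_iff)
    qed
    have ye: "\<bar>2 * y * e\<bar> \<le> 2"
    proof -
      have "2 * y * \<bar>e\<bar> \<le> 2 * y * (1 / (2 * real N * (s + p)))" using e y by (intro mult_left_mono) auto
      also have "\<dots> = (s / N) * (s / (s + p))" using s N p by (simp add: power2_eq_square)
      also have "\<dots> \<le> 2 * 1" using s N p by (intro mult_mono) (auto simp: field_simps)
      finally show ?thesis using y by (simp add: abs_mult)
    qed
    define l where "l = ln (1 + p / s) - p / s"
    have yl: "\<bar>2 * y * l\<bar> \<le> 2"
    proof -
      have "\<bar>l\<bar> \<le> (p / s)\<^sup>2" unfolding l_def using p s by (intro ln_add_one_bounds) auto
      hence "2 * y * \<bar>l\<bar> \<le> 2 * y * (p / s)\<^sup>2" using y by (intro mult_left_mono) auto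
      also have "\<dots> = 2 * p\<^sup>2" using s by (simp add: power_divide)
      also have "\<dots> \<le> 2" using p by (simp add: power_le_one)
      finally show ?thesis using y by (simp add: abs_mult)
    qed
    have lnsp: "ln (s + p) = ln y / 2 + p / s + l"
    proof -
      have "s + p = s * (1 + p / s)" using s by (simp add: field_simps)
      moreover have "1 + p / s > 0" using s p by (simp add: add_pos_nonneg)
      ultimately have "ln (s + p) = ln s + ln (1 + p / s)" using s by (simp add: ln_mult)
      moreover have "ln y = 2 * ln s" using s by (simp add: ln_realpow)
      ultimately show ?thesis by (simp add: l_def)
    qed
    define r where "r = y / (s + p) - s + p"
    have r: "\<bar>r\<bar> \<le> 1"
    proof -
      have "r = p * (p / (s + p))" using s p by (simp add: r_def field_simps power2_eq_square)
      moreover have "p * (p / (s + p)) \<le> 1 * 1" using s p by (intro mult_mono) auto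
      moreover have "p * (p / (s + p)) \<ge> 0" using s p by simp
      ultimately show ?thesis by linarith
    qed
    have "2 * y * harm N = y * ln y + 2 * s * p + 2 * y * l - (s - p + r) + 2 * y * euler_mascheroni + 2 * y * e"
    proof -
      have "harm N = ln y / 2 + p / s + l - 1 / (2 * (s + p)) + euler_mascheroni + e"
        unfolding e_def lnsp by simp
      moreover have "2 * y * (a / 2 + b + l - 1 / (2 * d) + g + e) = y * a + 2 * (y * b) + 2 * y * l - y / d + 2 * y * g + 2 * y * e"
        for a b d g :: real by (simp add: algebra_simps)
      ultimately have "2 * y * harm N = y * ln y + 2 * (y * (p / s)) + 2 * y * l - y / (s + p) + 2 * y * euler_mascheroni + 2 * y * e"
        by (simp only:)
      moreover have "y * (p / s) = s * p" using s by (simp add: power2_eq_square)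
      ultimately show ?thesis by (simp add: r_def)
    qed
    moreover have "real N = s + p - 1" by (simp add: p_def)
    hence "real N + (real N)\<^sup>2 = y + 2 * s * p + p\<^sup>2 - s - p"
      unfolding s(2) by (simp only: power2_eq_square) (simp add: algebra_simps)
    ultimately have "div_sum y - y * (ln y + 2 * euler_mascheroni - 1) =
      2 * y * l + 2 * y * e - r + 2 * p - p\<^sup>2 - 2 * (\<Sum>m=1..N. saw (y / real m))"
      unfolding D by (simp add: algebra_simps)
    moreover have "\<bar>\<Sum>m=1..N. saw (y / real m)\<bar> \<le> C * y powr (19/40)" using C(2)[OF y] by (simp add: N_def)
    moreover have "0 \<le> p\<^sup>2" "p\<^sup>2 \<le> 1" using p by (auto simp: power_le_one)
    ultimately have "\<bar>div_sum y - y * (ln y + 2 * euler_mascheroni - 1)\<bar> \<le> 20 + 2 * (C * y powr (19/40))"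
      using ye yl r p by linarith
    also have "\<dots> \<le> 20 * y powr (19/40) + 2 * (C * y powr (19/40))"
      using y by (intro add_mono) (auto simp: ge_one_powr_ge_zero)
    finally show ?thesis by (simp add: algebra_simps)
  qed
  thus ?thesis using C by (intro exI[of _ "2 * C + 20"]) auto
qed


section \<open>The error term\<close>

text \<open>Associativity of Dirichlet convolution: 1 convolved with \<open>mu\<close> is the unit,
  so only \<open>a = g\<close> survives after the order of summation is changed.\<close>

lemma mu_conv_divisor_sum:
  assumes "g > 0"
  shows "(\<Sum>d | d dvd g. mu_conv d) = of_int (moebius_mu g)"
proof -
  let ?F = "\<lambda>a b. of_int (moebius_mu a * moebius_mu b) :: real"
  have "(\<Sum>d | d dvd g. mu_conv d) = (\<Sum>(d, a)\<in>Sigma {d. d dvd g} (\<lambda>d. {a. a dvd d}). ?F a (d div a))"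
    unfolding mu_conv_def using assms by (intro sum.Sigma) (auto dest: dvd_pos_nat)
  also have "\<dots> = (\<Sum>(a, b)\<in>Sigma {a. a dvd g} (\<lambda>a. {b. b dvd g div a}). ?F a b)"
    by (rule sum.reindex_bij_witness[of _ "\<lambda>(a, b). (a * b, a)" "\<lambda>(d, a). (a, d div a)"])
       (use assms in \<open>auto elim!: dvdE\<close>)
  also have "\<dots> = (\<Sum>a | a dvd g. \<Sum>b | b dvd g div a. ?F a b)"
    using assms by (intro sum.Sigma[symmetric]) (auto elim!: dvdE)
  also have "\<dots> = (\<Sum>a | a dvd g. if a = g then of_int (moebius_mu g) else 0)"
  proof (rule sum.cong[OF refl])
    fix a assume a: "a \<in> {a. a dvd g}"
    then obtain c where c: "g = a * c" by auto
    have "(\<Sum>b | b dvd g div a. ?F a b) = of_int (moebius_mu a * (\<Sum>b | b dvd g div a. moebius_mu b))"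
      by (simp add: sum_distrib_left)
    also have "\<dots> = (if a = g then of_int (moebius_mu g) else 0)"
      using assms c by (subst moebius_mu_divisor_sum) auto
    finally show "(\<Sum>b | b dvd g div a. ?F a b) = (if a = g then of_int (moebius_mu g) else 0)" .
  qed
  also have "\<dots> = of_int (moebius_mu g)" using assms by simp
  finally show ?thesis .
qed

text \<open>A pair with a common divisor \<open>d\<close> is the same as \<open>d\<close> together
  with the pair divided by \<open>d\<close>, whose product is at most
  \<open>x / d\<^sup>2\<close>.\<close>

lemma S_mu_eq_sum_div_sum:
  assumes x: "x \<ge> 1"
  defines "X \<equiv> nat \<lfloor>sqrt x\<rfloor>"
  shows "S_mu x = (\<Sum>d=1..X. mu_conv d * div_sum (x / (real d)\<^sup>2))"
proof -
  let ?P = "\<lambda>v. {(m :: nat, n :: nat). m > 0 \<and> n > 0 \<and> real (m * n) \<le> v}"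
  have fin: "finite (?P v)" for v by (rule finite_S_mu_range)
  have X_iff: "d \<le> X \<longleftrightarrow> (real d)\<^sup>2 \<le> x" for d
  proof -
    have "d \<le> X \<longleftrightarrow> real d \<le> sqrt x" unfolding X_def using x by (simp add: le_nat_iff le_floor_iff)
    also have "\<dots> \<longleftrightarrow> (real d)\<^sup>2 \<le> x" using x real_le_rsqrt real_sqrt_le_iff[of "(real d)\<^sup>2" x] by simp
    finally show ?thesis .
  qed
  have "S_mu x = (\<Sum>p\<in>?P x. \<Sum>d | d dvd gcd (fst p) (snd p). mu_conv d)"
    unfolding S_mu_def
  proof (rule sum.cong[OF refl])
    fix p assume "p \<in> ?P x"
    thus "(case p of (m, n) \<Rightarrow> of_int (moebius_mu (gcd m n))) = (\<Sum>d | d dvd gcd (fst p) (snd p). mu_conv d)"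
      by (subst mu_conv_divisor_sum) auto
  qed
  also have "\<dots> = (\<Sum>(p, d)\<in>Sigma (?P x) (\<lambda>p. {d. d dvd gcd (fst p) (snd p)}). mu_conv d)"
    using fin by (intro sum.Sigma) auto
  also have "\<dots> = (\<Sum>(d, p)\<in>Sigma {1..X} (\<lambda>d. ?P (x / (real d)\<^sup>2)). mu_conv d)"
  proof (rule sum.reindex_bij_witness[of _ "\<lambda>(d, p). ((d * fst p, d * snd p), d)" "\<lambda>(p, d). (d, (fst p div d, snd p div d))"])
    fix q assume "q \<in> Sigma (?P x) (\<lambda>p. {d. d dvd gcd (fst p) (snd p)})"
    then obtain m n d where q: "q = ((m, n), d)" "m > 0" "n > 0" "real (m * n) \<le> x" "d dvd m" "d dvd n"
      by auto
    obtain m' n' where mn: "m = d * m'" "n = d * n'" using q by (auto elim!: dvdE)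
    have pos: "d > 0" "m' > 0" "n' > 0" using q mn by auto
    have le: "(real d)\<^sup>2 * (real m' * real n') \<le> x" using q(4) by (simp add: mn power2_eq_square mult_ac)
    have "1 \<le> real m' * real n'" using pos by (simp flip: of_nat_mult)
    hence "(real d)\<^sup>2 * 1 \<le> (real d)\<^sup>2 * (real m' * real n')" by (intro mult_left_mono) auto
    hence "d \<le> X" using le by (simp add: X_iff)
    thus "(case q of (p, d) \<Rightarrow> (d, fst p div d, snd p div d)) \<in> Sigma {1..X} (\<lambda>d. ?P (x / (real d)\<^sup>2))"
      using pos le by (simp add: q(1) mn field_simps)
    show "(case case q of (p, d) \<Rightarrow> (d, fst p div d, snd p div d) of (d, p) \<Rightarrow> ((d * fst p, d * snd p), d)) = q"
      using q by simp
    show "(case case q of (p, d) \<Rightarrow> (d, fst p div d, snd p div d) of (d, p) \<Rightarrow> mu_conv d) = (case q of (p, d) \<Rightarrow> mu_conv d)"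
      by (simp add: q(1))
  next
    fix q assume "q \<in> Sigma {1..X} (\<lambda>d. ?P (x / (real d)\<^sup>2))"
    then obtain d m n where q: "q = (d, (m, n))" "d > 0" "m > 0" "n > 0" "real (m * n) \<le> x / (real d)\<^sup>2"
      by auto
    show "(case case q of (d, p) \<Rightarrow> ((d * fst p, d * snd p), d) of (p, d) \<Rightarrow> (d, fst p div d, snd p div d)) = q"
      using q by simp
    have "real (d * m * (d * n)) \<le> x" using q(2,5) by (simp add: field_simps power2_eq_square)
    thus "(case q of (d, p) \<Rightarrow> ((d * fst p, d * snd p), d)) \<in> Sigma (?P x) (\<lambda>p. {d. d dvd gcd (fst p) (snd p)})"
      using q by simp
  qed
  also have "\<dots> = (\<Sum>d=1..X. \<Sum>p\<in>?P (x / (real d)\<^sup>2). mu_conv d)"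
    using fin by (intro sum.Sigma[symmetric]) auto
  also have "\<dots> = (\<Sum>d=1..X. mu_conv d * div_sum (x / (real d)\<^sup>2))"
    by (simp add: div_sum_def mult.commute)
  finally show ?thesis .
qed

text \<open>Crude but sufficient: for the large divisors \<open>v = x / Y\<^sup>2\<close> is only
  \<open>exp (O((ln x) powr (35/100)))\<close>, so squaring it is affordable.\<close>

lemma card_pairs_le_square:
  assumes "v \<ge> 0"
  shows "real (card {(m :: nat, n :: nat). m > 0 \<and> n > 0 \<and> real (m * n) \<le> v}) \<le> v\<^sup>2"
proof -
  let ?N = "nat \<lfloor>v\<rfloor>"
  have "{(m :: nat, n :: nat). m > 0 \<and> n > 0 \<and> real (m * n) \<le> v} \<subseteq> {1..?N} \<times> {1..?N}"
  proof
    fix p assume "p \<in> {(m :: nat, n :: nat). m > 0 \<and> n > 0 \<and> real (m * n) \<le> v}"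
    then obtain m n where p: "p = (m, n)" "m > 0" "n > 0" "real (m * n) \<le> v" by auto
    have "m * n \<le> ?N" using p(4) assms by (simp add: le_nat_iff le_floor_iff)
    moreover have "m \<le> m * n" "n \<le> m * n" using p by auto
    ultimately have "m \<le> ?N" "n \<le> ?N" by linarith+
    thus "p \<in> {1..?N} \<times> {1..?N}" using p by simp
  qed
  from card_mono[OF _ this] have "card {(m :: nat, n :: nat). m > 0 \<and> n > 0 \<and> real (m * n) \<le> v} \<le> ?N * ?N"
    by (simp add: card_cartesian_product)
  hence "real (card {(m :: nat, n :: nat). m > 0 \<and> n > 0 \<and> real (m * n) \<le> v}) \<le> real (?N * ?N)"
    by (simp only: of_nat_le_iff)
  also have "\<dots> = real ?N * real ?N" by (rule of_nat_mult)
  also have "\<dots> \<le> v * v"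
    by (rule mult_mono[OF of_nat_floor[OF assms] of_nat_floor[OF assms] assms of_nat_0_le_iff])
  finally show ?thesis by (simp add: power2_eq_square)
qed

lemma mu_conv_sum_diff:
  assumes "Y \<le> Z"
  shows "(\<Sum>d\<in>{Y<..Z}. mu_conv d) = mu_conv_sum Z - mu_conv_sum Y"
proof -
  have "{1..Z} = {1..Y} \<union> {Y<..Z}" using assms by auto
  hence "mu_conv_sum Z = mu_conv_sum Y + (\<Sum>d\<in>{Y<..Z}. mu_conv d)"
    unfolding mu_conv_sum_def by (simp only:) (rule sum.union_disjoint, auto)
  thus ?thesis by simp
qed

text \<open>With the sum over \<open>d\<close> inside, every lattice point with product at most
  \<open>x / Y\<^sup>2\<close> carries a difference of two values of \<open>mu_conv_sum\<close> at
  arguments between \<open>Y\<close> and \<open>sqrt x\<close>, or nothing. This gives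
  \<open>2 * \<kappa> * sqrt x\<close> per point.\<close>

lemma large_divisors_bound:
  assumes x: "x \<ge> 1" and Y: "Y \<ge> 1" and \<kappa>: "\<kappa> \<ge> 0" and b: "\<And>N. N \<ge> Y \<Longrightarrow> \<bar>mu_conv_sum N\<bar> \<le> \<kappa> * real N"
  defines "X \<equiv> nat \<lfloor>sqrt x\<rfloor>"
  shows "\<bar>\<Sum>d\<in>{Y<..X}. mu_conv d * div_sum (x / (real d)\<^sup>2)\<bar> \<le> 2 * \<kappa> * sqrt x * (x / (real Y)\<^sup>2)\<^sup>2"
proof -
  let ?P = "\<lambda>v. {(m :: nat, n :: nat). m > 0 \<and> n > 0 \<and> real (m * n) \<le> v}"
  define D where "D p = nat \<lfloor>sqrt (x / real (fst p * snd p))\<rfloor>" for p :: "nat \<times> nat"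
  have fin: "finite (?P v)" for v by (rule finite_S_mu_range)
  have D_iff: "d \<le> D (m, n) \<longleftrightarrow> real (m * n) \<le> x / (real d)\<^sup>2" if "m > 0" "n > 0" "d > 0" for d m n
  proof -
    have mn: "real (m * n) > 0" using that by simp
    have "d \<le> D (m, n) \<longleftrightarrow> real d \<le> sqrt (x / real (m * n))"
      unfolding D_def using x by (simp add: le_nat_iff le_floor_iff)
    also have "\<dots> \<longleftrightarrow> (real d)\<^sup>2 \<le> x / real (m * n)"
      using real_sqrt_le_iff[of "(real d)\<^sup>2" "x / real (m * n)"] by simp
    also have "\<dots> \<longleftrightarrow> real (m * n) \<le> x / (real d)\<^sup>2"
      using mn that(3) by (simp add: pos_le_divide_eq mult.commute del: of_nat_mult)
    finally show ?thesis .
  qed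
  have D_le: "real (D p) \<le> sqrt x" if "p \<in> ?P v" for p v
  proof -
    have "real (fst p * snd p) \<ge> 1" using that by (auto simp flip: of_nat_mult simp: Suc_le_eq)
    hence "x / real (fst p * snd p) \<le> x / 1" using x by (intro divide_left_mono) auto
    moreover have "real (D p) \<le> sqrt (x / real (fst p * snd p))" unfolding D_def using x by (intro of_nat_floor) auto
    moreover from calculation(1) have "sqrt (x / real (fst p * snd p)) \<le> sqrt x"
      by (intro real_sqrt_le_mono) (simp only: div_by_1)
    ultimately show ?thesis by linarith
  qed
  have "(\<Sum>d\<in>{Y<..X}. mu_conv d * div_sum (x / (real d)\<^sup>2)) = (\<Sum>d\<in>{Y<..X}. \<Sum>p\<in>?P (x / (real d)\<^sup>2). mu_conv d)"
    by (simp add: div_sum_def mult.commute)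
  also have "\<dots> = (\<Sum>(d, p)\<in>Sigma {Y<..X} (\<lambda>d. ?P (x / (real d)\<^sup>2)). mu_conv d)"
    using fin by (intro sum.Sigma) auto
  also have "\<dots> = (\<Sum>(p, d)\<in>Sigma (?P (x / (real Y)\<^sup>2)) (\<lambda>p. {Y<..D p}). mu_conv d)"
  proof (rule sum.reindex_bij_witness[of _ "\<lambda>(p, d). (d, p)" "\<lambda>(d, p). (p, d)"])
    fix q assume "q \<in> Sigma {Y<..X} (\<lambda>d. ?P (x / (real d)\<^sup>2))"
    then obtain d m n where q: "q = (d, (m, n))" "d > Y" "m > 0" "n > 0" "real (m * n) \<le> x / (real d)\<^sup>2" by auto
    have "x / (real d)\<^sup>2 \<le> x / (real Y)\<^sup>2" using q(2) Y x by (intro divide_left_mono power_mono) auto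
    hence "real (m * n) \<le> x / (real Y)\<^sup>2" using q(5) by linarith
    moreover have "d \<le> D (m, n)" using q Y by (subst D_iff) auto
    ultimately show "(case q of (d, p) \<Rightarrow> (p, d)) \<in> Sigma (?P (x / (real Y)\<^sup>2)) (\<lambda>p. {Y<..D p})"
      using q by simp
  next
    fix q assume "q \<in> Sigma (?P (x / (real Y)\<^sup>2)) (\<lambda>p. {Y<..D p})"
    then obtain d m n where q: "q = ((m, n), d)" "d > Y" "m > 0" "n > 0" "(m, n) \<in> ?P (x / (real Y)\<^sup>2)" "d \<le> D (m, n)" by auto
    have "real d \<le> sqrt x" using D_le[OF q(5)] q(6) by linarith
    hence "d \<le> X" unfolding X_def using x by (simp add: le_nat_iff le_floor_iff)
    moreover have "real (m * n) \<le> x / (real d)\<^sup>2" using q Y D_iff[of m n d] by auto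
    ultimately show "(case q of (p, d) \<Rightarrow> (d, p)) \<in> Sigma {Y<..X} (\<lambda>d. ?P (x / (real d)\<^sup>2))"
      using q by simp
  qed auto
  also have "\<dots> = (\<Sum>p\<in>?P (x / (real Y)\<^sup>2). \<Sum>d\<in>{Y<..D p}. mu_conv d)"
    using fin by (intro sum.Sigma[symmetric]) auto
  also have "\<bar>\<dots>\<bar> \<le> (\<Sum>p\<in>?P (x / (real Y)\<^sup>2). 2 * \<kappa> * sqrt x)"
  proof (rule order_trans[OF sum_abs sum_mono])
    fix p assume p: "p \<in> ?P (x / (real Y)\<^sup>2)"
    show "\<bar>\<Sum>d\<in>{Y<..D p}. mu_conv d\<bar> \<le> 2 * \<kappa> * sqrt x"
    proof (cases "Y \<le> D p")
      case True
      have "\<bar>\<Sum>d\<in>{Y<..D p}. mu_conv d\<bar> \<le> \<bar>mu_conv_sum (D p)\<bar> + \<bar>mu_conv_sum Y\<bar>"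
        unfolding mu_conv_sum_diff[OF True] by (rule abs_triangle_ineq4)
      also have "\<dots> \<le> \<kappa> * real (D p) + \<kappa> * real Y" by (intro add_mono b True order_refl)
      also have "\<dots> \<le> \<kappa> * sqrt x + \<kappa> * sqrt x"
        using True D_le[OF p] \<kappa> by (intro add_mono mult_left_mono) auto
      finally show ?thesis by simp
    qed (use \<kappa> x in auto)
  qed
  also have "\<dots> = real (card (?P (x / (real Y)\<^sup>2))) * (2 * \<kappa> * sqrt x)" by simp
  also have "\<dots> \<le> (x / (real Y)\<^sup>2)\<^sup>2 * (2 * \<kappa> * sqrt x)"
    using x \<kappa> by (intro mult_right_mono card_pairs_le_square) auto
  finally show ?thesis by (simp add: mult_ac)
qed

text \<open>The exponent is twice 19/40, from \<open>(x / d\<^sup>2) powr (19/40)\<close>. After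
  \<open>\<bar>mu_conv d\<bar>\<close> is bounded by the number of divisors of \<open>d\<close>, the
  weight splits as \<open>(a * b) powr (1/20)\<close> times \<open>1 / (a * b)\<close>, and the
  latter sums to a square of a harmonic number.\<close>

lemma abs_mu_conv_weighted_sum:
  "(\<Sum>d=1..Y. \<bar>mu_conv d\<bar> * real d powr (-19/20)) \<le> real Y powr (1/20) * (harm Y)\<^sup>2"
proof -
  have le: "\<bar>mu_conv d\<bar> * real d powr (-19/20) \<le> (\<Sum>a | a dvd d. real (a * (d div a)) powr (-19/20))" if "d \<ge> 1" for d
  proof -
    have "\<bar>mu_conv d\<bar> \<le> (\<Sum>a | a dvd d. 1)"
      unfolding mu_conv_def
    proof (rule order_trans[OF sum_abs sum_mono])
      fix a
      have "\<bar>moebius_mu a * moebius_mu (d div a)\<bar> \<le> 1 * 1"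
        unfolding abs_mult by (intro mult_mono abs_moebius_mu_le) auto
      thus "\<bar>real_of_int (moebius_mu a * moebius_mu (d div a))\<bar> \<le> 1" by linarith
    qed
    hence "\<bar>mu_conv d\<bar> * real d powr (-19/20) \<le> (\<Sum>a | a dvd d. 1) * real d powr (-19/20)"
      by (intro mult_right_mono) auto
    also have "\<dots> = (\<Sum>a | a dvd d. real (a * (d div a)) powr (-19/20))"
      unfolding sum_distrib_right by (intro sum.cong refl) auto
    finally show ?thesis .
  qed
  have "(\<Sum>d=1..Y. \<bar>mu_conv d\<bar> * real d powr (-19/20)) \<le> (\<Sum>d=1..Y. \<Sum>a | a dvd d. real (a * (d div a)) powr (-19/20))"
    by (intro sum_mono le) auto
  also have "\<dots> = (\<Sum>(a, b)\<in>{(a, b). 0 < a \<and> 0 < b \<and> a * b \<le> Y}. real (a * b) powr (-19/20))"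
    by (rule sum_divisor_pairs)
  also have "\<dots> \<le> (\<Sum>(a, b)\<in>{(a, b). 0 < a \<and> 0 < b \<and> a * b \<le> Y}. real Y powr (1/20) * (inverse (real a) * inverse (real b)))"
  proof (rule sum_mono, clarify)
    fix a b :: nat assume ab: "0 < a" "0 < b" "a * b \<le> Y"
    have "real (a * b) powr (-19/20) = real (a * b) powr (1/20) * real (a * b) powr (-1)"
      using powr_add[of "real (a * b)" "1/20" "-1"] by simp
    also have "real (a * b) powr (-1) = inverse (real a) * inverse (real b)"
      using ab by (simp add: powr_minus)
    also have "real (a * b) powr (1/20) \<le> real Y powr (1/20)"
      using ab by (intro powr_mono2) (auto simp flip: of_nat_mult)
    finally show "real (a * b) powr (-19/20) \<le> real Y powr (1/20) * (inverse (real a) * inverse (real b))"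
      using ab by (simp add: mult_right_mono)
  qed
  also have "\<dots> \<le> (\<Sum>(a, b)\<in>{1..Y} \<times> {1..Y}. real Y powr (1/20) * (inverse (real a) * inverse (real b)))"
  proof (rule sum_mono2)
    show "{(a, b). 0 < a \<and> 0 < b \<and> a * b \<le> Y} \<subseteq> {1..Y} \<times> {1..Y}"
    proof
      fix p assume "p \<in> {(a, b). 0 < a \<and> 0 < b \<and> a * b \<le> Y}"
      then obtain a b where p: "p = (a, b)" "0 < a" "0 < b" "a * b \<le> Y" by auto
      moreover have "a \<le> a * b" "b \<le> a * b" using p by auto
      ultimately have "a \<le> Y" "b \<le> Y" by linarith+
      thus "p \<in> {1..Y} \<times> {1..Y}" using p by simp
    qed
  qed auto
  also have "\<dots> = real Y powr (1/20) * (harm Y)\<^sup>2"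
    unfolding harm_def power2_eq_square sum_product sum.cartesian_product[symmetric]
    by (simp only: sum_distrib_left)
  finally show ?thesis .
qed

section \<open>The series of the main term and their tails\<close>

lemma zeta_2_real:
  "zeta 2 = of_real (Re (zeta 2))" "deriv zeta 2 = of_real (Re (deriv zeta 2))" "Re (zeta 2) \<noteq> 0"
proof -
  have Im0: "Im (of_nat n powr (- 2)) = 0" if "n > 0" for n
  proof -
    have "(of_nat n :: complex) powr (- 2) = of_real (real n powr (- 2))"
      using powr_of_real[of "real n" "- 2"] by simp
    thus ?thesis by (simp only: Im_complex_of_real)
  qed
  have "((\<lambda>n. Im (of_nat n powr (- 2))) has_sum Im (zeta 2)) {0<..}"
    using has_sum_Im[OF zeta_has_sum[of 2]] by simp
  moreover have "((\<lambda>n. Im (of_nat n powr (- 2))) has_sum 0) {0<..}"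
    by (rule has_sum_0) (use Im0 in auto)
  ultimately have "Im (zeta 2) = 0" by (rule has_sum_unique)
  thus 1: "zeta 2 = of_real (Re (zeta 2))" by (simp add: complex_eq_iff)
  have "((\<lambda>n. Im (of_real (ln (real n)) * of_nat n powr (- 2))) has_sum Im (- deriv zeta 2)) {0<..}"
    using has_sum_Im[OF zeta_series_deriv(3)[of 2]] by simp
  moreover have "((\<lambda>n. Im (of_real (ln (real n)) * of_nat n powr (- 2))) has_sum 0) {0<..}"
    by (rule has_sum_0) (use Im0 in auto)
  ultimately have "Im (- deriv zeta 2) = 0" by (rule has_sum_unique)
  thus "deriv zeta 2 = of_real (Re (deriv zeta 2))" by (simp add: complex_eq_iff)
  show "Re (zeta 2) \<noteq> 0" using zeta_nonzero[of 2] 1 by fastforce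
qed

text \<open>The values at 2 of \<open>1 / zeta\<^sup>2\<close> and of minus its derivative. No
  series of \<open>mu\<close> is differentiated: since \<open>ln\<close> of a product is a sum,
  multiplication by \<open>ln\<close> is a derivation for Dirichlet convolution. Applied to the
  convolution of \<open>mu\<close> with 1, which lives on \<open>n = 1\<close> where
  \<open>ln\<close> vanishes, it yields \<open>L * zeta 2 - M * deriv zeta 2 = 0\<close> and so
  determines \<open>L\<close>; applied to \<open>mu_conv\<close> it gives
  \<open>2 * L * M\<close>.\<close>

lemma mu_conv_series:
  defines "z \<equiv> Re (zeta 2)" and "z' \<equiv> Re (deriv zeta 2)"
  shows "((\<lambda>n. mu_conv n * (1 / (real n)\<^sup>2)) has_sum (1 / z\<^sup>2)) {0<..}"
    and "((\<lambda>n. mu_conv n * (ln (real n) / (real n)\<^sup>2)) has_sum (2 * z' / z ^ 3)) {0<..}"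
proof -
  define p where "p n = (of_nat n powr (- 2) :: complex)" for n :: nat
  define f l v where "f n = of_int (moebius_mu n) * p n" and "l n = of_real (ln (real n)) * f n"
    and "v n = of_real (ln (real n)) * p n" for n
  have p_real: "p n = of_real (1 / (real n)\<^sup>2)" if "n > 0" for n
  proof -
    have "p n = of_real (real n powr (- 2))"
      using powr_of_real[of "real n" "- 2"] by (simp add: p_def)
    also have "real n powr (- 2) = 1 / (real n)\<^sup>2" using that by (simp add: powr_minus_divide)
    finally show ?thesis .
  qed
  have p_mult: "p a * p (n div a) = p n" if "a dvd n" "n > 0" for a n
    unfolding p_def using that by (rule of_nat_div_powr)
  have ln_mult': "ln (real n) = ln (real a) + ln (real (n div a))" if "a dvd n" "n > 0" for a n
  proof -
    obtain b where "n = a * b" using \<open>a dvd n\<close> by auto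
    thus ?thesis using \<open>n > 0\<close> by (auto simp: ln_mult)
  qed
  have sp: "(\<lambda>n. norm (p n)) summable_on {0<..}"
    using abs_summable_dirichlet[of "\<lambda>_. 1" 2] by (simp add: p_def)
  have sf: "(\<lambda>n. norm (f n)) summable_on {0<..}"
    using abs_summable_mu[of 2] by (simp add: f_def p_def)
  have sv: "(\<lambda>n. norm (v n)) summable_on {0<..}"
  proof -
    have "(\<lambda>n. norm (v n)) summable_on {0<..} \<longleftrightarrow> (\<lambda>n. ln (real n) * real n powr - Re 2) summable_on {0<..}"
      by (rule summable_on_cong) (auto simp: v_def p_def norm_mult norm_of_nat_powr)
    thus ?thesis using zeta_series_deriv(2)[of 2] by simp
  qed
  have sl: "(\<lambda>n. norm (l n)) summable_on {0<..}"
  proof (rule summable_on_comparison_test[OF sv])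
    fix n :: nat assume "n \<in> {0<..}"
    have "real_of_int \<bar>moebius_mu n\<bar> \<le> 1" using abs_moebius_mu_le[of n] by linarith
    thus "norm (l n) \<le> norm (v n)"
      by (auto simp: l_def f_def v_def norm_mult intro!: mult_left_mono mult_left_le_one_le)
  qed auto
  define M L where "M = infsum f {0<..}" and "L = infsum l {0<..}"
  have M: "M = 1 / zeta 2"
    using inverse_zeta[of 2] by (simp add: mu_series_def M_def f_def[abs_def] p_def)
  have P: "infsum p {0<..} = zeta 2" using zeta_infsum[of 2] by (simp add: p_def[abs_def])
  have V: "infsum v {0<..} = - deriv zeta 2"
    using infsumI[OF zeta_series_deriv(3)[of 2]] by (simp add: v_def[abs_def] p_def)
  have L: "L = deriv zeta 2 / (zeta 2)\<^sup>2"
  proof -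
    have "((\<lambda>n. (\<Sum>a | a dvd n. l a * p (n div a)) + (\<Sum>a | a dvd n. f a * v (n div a))) has_sum
        (L * zeta 2 + M * (- deriv zeta 2))) {0<..}"
      unfolding L_def M_def P[symmetric] V[symmetric]
      by (intro has_sum_add dirichlet_product_has_sum sl sp sf sv)
    also have "?this \<longleftrightarrow> ((\<lambda>_. 0) has_sum (L * zeta 2 + M * (- deriv zeta 2))) ({0<..} :: nat set)"
    proof (rule has_sum_cong)
      fix n :: nat assume n: "n \<in> {0<..}"
      have "(\<Sum>a | a dvd n. l a * p (n div a)) + (\<Sum>a | a dvd n. f a * v (n div a)) =
         (\<Sum>a | a dvd n. of_int (moebius_mu a) * (of_real (ln (real n)) * p n))"
        unfolding sum.distrib[symmetric]
      proof (rule sum.cong[OF refl])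
        fix a assume a: "a \<in> {a. a dvd n}"
        have "l a * p (n div a) + f a * v (n div a) =
          of_int (moebius_mu a) * (of_real (ln (real a) + ln (real (n div a))) * (p a * p (n div a)))"
          by (simp add: l_def f_def v_def algebra_simps)
        thus "l a * p (n div a) + f a * v (n div a) = of_int (moebius_mu a) * (of_real (ln (real n)) * p n)"
          using p_mult[of a n] ln_mult'[of a n] a n by simp
      qed
      also have "\<dots> = of_int (\<Sum>a | a dvd n. moebius_mu a) * (of_real (ln (real n)) * p n)"
        by (simp add: sum_distrib_right)
      also have "\<dots> = 0" using n by (subst moebius_mu_divisor_sum) auto
      finally show "(\<Sum>a | a dvd n. l a * p (n div a)) + (\<Sum>a | a dvd n. f a * v (n div a)) = 0" .
    qed
    finally have "L * zeta 2 + M * (- deriv zeta 2) = 0"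
      using has_sum_0_simp has_sum_unique by blast
    thus ?thesis using zeta_nonzero[of 2] by (simp add: M field_simps power2_eq_square)
  qed
  have "((\<lambda>n. \<Sum>a | a dvd n. f a * f (n div a)) has_sum (M * M)) {0<..}"
    unfolding M_def by (rule dirichlet_product_has_sum[OF sf sf])
  also have "?this \<longleftrightarrow> ((\<lambda>n. of_real (mu_conv n * (1 / (real n)\<^sup>2))) has_sum (M * M)) {0<..}"
  proof (rule has_sum_cong)
    fix n :: nat assume n: "n \<in> {0<..}"
    have "(\<Sum>a | a dvd n. f a * f (n div a)) = (\<Sum>a | a dvd n. of_int (moebius_mu a * moebius_mu (n div a)) * p n)"
    proof (rule sum.cong[OF refl])
      fix a assume "a \<in> {a. a dvd n}"
      hence "p n = p a * p (n div a)" using p_mult n by simp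
      thus "f a * f (n div a) = of_int (moebius_mu a * moebius_mu (n div a)) * p n"
        by (simp add: f_def)
    qed
    also have "\<dots> = of_real (mu_conv n) * p n" by (simp add: mu_conv_def sum_distrib_right)
    finally show "(\<Sum>a | a dvd n. f a * f (n div a)) = of_real (mu_conv n * (1 / (real n)\<^sup>2))"
      using p_real n by simp
  qed
  also have "M * M = of_real (1 / z\<^sup>2)"
    unfolding M z_def by (subst zeta_2_real(1), subst (2) zeta_2_real(1)) (simp add: power2_eq_square)
  finally show "((\<lambda>n. mu_conv n * (1 / (real n)\<^sup>2)) has_sum (1 / z\<^sup>2)) {0<..}"
    using has_sum_Re by fastforce
  have "((\<lambda>n. (\<Sum>a | a dvd n. l a * f (n div a)) + (\<Sum>a | a dvd n. f a * l (n div a))) has_sum (L * M + M * L)) {0<..}"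
    unfolding M_def L_def by (intro has_sum_add dirichlet_product_has_sum sf sl)
  also have "?this \<longleftrightarrow> ((\<lambda>n. of_real (mu_conv n * (ln (real n) / (real n)\<^sup>2))) has_sum (L * M + M * L)) {0<..}"
  proof (rule has_sum_cong)
    fix n :: nat assume n: "n \<in> {0<..}"
    have "(\<Sum>a | a dvd n. l a * f (n div a)) + (\<Sum>a | a dvd n. f a * l (n div a)) =
       (\<Sum>a | a dvd n. of_int (moebius_mu a * moebius_mu (n div a)) * (of_real (ln (real n)) * p n))"
      unfolding sum.distrib[symmetric]
    proof (rule sum.cong[OF refl])
      fix a assume a: "a \<in> {a. a dvd n}"
      have "l a * f (n div a) + f a * l (n div a) = of_int (moebius_mu a * moebius_mu (n div a)) *
          (of_real (ln (real a) + ln (real (n div a))) * (p a * p (n div a)))"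
        by (simp add: l_def f_def algebra_simps)
      thus "l a * f (n div a) + f a * l (n div a) = of_int (moebius_mu a * moebius_mu (n div a)) * (of_real (ln (real n)) * p n)"
        using p_mult[of a n] ln_mult'[of a n] a n by simp
    qed
    also have "\<dots> = of_real (mu_conv n) * (of_real (ln (real n)) * p n)" by (simp add: mu_conv_def sum_distrib_right)
    finally show "(\<Sum>a | a dvd n. l a * f (n div a)) + (\<Sum>a | a dvd n. f a * l (n div a)) = of_real (mu_conv n * (ln (real n) / (real n)\<^sup>2))"
      using p_real n by simp
  qed
  also have "L * M + M * L = of_real (2 * z' / z ^ 3)"
  proof -
    have "L * M + M * L = 2 * deriv zeta 2 / zeta 2 ^ 3"
      unfolding L M by (simp add: power2_eq_square power3_eq_cube)
    also have "\<dots> = 2 * of_real z' / of_real z ^ 3"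
      unfolding z_def z'_def using zeta_2_real(1,2) by simp
    finally show ?thesis by simp
  qed
  finally show "((\<lambda>n. mu_conv n * (ln (real n) / (real n)\<^sup>2)) has_sum (2 * z' / z ^ 3)) {0<..}"
    using has_sum_Re by fastforce
qed

text \<open>Partial summation against a decreasing weight. Once \<open>mu_conv_sum n\<close> is
  replaced by \<open>\<kappa> * n\<close>, the sum of \<open>n * (g n - g (n + 1))\<close> can be
  summed by parts back into the sum of \<open>g\<close>, bounded by \<open>G\<close>.\<close>

lemma mu_conv_tail_abel:
  fixes g :: "nat \<Rightarrow> real"
  assumes \<kappa>: "\<kappa> \<ge> 0" and b: "\<And>N. N \<ge> Y \<Longrightarrow> \<bar>mu_conv_sum N\<bar> \<le> \<kappa> * real N"
    and g: "\<And>n. n > Y \<Longrightarrow> 0 \<le> g n" "\<And>n. n > Y \<Longrightarrow> g (Suc n) \<le> g n"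
    and G: "\<And>Z. (\<Sum>n\<in>{Y<..Z}. g n) \<le> G"
    and S: "((\<lambda>n. mu_conv n * g n) has_sum S) {0<..}"
  shows "\<bar>S - (\<Sum>n=1..Y. mu_conv n * g n)\<bar> \<le> \<kappa> * (2 * (Suc Y * g (Suc Y)) + G)"
proof -
  \<comment> \<open>The boundary term stands on the left and its majorant is subtracted on the
    right; in this form the right sides for \<open>Z\<close> and \<open>Suc Z\<close> differ by
    exactly the bound for the new term.\<close>
  have abel: "\<bar>(\<Sum>n\<in>{Y<..Z}. mu_conv n * g n) - mu_conv_sum Z * g Z\<bar> \<le>
      \<kappa> * (2 * (Suc Y * g (Suc Y)) + (\<Sum>n\<in>{Y<..Z}. g n) - Z * g Z)" if "Suc Y \<le> Z" for Z
    using that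
  proof (induction Z rule: dec_induct)
    case base
    have "{Y<..Suc Y} = {Suc Y}" by auto
    moreover have "mu_conv_sum (Suc Y) = mu_conv_sum Y + mu_conv (Suc Y)" by (simp add: mu_conv_sum_def)
    ultimately have "\<bar>(\<Sum>n\<in>{Y<..Suc Y}. mu_conv n * g n) - mu_conv_sum (Suc Y) * g (Suc Y)\<bar> = \<bar>mu_conv_sum Y\<bar> * g (Suc Y)"
      using g(1)[of "Suc Y"] by (simp add: algebra_simps abs_mult)
    also have "\<dots> \<le> \<kappa> * real Y * g (Suc Y)" using b[of Y] g(1)[of "Suc Y"] by (intro mult_right_mono) auto
    also have "\<dots> \<le> \<kappa> * ((real Y + 2) * g (Suc Y))"
      using \<kappa> g(1)[of "Suc Y"] unfolding mult.assoc by (intro mult_left_mono mult_right_mono) auto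
    also have "(real Y + 2) * g (Suc Y) = 2 * (Suc Y * g (Suc Y)) + (\<Sum>n\<in>{Y<..Suc Y}. g n) - Suc Y * g (Suc Y)"
      using \<open>{Y<..Suc Y} = {Suc Y}\<close> by (simp add: algebra_simps)
    finally show ?case .
  next
    case (step Z)
    have ins: "{Y<..Suc Z} = insert (Suc Z) {Y<..Z}" using step.hyps by auto
    have "mu_conv_sum (Suc Z) = mu_conv_sum Z + mu_conv (Suc Z)" by (simp add: mu_conv_sum_def)
    hence "(\<Sum>n\<in>{Y<..Suc Z}. mu_conv n * g n) - mu_conv_sum (Suc Z) * g (Suc Z) =
      ((\<Sum>n\<in>{Y<..Z}. mu_conv n * g n) - mu_conv_sum Z * g Z) + mu_conv_sum Z * (g Z - g (Suc Z))"
      unfolding ins by (simp add: algebra_simps)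
    also have "\<bar>\<dots>\<bar> \<le> \<kappa> * (2 * (Suc Y * g (Suc Y)) + (\<Sum>n\<in>{Y<..Z}. g n) - Z * g Z) + \<kappa> * real Z * (g Z - g (Suc Z))"
    proof (rule order_trans[OF abs_triangle_ineq add_mono[OF step.IH]])
      have "\<bar>mu_conv_sum Z * (g Z - g (Suc Z))\<bar> = \<bar>mu_conv_sum Z\<bar> * (g Z - g (Suc Z))"
        using g(2)[of Z] step.hyps by (simp add: abs_mult)
      also have "\<dots> \<le> \<kappa> * real Z * (g Z - g (Suc Z))"
        using g(2)[of Z] step.hyps b[of Z] by (intro mult_right_mono) auto
      finally show "\<bar>mu_conv_sum Z * (g Z - g (Suc Z))\<bar> \<le> \<kappa> * real Z * (g Z - g (Suc Z))" .
    qed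
    also have "\<dots> = \<kappa> * (2 * (Suc Y * g (Suc Y)) + (\<Sum>n\<in>{Y<..Suc Z}. g n) - Suc Z * g (Suc Z))"
      unfolding ins by (simp add: algebra_simps)
    finally show ?case .
  qed
  have fin: "\<bar>\<Sum>n\<in>{Y<..Z}. mu_conv n * g n\<bar> \<le> \<kappa> * (2 * (Suc Y * g (Suc Y)) + G)" if Z: "Suc Y \<le> Z" for Z
  proof -
    have "\<bar>mu_conv_sum Z * g Z\<bar> \<le> \<kappa> * real Z * g Z"
      using b[of Z] g(1)[of Z] Z by (simp add: abs_mult mult_right_mono)
    hence "\<bar>\<Sum>n\<in>{Y<..Z}. mu_conv n * g n\<bar> \<le> \<kappa> * (2 * (Suc Y * g (Suc Y)) + (\<Sum>n\<in>{Y<..Z}. g n) - Z * g Z) + \<kappa> * real Z * g Z"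
      using abel[OF Z] by linarith
    also have "\<dots> = \<kappa> * (2 * (Suc Y * g (Suc Y)) + (\<Sum>n\<in>{Y<..Z}. g n))" by (simp add: algebra_simps)
    also have "\<dots> \<le> \<kappa> * (2 * (Suc Y * g (Suc Y)) + G)" using \<kappa> G[of Z] by (intro mult_left_mono) auto
    finally show ?thesis .
  qed
  have "((\<lambda>n. mu_conv (Suc n) * g (Suc n)) has_sum S) UNIV \<longleftrightarrow> ((\<lambda>n. mu_conv n * g n) has_sum S) {0<..}"
    by (rule has_sum_reindex_bij_witness[of _ "\<lambda>n. n - 1" Suc]) auto
  hence "(\<lambda>n. mu_conv (Suc n) * g (Suc n)) sums S" using S has_sum_imp_sums by blast
  hence "(\<lambda>Z. \<Sum>n<Z. mu_conv (Suc n) * g (Suc n)) \<longlonglongrightarrow> S" by (simp add: sums_def)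
  moreover have "(\<Sum>n<Z. mu_conv (Suc n) * g (Suc n)) = (\<Sum>n=1..Z. mu_conv n * g n)" for Z
    by (rule sum.reindex_bij_witness[of _ "\<lambda>n. n - 1" Suc]) auto
  ultimately have "(\<lambda>Z. \<Sum>n=1..Z. mu_conv n * g n) \<longlonglongrightarrow> S" by simp
  hence "(\<lambda>Z. \<bar>(\<Sum>n=1..Z. mu_conv n * g n) - (\<Sum>n=1..Y. mu_conv n * g n)\<bar>) \<longlonglongrightarrow> \<bar>S - (\<Sum>n=1..Y. mu_conv n * g n)\<bar>"
    by (intro tendsto_rabs tendsto_diff tendsto_const)
  note lim = this
  show ?thesis
  proof (rule LIMSEQ_le_const2[OF lim], intro exI[of _ "Suc Y"] allI impI)
    fix Z assume Z: "Suc Y \<le> Z"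
    hence "{1..Z} = {1..Y} \<union> {Y<..Z}" by auto
    hence "(\<Sum>n=1..Z. mu_conv n * g n) = (\<Sum>n=1..Y. mu_conv n * g n) + (\<Sum>n\<in>{Y<..Z}. mu_conv n * g n)"
      by (simp only:) (rule sum.union_disjoint, auto)
    thus "\<bar>(\<Sum>n=1..Z. mu_conv n * g n) - (\<Sum>n=1..Y. mu_conv n * g n)\<bar> \<le> \<kappa> * (2 * (Suc Y * g (Suc Y)) + G)"
      using fin[OF Z] by (simp only: add_diff_cancel_left')
  qed
qed


text \<open>With \<open>v = r * u\<close> the claim becomes
  \<open>ln r \<le> (r\<^sup>2 - 1) * ln u\<close>, and \<open>ln r \<le> r - 1\<close> suffices as
  soon as \<open>(r + 1) * ln u \<ge> 1\<close>. For \<open>u \<ge> 2\<close> this follows from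
  \<open>ln 2 \<ge> 2/3\<close>.\<close>

lemma ln_over_square_antimono:
  fixes u v :: real
  assumes "2 \<le> u" "u \<le> v"
  shows "ln v / v\<^sup>2 \<le> ln u / u\<^sup>2"
proof -
  define r where "r = v / u"
  have u: "u > 0" and r: "r \<ge> 1" "v = r * u" using assms by (auto simp: r_def)
  have "2 / 3 \<le> ln u" using ln2_ge_two_thirds ln_mono[of 2 u] assms by linarith
  have "ln v = ln r + ln u" using u r by (simp add: ln_mult)
  also have "ln r \<le> r - 1" using r by (intro ln_le_minus_one) auto
  also have "r - 1 \<le> (r - 1) * ((r + 1) * ln u)"
  proof -
    have "2 * (2 / 3) \<le> (r + 1) * ln u" using r \<open>2 / 3 \<le> ln u\<close> by (intro mult_mono) auto
    thus ?thesis using r mult_left_mono[of 1 "(r + 1) * ln u" "r - 1"] by simp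
  qed
  finally have "ln v \<le> r\<^sup>2 * ln u" by (simp add: algebra_simps power2_eq_square)
  hence "ln v / v\<^sup>2 \<le> r\<^sup>2 * ln u / v\<^sup>2" by (intro divide_right_mono) auto
  also have "\<dots> = ln u / u\<^sup>2" using u r by (simp add: power_mult_distrib)
  finally show ?thesis .
qed

lemma sum_ln_over_square_tail:
  assumes Y: "Y \<ge> 2"
  shows "(\<Sum>n\<in>{Y<..Z}. ln (real n) / (real n)\<^sup>2) \<le> (ln (real Y) + 1) / real Y"
proof (cases "Y \<le> Z")
  case True
  \<comment> \<open>Minus an antiderivative of \<open>ln u / u\<^sup>2\<close>.\<close>
  define \<phi> where "\<phi> u = (ln u + 1) / u" for u :: real
  have step: "ln (real (Suc m)) / (real (Suc m))\<^sup>2 \<le> \<phi> (real m) - \<phi> (real (Suc m))" if m: "m \<ge> 2" for m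
  proof -
    have "\<exists>u. real m < u \<and> u < real m + 1 \<and> \<phi> (real m + 1) - \<phi> (real m) = (real m + 1 - real m) * (- (ln u / u\<^sup>2))"
    proof (rule MVT2)
      fix u :: real assume "real m \<le> u" "u \<le> real m + 1"
      thus "(\<phi> has_real_derivative - (ln u / u\<^sup>2)) (at u)"
        unfolding \<phi>_def using m by (auto intro!: derivative_eq_intros simp: field_simps power2_eq_square)
    qed simp
    then obtain u where u: "real m < u" "u < real m + 1" "\<phi> (real m + 1) - \<phi> (real m) = - (ln u / u\<^sup>2)" by auto
    have "ln (real m + 1) / (real m + 1)\<^sup>2 \<le> ln u / u\<^sup>2" using u m by (intro ln_over_square_antimono) auto
    thus ?thesis using u(3) by (simp add: add.commute)
  qed
  have "(\<Sum>n\<in>{Y<..Z}. ln (real n) / (real n)\<^sup>2) \<le> \<phi> Y - \<phi> Z" using True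
  proof (induction Z rule: dec_induct)
    case (step Z)
    have "{Y<..Suc Z} = insert (Suc Z) {Y<..Z}" using step.hyps by auto
    thus ?case using step.IH \<open>\<And>m. m \<ge> 2 \<Longrightarrow> _\<close>[of Z] step.hyps Y by simp
  qed simp
  moreover have "\<phi> Z \<ge> 0" using True Y by (simp add: \<phi>_def)
  ultimately show ?thesis by (simp add: \<phi>_def)
qed (use Y in simp)

lemma sum_inverse_square_tail:
  assumes Y: "Y \<ge> 1"
  shows "(\<Sum>n\<in>{Y<..Z}. 1 / (real n)\<^sup>2) \<le> 1 / real Y"
proof (cases "Y \<le> Z")
  case True
  hence "(\<Sum>n\<in>{Y<..Z}. 1 / (real n)\<^sup>2) \<le> 1 / real Y - 1 / real Z"
  proof (induction Z rule: dec_induct)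
    case (step Z)
    have "{Y<..Suc Z} = insert (Suc Z) {Y<..Z}" using step.hyps by auto
    moreover have "1 / (real (Suc Z))\<^sup>2 \<le> 1 / real Z - 1 / real (Suc Z)"
    proof -
      have "1 / (a + 1)\<^sup>2 \<le> 1 / a - 1 / (a + 1)" if "a > 0" for a :: real
      proof -
        have "1 / (a + 1)\<^sup>2 \<le> 1 / (a * (a + 1))"
          using that by (intro divide_left_mono) (auto simp: power2_eq_square)
        also have "\<dots> = 1 / a - 1 / (a + 1)" using that by (simp add: field_simps)
        finally show ?thesis .
      qed
      from this[of "real Z"] show ?thesis using step.hyps Y by (simp add: add.commute)
    qed
    ultimately show ?case using step.IH by simp
  qed simp
  moreover have "1 / real Z \<ge> 0" by simp
  ultimately show ?thesis by linarith
qed simp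

lemma euler_mascheroni_nonneg: "(euler_mascheroni :: real) \<ge> 0"
proof (rule LIMSEQ_le_const[OF euler_mascheroni_LIMSEQ], intro exI[of _ 1] allI impI)
  show "0 \<le> harm n - ln (real n)" if "1 \<le> n" for n
    using euler_mascheroni_sequence_nonneg[of n] that by simp
qed

lemma euler_mascheroni_le_1: "(euler_mascheroni :: real) \<le> 1"
proof (rule LIMSEQ_le_const2[OF euler_mascheroni_LIMSEQ], intro exI[of _ 1] allI impI)
  show "harm n - ln (real n) \<le> 1" if "1 \<le> n" for n
    using harm_le_one_plus_ln[OF that] by simp
qed

text \<open>The three summands are the error in the divisor problem for \<open>d \<le> Y\<close>,
  the contribution of \<open>d > Y\<close>, and the price for completing the main-term sums over
  \<open>d \<le> Y\<close> to infinite series.\<close>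

lemma E_mu_bound:
  fixes x C1 C2 :: real and Y :: nat
  assumes C1: "C1 \<ge> 0" "\<And>N. N \<ge> 1 \<Longrightarrow> \<bar>mu_conv_sum N\<bar> \<le> C1 * (real N * exp (- (ln (real N) powr (38/100))))"
    and C2: "C2 \<ge> 0" "\<And>y. y \<ge> 1 \<Longrightarrow> \<bar>div_sum y - y * (ln y + 2 * euler_mascheroni - 1)\<bar> \<le> C2 * y powr (19/40)"
    and Y: "Y \<ge> 2" "real Y \<le> sqrt x"
  defines "\<kappa> \<equiv> C1 * exp (- (ln (real Y) powr (38/100)))"
  shows "\<bar>E_mu x\<bar> \<le> C2 * (x powr (19/40) * real Y powr (1/20) * (1 + ln x)\<^sup>2)
     + 2 * \<kappa> * sqrt x * (x / (real Y)\<^sup>2)\<^sup>2 + 9 * (x * \<kappa> * (ln x + 1) / real Y)"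
proof -
  define X where "X = nat \<lfloor>sqrt x\<rfloor>"
  define z z' where "z = Re (zeta 2)" and "z' = Re (deriv zeta 2)"
  define c where "c = ln x + 2 * euler_mascheroni - 1"
  have z: "z \<noteq> 0" unfolding z_def by (rule zeta_2_real(3))
  have x2: "sqrt x \<ge> 2" using Y by linarith
  have Yx: "(real Y)\<^sup>2 \<le> x"
  proof -
    have "(real Y)\<^sup>2 \<le> (sqrt x)\<^sup>2" using Y by (intro power_mono) auto
    moreover have "0 < sqrt x" using x2 by linarith
    hence "(sqrt x)\<^sup>2 = x" by simp
    ultimately show ?thesis by simp
  qed
  have "(2::real)\<^sup>2 \<le> (real Y)\<^sup>2" using Y by (intro power_mono) auto
  hence x: "x \<ge> 4" using Yx by simp
  have lnY: "0 \<le> ln (real Y)" "ln (real Y) \<le> ln x"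
  proof -
    show "0 \<le> ln (real Y)" using Y by simp
    have "real Y \<le> (real Y)\<^sup>2" using Y by (simp add: power2_eq_square)
    hence "real Y \<le> x" using Yx by (rule order_trans)
    thus "ln (real Y) \<le> ln x" using Y by (intro ln_mono) auto
  qed
  have YX: "Y \<le> X" unfolding X_def using Y x by (simp add: le_nat_iff le_floor_iff)
  have \<kappa>: "\<kappa> \<ge> 0" using C1 by (simp add: \<kappa>_def)
  have Hb: "\<bar>mu_conv_sum N\<bar> \<le> \<kappa> * real N" if N: "N \<ge> Y" for N
  proof -
    have "ln (real Y) \<le> ln (real N)" using N Y by (intro ln_mono) auto
    hence "exp (- (ln (real N) powr (38/100))) \<le> exp (- (ln (real Y) powr (38/100)))"
      using lnY by (simp add: powr_mono2)
    hence "C1 * (real N * exp (- (ln (real N) powr (38/100)))) \<le> C1 * (real N * exp (- (ln (real Y) powr (38/100))))"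
      using C1 by (intro mult_left_mono) auto
    moreover have "\<bar>mu_conv_sum N\<bar> \<le> C1 * (real N * exp (- (ln (real N) powr (38/100))))"
      using N Y by (intro C1) auto
    ultimately show ?thesis by (simp add: \<kappa>_def mult_ac)
  qed
  \<comment> \<open>Since \<open>ln (x / d\<^sup>2) = ln x - 2 * ln d\<close>, the main terms for
    \<open>d \<le> Y\<close> add up to \<open>x * (c * A - 2 * B)\<close>.\<close>
  define A B where "A = (\<Sum>d=1..Y. mu_conv d * (1 / (real d)\<^sup>2))" and "B = (\<Sum>d=1..Y. mu_conv d * (ln (real d) / (real d)\<^sup>2))"
  have A: "\<bar>1 / z\<^sup>2 - A\<bar> \<le> \<kappa> * (3 / real Y)"
  proof -
    have "\<bar>1 / z\<^sup>2 - A\<bar> \<le> \<kappa> * (2 * (Suc Y * (1 / (real (Suc Y))\<^sup>2)) + 1 / real Y)"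
      unfolding A_def
    proof (rule mu_conv_tail_abel[OF \<kappa> Hb])
      show "((\<lambda>n. mu_conv n * (1 / (real n)\<^sup>2)) has_sum 1 / z\<^sup>2) {0<..}"
        unfolding z_def by (rule mu_conv_series(1))
      show "1 / (real (Suc n))\<^sup>2 \<le> 1 / (real n)\<^sup>2" if "n > Y" for n
        using that by (intro divide_left_mono power_mono) auto
      show "(\<Sum>n\<in>{Y<..Z}. 1 / (real n)\<^sup>2) \<le> 1 / real Y" for Z
        using Y by (intro sum_inverse_square_tail) auto
    qed auto
    also have "Suc Y * (1 / (real (Suc Y))\<^sup>2) = 1 / real (Suc Y)" by (simp add: power2_eq_square del: of_nat_Suc)
    also have "\<kappa> * (2 * (1 / real (Suc Y)) + 1 / real Y) \<le> \<kappa> * (2 * (1 / real Y) + 1 / real Y)"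
      using \<kappa> Y by (intro mult_left_mono add_right_mono divide_left_mono) auto
    finally show ?thesis by simp
  qed
  have B: "\<bar>2 * z' / z ^ 3 - B\<bar> \<le> \<kappa> * (3 * ((ln x + 1) / real Y))"
  proof -
    have "\<bar>2 * z' / z ^ 3 - B\<bar> \<le> \<kappa> * (2 * (Suc Y * (ln (real (Suc Y)) / (real (Suc Y))\<^sup>2)) + (ln (real Y) + 1) / real Y)"
      unfolding B_def
    proof (rule mu_conv_tail_abel[OF \<kappa> Hb])
      show "((\<lambda>n. mu_conv n * (ln (real n) / (real n)\<^sup>2)) has_sum 2 * z' / z ^ 3) {0<..}"
        unfolding z_def z'_def by (rule mu_conv_series(2))
      show "ln (real (Suc n)) / (real (Suc n))\<^sup>2 \<le> ln (real n) / (real n)\<^sup>2" if "n > Y" for n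
        using that Y by (intro ln_over_square_antimono) auto
      show "(\<Sum>n\<in>{Y<..Z}. ln (real n) / (real n)\<^sup>2) \<le> (ln (real Y) + 1) / real Y" for Z
        by (rule sum_ln_over_square_tail[OF Y(1)])
    qed auto
    also have "Suc Y * (ln (real (Suc Y)) / (real (Suc Y))\<^sup>2) = ln (real (Suc Y)) / real (Suc Y)"
      by (simp add: power2_eq_square del: of_nat_Suc)
    also have "ln (real (Suc Y)) / real (Suc Y) \<le> (ln (real Y) + 1) / real Y"
    proof (rule frac_le)
      have "ln (real (Suc Y)) = ln (real Y) + ln (1 + 1 / real Y)"
      proof -
        have "real (Suc Y) = real Y * (1 + 1 / real Y)" using Y by (simp add: field_simps)
        moreover have "1 + 1 / real Y > 0" by (simp add: add_pos_nonneg)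
        ultimately show ?thesis using Y by (simp add: ln_mult del: of_nat_Suc)
      qed
      also have "ln (1 + 1 / real Y) \<le> 1 / real Y" by (intro ln_add_one_self_le_self) auto
      also have "1 / real Y \<le> 1" using Y by simp
      finally show "ln (real (Suc Y)) \<le> ln (real Y) + 1" by simp
    qed (use Y in auto)
    hence "\<kappa> * (2 * (ln (real (Suc Y)) / real (Suc Y)) + (ln (real Y) + 1) / real Y) \<le> \<kappa> * (2 * ((ln (real Y) + 1) / real Y) + (ln (real Y) + 1) / real Y)"
      using \<kappa> by (intro mult_left_mono add_right_mono) auto
    also have "\<dots> = \<kappa> * (3 * ((ln (real Y) + 1) / real Y))"
      by (rule arg_cong[where f = "\<lambda>t. \<kappa> * t"]) linarith
    also have "\<dots> \<le> \<kappa> * (3 * ((ln x + 1) / real Y))"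
      using \<kappa> lnY by (intro mult_left_mono divide_right_mono) auto
    finally show ?thesis .
  qed
  define T2 where "T2 = (\<Sum>d\<in>{Y<..X}. mu_conv d * div_sum (x / (real d)\<^sup>2))"
  define T1 where "T1 = (\<Sum>d=1..Y. mu_conv d * div_sum (x / (real d)\<^sup>2))"
  have S: "S_mu x = T1 + T2"
  proof -
    have "{1..X} = {1..Y} \<union> {Y<..X}" using YX by auto
    moreover have "S_mu x = (\<Sum>d\<in>{1..X}. mu_conv d * div_sum (x / (real d)\<^sup>2))"
      unfolding X_def using x by (intro S_mu_eq_sum_div_sum) auto
    ultimately show ?thesis unfolding T1_def T2_def
      by (simp only:) (rule sum.union_disjoint, auto)
  qed
  have T2: "\<bar>T2\<bar> \<le> 2 * \<kappa> * sqrt x * (x / (real Y)\<^sup>2)\<^sup>2"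
    unfolding T2_def X_def using x Y \<kappa> by (intro large_divisors_bound Hb) auto
  have T1: "\<bar>T1 - x * (c * A - 2 * B)\<bar> \<le> C2 * (x powr (19/40) * real Y powr (1/20) * (1 + ln x)\<^sup>2)"
  proof -
    have main: "x * (c * A - 2 * B) = (\<Sum>d=1..Y. mu_conv d * (x / (real d)\<^sup>2 * (ln (x / (real d)\<^sup>2) + 2 * euler_mascheroni - 1)))"
    proof -
      have "x * (c * A - 2 * B) = (\<Sum>d=1..Y. x * (c * (mu_conv d * (1 / (real d)\<^sup>2))) - x * (2 * (mu_conv d * (ln (real d) / (real d)\<^sup>2))))"
        unfolding A_def B_def by (simp only: sum_subtractf sum_distrib_left right_diff_distrib)
      also have "\<dots> = (\<Sum>d=1..Y. mu_conv d * (x / (real d)\<^sup>2 * (ln (x / (real d)\<^sup>2) + 2 * euler_mascheroni - 1)))"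
      proof (rule sum.cong[OF refl])
        fix d assume d: "d \<in> {1..Y}"
        have l: "ln (x / (real d)\<^sup>2) = ln x - 2 * ln (real d)" using d x by (simp add: ln_div ln_realpow)
        show "x * (c * (mu_conv d * (1 / (real d)\<^sup>2))) - x * (2 * (mu_conv d * (ln (real d) / (real d)\<^sup>2))) =
            mu_conv d * (x / (real d)\<^sup>2 * (ln (x / (real d)\<^sup>2) + 2 * euler_mascheroni - 1))"
          unfolding l c_def using d by (simp add: field_simps)
      qed
      finally show ?thesis .
    qed
    have eq: "T1 - x * (c * A - 2 * B) = (\<Sum>d=1..Y. mu_conv d * (div_sum (x / (real d)\<^sup>2) - x / (real d)\<^sup>2 * (ln (x / (real d)\<^sup>2) + 2 * euler_mascheroni - 1)))"
      unfolding main T1_def by (simp add: sum_subtractf right_diff_distrib)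
    have "\<bar>T1 - x * (c * A - 2 * B)\<bar> \<le> (\<Sum>d=1..Y. C2 * x powr (19/40) * (\<bar>mu_conv d\<bar> * real d powr (-19/20)))"
      unfolding eq
    proof (rule order_trans[OF sum_abs sum_mono])
      fix d assume d: "d \<in> {1..Y}"
      have "(real d)\<^sup>2 \<le> (real Y)\<^sup>2" using d by (intro power_mono) auto
      hence "(real d)\<^sup>2 \<le> x" using Yx by (rule order_trans)
      hence "x / (real d)\<^sup>2 \<ge> 1" using d by simp
      hence bd: "\<bar>div_sum (x / (real d)\<^sup>2) - x / (real d)\<^sup>2 * (ln (x / (real d)\<^sup>2) + 2 * euler_mascheroni - 1)\<bar> \<le> C2 * (x / (real d)\<^sup>2) powr (19/40)"
        by (rule C2(2))
      have pw: "(x / (real d)\<^sup>2) powr (19/40) = x powr (19/40) * real d powr (-19/20)"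
      proof -
        have "(x / (real d)\<^sup>2) powr (19/40) = x powr (19/40) / ((real d)\<^sup>2) powr (19/40)"
          by (rule powr_divide)
        also have "((real d)\<^sup>2) powr (19/40) = real d powr (19/20)"
          using powr_powr[of "real d" 2 "19/40"] d by simp
        finally show ?thesis using powr_minus_divide[of "real d" "19/20"] by simp
      qed
      have "\<bar>mu_conv d\<bar> * \<bar>div_sum (x / (real d)\<^sup>2) - x / (real d)\<^sup>2 * (ln (x / (real d)\<^sup>2) + 2 * euler_mascheroni - 1)\<bar> \<le>
          \<bar>mu_conv d\<bar> * (C2 * (x powr (19/40) * real d powr (-19/20)))"
        by (rule mult_left_mono[OF bd[unfolded pw]]) simp
      moreover have "h * (C2 * (s * t)) = C2 * s * (h * t)" for h s t :: real by simp
      ultimately show "\<bar>mu_conv d * (div_sum (x / (real d)\<^sup>2) - x / (real d)\<^sup>2 * (ln (x / (real d)\<^sup>2) + 2 * euler_mascheroni - 1))\<bar> \<le>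
          C2 * x powr (19/40) * (\<bar>mu_conv d\<bar> * real d powr (-19/20))"
        by (subst abs_mult) (simp only:)
    qed
    also have "\<dots> = C2 * x powr (19/40) * (\<Sum>d=1..Y. \<bar>mu_conv d\<bar> * real d powr (-19/20))"
      by (rule sum_distrib_left[symmetric])
    also have "\<dots> \<le> C2 * x powr (19/40) * (real Y powr (1/20) * (harm Y)\<^sup>2)"
      using C2(1) by (intro mult_left_mono[OF abs_mu_conv_weighted_sum] mult_nonneg_nonneg powr_ge_zero)
    also have "\<dots> \<le> C2 * x powr (19/40) * (real Y powr (1/20) * (1 + ln x)\<^sup>2)"
    proof -
      have "harm Y \<le> 1 + ln x" using harm_le_one_plus_ln[of Y] Y lnY by linarith
      hence "(harm Y)\<^sup>2 \<le> (1 + ln x)\<^sup>2" by (intro power_mono harm_nonneg)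
      thus ?thesis using C2(1) by (intro mult_left_mono mult_nonneg_nonneg powr_ge_zero)
    qed
    finally show ?thesis by (simp add: mult.assoc)
  qed
  have c: "\<bar>c\<bar> \<le> ln x + 1"
    using euler_mascheroni_nonneg euler_mascheroni_le_1 lnY unfolding c_def by (auto simp: abs_le_iff)
  \<comment> \<open>The main term in \<open>E_mu\<close> is \<open>x * (c * A - 2 * B)\<close> with
    \<open>A\<close> and \<open>B\<close> replaced by the full series \<open>1 / z\<^sup>2\<close>
    and \<open>2 * z' / z ^ 3\<close>. Their tails contribute 3 and 6 to the coefficient 9.\<close>
  have E: "E_mu x = (T1 - x * (c * A - 2 * B)) + T2 - x * (c * (1 / z\<^sup>2 - A)) + x * (2 * (2 * z' / z ^ 3 - B))"
  proof -
    have "x / z\<^sup>2 * (c - 4 * (z' / z)) = x * (c * (1 / z\<^sup>2) - 2 * (2 * z' / z ^ 3))"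
      using z by (simp add: field_simps power2_eq_square power3_eq_cube)
    moreover have "E_mu x = S_mu x - x / z\<^sup>2 * (c - 4 * (z' / z))"
      by (simp add: E_mu_def z_def z'_def c_def)
    moreover have "T1 + T2 - x * (c * p - 2 * r) = (T1 - x * (c * A - 2 * B)) + T2 - x * (c * (p - A)) + x * (2 * (r - B))"
      for p r by (simp add: algebra_simps)
    ultimately show ?thesis unfolding S by (simp only:)
  qed
  have "\<bar>x * (c * (1 / z\<^sup>2 - A))\<bar> \<le> x * ((ln x + 1) * (\<kappa> * (3 / real Y)))"
    using x c A lnY by (simp only: abs_mult) (intro mult_mono, auto)
  moreover have "\<bar>x * (2 * (2 * z' / z ^ 3 - B))\<bar> \<le> x * (2 * (\<kappa> * (3 * ((ln x + 1) / real Y))))"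
    using x B by (simp only: abs_mult) (intro mult_mono, auto)
  moreover have "x * ((ln x + 1) * (\<kappa> * (3 / real Y))) + x * (2 * (\<kappa> * (3 * ((ln x + 1) / real Y)))) = 9 * (x * \<kappa> * (ln x + 1) / real Y)"
    by (simp add: divide_inverse algebra_simps)
  ultimately show ?thesis using T1 T2 unfolding E by linarith
qed

text \<open>The splitting point is \<open>sqrt x * exp (- (ln x powr (35/100)))\<close>: the exponent must exceed \<open>1/3\<close>, and
  stay below the exponent \<open>38/100\<close> of the bound for \<open>mu_conv_sum\<close>.\<close>
lemma E_mu_eventually:
  "\<exists>C>0. eventually (\<lambda>x. \<bar>E_mu x\<bar> \<le> C * (x powr (1/2) * exp (- 1 * (ln x * ln (ln x)) powr (1/3)))) at_top"
proof -
  obtain C1 where C1: "C1 > 0" "\<And>N. N \<ge> 1 \<Longrightarrow> \<bar>mu_conv_sum N\<bar> \<le> C1 * (real N * exp (- (ln (real N) powr (38/100))))"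
    using mu_conv_sum_bound by blast
  obtain C2 where C2: "C2 > 0" "\<And>y. y \<ge> 1 \<Longrightarrow> \<bar>div_sum y - y * (ln y + 2 * euler_mascheroni - 1)\<bar> \<le> C2 * y powr (19/40)"
    using div_sum_asymptotic by blast
  define y where "y x = sqrt x * exp (- (ln x powr (35/100)))" for x :: real
  define F where "F x = x powr (1/2) * exp (- 1 * (ln x * ln (ln x)) powr (1/3))" for x :: real
  have e1: "eventually (\<lambda>x::real. y x \<ge> 4) at_top" unfolding y_def by real_asymp
  \<comment> \<open>The left side is \<open>sqrt x * exp (- (ln x powr (35/100)) / 20)\<close> times
    a squared logarithm.\<close>
  have e2: "eventually (\<lambda>x::real. x powr (19/40) * y x powr (1/20) * (1 + ln x)\<^sup>2 \<le> F x) at_top"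
    unfolding y_def F_def by real_asymp
  \<comment> \<open>Here \<open>y x / 2\<close> is a lower bound for the rounded splitting point.
    The last factor is \<open>16 * exp (4 * ln x powr (35/100))\<close> and loses against the first
    one with its exponent 38/100.\<close>
  have e3: "eventually (\<lambda>x::real. exp (- (ln (y x / 2) powr (38/100))) * sqrt x * (x / (y x / 2)\<^sup>2)\<^sup>2 \<le> F x) at_top"
    unfolding y_def F_def by real_asymp
  have e4: "eventually (\<lambda>x::real. x * exp (- (ln (y x / 2) powr (38/100))) * (ln x + 1) / (y x / 2) \<le> F x) at_top"
    unfolding y_def F_def by real_asymp
  have "eventually (\<lambda>x. \<bar>E_mu x\<bar> \<le> (C2 + 2 * C1 + 9 * C1) * F x) at_top"
    using e1 e2 e3 e4 eventually_ge_at_top[of 1]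
  proof eventually_elim
    case (elim x)
    define Y where "Y = nat \<lfloor>y x\<rfloor>"
    have Y: "real Y \<le> y x" "y x / 2 \<le> real Y" "2 \<le> Y" using elim(1) unfolding Y_def by linarith+
    have "y x \<le> sqrt x * 1" unfolding y_def using elim(5) by (intro mult_left_mono) auto
    hence Yx: "real Y \<le> sqrt x" using Y by simp
    have y0: "y x / 2 > 0" "y x / 2 \<ge> 2" using elim(1) by auto
    have lnx: "ln x \<ge> 0" using elim(5) by simp
    define k where "k = exp (- (ln (real Y) powr (38/100)))"
    define k' where "k' = exp (- (ln (y x / 2) powr (38/100)))"
    have "ln (y x / 2) powr (38/100) \<le> ln (real Y) powr (38/100)"
      using y0 Y by (intro powr_mono2 ln_mono) auto
    hence k: "k \<le> k'" "k \<ge> 0" "k' \<ge> 0" by (auto simp: k_def k'_def)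
    have "\<bar>E_mu x\<bar> \<le> C2 * (x powr (19/40) * real Y powr (1/20) * (1 + ln x)\<^sup>2)
       + 2 * (C1 * k) * sqrt x * (x / (real Y)\<^sup>2)\<^sup>2 + 9 * (x * (C1 * k) * (ln x + 1) / real Y)"
      unfolding k_def using C1 C2 Y Yx by (intro E_mu_bound) auto
    also have "\<dots> = C2 * (x powr (19/40) * real Y powr (1/20) * (1 + ln x)\<^sup>2)
       + 2 * C1 * (k * sqrt x * (x / (real Y)\<^sup>2)\<^sup>2) + 9 * C1 * (x * k * (ln x + 1) / real Y)"
      by (simp add: mult_ac)
    also have "\<dots> \<le> C2 * F x + 2 * C1 * F x + 9 * C1 * F x"
    proof (intro add_mono mult_left_mono)
      have "x powr (19/40) * real Y powr (1/20) * (1 + ln x)\<^sup>2 \<le> x powr (19/40) * y x powr (1/20) * (1 + ln x)\<^sup>2"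
        using Y by (intro mult_right_mono mult_left_mono powr_mono2) auto
      thus "x powr (19/40) * real Y powr (1/20) * (1 + ln x)\<^sup>2 \<le> F x" using elim(2) by linarith
      have "x / (real Y)\<^sup>2 \<le> x / (y x / 2)\<^sup>2"
        using Y y0 elim(5) by (intro divide_left_mono power_mono mult_pos_pos) auto
      hence "(x / (real Y)\<^sup>2)\<^sup>2 \<le> (x / (y x / 2)\<^sup>2)\<^sup>2" using elim(5) by (intro power_mono) auto
      hence "k * sqrt x * (x / (real Y)\<^sup>2)\<^sup>2 \<le> k' * sqrt x * (x / (y x / 2)\<^sup>2)\<^sup>2"
        using k elim(5) by (intro mult_mono) auto
      thus "k * sqrt x * (x / (real Y)\<^sup>2)\<^sup>2 \<le> F x" using elim(3) unfolding k'_def by linarith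
      have "x * k * (ln x + 1) / real Y \<le> x * k' * (ln x + 1) / (y x / 2)"
        using k Y y0 lnx elim(5) by (intro frac_le mult_mono) auto
      thus "x * k * (ln x + 1) / real Y \<le> F x" using elim(4) unfolding k'_def by linarith
    qed (use C1 C2 in auto)
    finally show ?case by (simp add: algebra_simps)
  qed
  thus ?thesis using C1 C2 unfolding F_def by (intro exI[of _ "C2 + 2 * C1 + 9 * C1"]) auto
qed

theorem theorem2:
  shows "\<exists>A>0. \<exists>C>0. \<forall>x::real. x > 5 \<longrightarrow>
           \<bar>E_mu x\<bar> \<le> C * (x powr (1/2) * exp (- A * (ln x * ln (ln x)) powr (1/3)))"
proof -
  define F where "F x = x powr (1/2) * exp (- 1 * (ln x * ln (ln x)) powr (1/3))" for x :: real
  obtain C x0 where C: "C > 0" and x0: "\<And>x. x \<ge> x0 \<Longrightarrow> \<bar>E_mu x\<bar> \<le> C * F x"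
    using E_mu_eventually unfolding F_def eventually_at_top_linorder by blast
  define X where "X = max x0 5"
  define z z' where "z = Re (zeta 2)" and "z' = Re (deriv zeta 2)"
  define B where "B = X\<^sup>2 + X / z\<^sup>2 * (ln X + 1 + 4 * \<bar>z' / z\<bar>)"
  define m where "m = exp (- 1 * (ln X * ln (ln X)) powr (1/3))"
  have m: "m > 0" by (simp add: m_def)
  \<comment> \<open>On the bounded range a trivial bound for \<open>E_mu\<close> is compared with a
    positive lower bound for \<open>F\<close>. As 5 exceeds \<open>exp 1\<close>,
    \<open>ln (ln x)\<close> is positive, so the exponential factor of \<open>F\<close> decreases
    and is at least its value \<open>m\<close> at \<open>X\<close>.\<close>
  have small: "\<bar>E_mu x\<bar> \<le> B \<and> m \<le> F x" if x: "x > 5" "x \<le> X" for x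
  proof
    have "exp 1 < (5 :: real)" using exp_le by linarith
    hence "ln (exp 1) < ln x" using x by (subst ln_less_cancel_iff) auto
    hence lnx: "ln x > 1" by simp
    have lnX: "ln x \<le> ln X" using x by (intro ln_mono) auto
    have "\<bar>S_mu x\<bar> \<le> (\<Sum>p\<in>{(m :: nat, n :: nat). m > 0 \<and> n > 0 \<and> real (m * n) \<le> x}. 1)"
      unfolding S_mu_def
    proof (rule order_trans[OF sum_abs sum_mono])
      fix p :: "nat \<times> nat"
      obtain m n where p: "p = (m, n)" by (cases p)
      have "real_of_int \<bar>moebius_mu (gcd m n)\<bar> \<le> 1" using abs_moebius_mu_le[of "gcd m n"] by linarith
      thus "\<bar>case p of (m, n) \<Rightarrow> real_of_int (moebius_mu (gcd m n))\<bar> \<le> 1" by (simp add: p)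
    qed
    also have "\<dots> \<le> x\<^sup>2" using card_pairs_le_square[of x] x by simp
    also have "\<dots> \<le> X\<^sup>2" using x by (intro power_mono) auto
    finally have S: "\<bar>S_mu x\<bar> \<le> X\<^sup>2" .
    have c: "\<bar>ln x + 2 * euler_mascheroni - 1 - 4 * (z' / z)\<bar> \<le> ln X + 1 + 4 * \<bar>z' / z\<bar>"
      using euler_mascheroni_nonneg euler_mascheroni_le_1 lnx lnX by linarith
    have "\<bar>x / z\<^sup>2 * (ln x + 2 * euler_mascheroni - 1 - 4 * (z' / z))\<bar> = x / z\<^sup>2 * \<bar>ln x + 2 * euler_mascheroni - 1 - 4 * (z' / z)\<bar>"
      using x by (simp add: abs_mult)
    also have "\<dots> \<le> X / z\<^sup>2 * (ln X + 1 + 4 * \<bar>z' / z\<bar>)"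
      using c x by (intro mult_mono divide_right_mono) auto
    finally have "\<bar>x / z\<^sup>2 * (ln x + 2 * euler_mascheroni - 1 - 4 * (z' / z))\<bar> \<le> X / z\<^sup>2 * (ln X + 1 + 4 * \<bar>z' / z\<bar>)" .
    moreover have "E_mu x = S_mu x - x / z\<^sup>2 * (ln x + 2 * euler_mascheroni - 1 - 4 * (z' / z))"
      by (simp add: E_mu_def z_def z'_def)
    ultimately show "\<bar>E_mu x\<bar> \<le> B" using S unfolding B_def by linarith
    have "ln x * ln (ln x) \<le> ln X * ln (ln X)" using lnx lnX by (intro mult_mono ln_mono[of "ln x" "ln X"]) auto
    hence "(ln x * ln (ln x)) powr (1/3) \<le> (ln X * ln (ln X)) powr (1/3)"
      using lnx by (intro powr_mono2) auto
    hence "m \<le> exp (- 1 * (ln x * ln (ln x)) powr (1/3))" by (simp add: m_def)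
    also have "\<dots> \<le> F x" unfolding F_def using x by (simp add: ge_one_powr_ge_zero)
    finally show "m \<le> F x" .
  qed
  have "\<bar>E_mu x\<bar> \<le> (C + \<bar>B\<bar> / m) * F x" if x: "x > 5" for x
  proof (cases "x \<le> X")
    case True
    have "F x \<ge> m" "\<bar>E_mu x\<bar> \<le> \<bar>B\<bar>" using small[OF x True] by auto
    hence "\<bar>E_mu x\<bar> \<le> \<bar>B\<bar> / m * F x" using m
      by (smt (verit) mult_left_mono nonzero_eq_divide_eq divide_nonneg_pos abs_ge_zero)
    also have "\<dots> \<le> (C + \<bar>B\<bar> / m) * F x" using C \<open>F x \<ge> m\<close> m by (intro mult_right_mono) auto
    finally show ?thesis .
  next
    case False
    hence "\<bar>E_mu x\<bar> \<le> C * F x" by (intro x0) (simp add: X_def)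
    also have "\<dots> \<le> (C + \<bar>B\<bar> / m) * F x" using m by (intro mult_right_mono) (auto simp: F_def)
    finally show ?thesis .
  qed
  moreover have "C + \<bar>B\<bar> / m > 0" using C m by (simp add: add_pos_nonneg)
  ultimately show ?thesis unfolding F_def
    by (intro exI[of _ 1] conjI exI[of _ "C + \<bar>B\<bar> / m"]) auto
qed


end
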